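(* Let $k$ be a field, $n$ a positive integer, $q\in k^\times$ arbitrary, and $A=\mathcal{O}_q(M_n(k))$. The antipreferred products $[T\mid T']$, as $(T,T')$ runs over all antipreferred bitableaux, form a $k$-basis for $A$.
   Context: $A=\mathcal{O}_q(M_n(k))$ is the $k$-algebra with generators $X_{ij}$ ($1\le i,j\le n$) and relations $X_{ij}X_{lj}=qX_{lj}X_{ij}$ for $i<l$; $X_{ij}X_{im}=qX_{im}X_{ij}$ for $j<m$; $X_{ij}X_{lm}=X_{lm}X_{ij}$ for $i<l$, $j>m$; $X_{ij}X_{lm}-X_{lm}X_{ij}=(q-q^{-1})X_{im}X_{lj}$ for $i<l$, $j<m$. For subsets $I=\{i_1<\cdots<i_s\}$, $J=\{j_1<\cdots<j_s\}$ of $\{1,\dots,n\}$ of the same cardinality, the quantum minor is $[I\mid J]=\sum_{\sigma\in S_s}(-q)^{\ell(\sigma)}X_{i_1j_{\sigma(1)}}\cdots X_{i_sj_{\sigma(s)}}$. A tableau is a Young diagram (left-justified rows of weakly decreasing lengths, possibly empty) with an entry in each box; here entries are in $\{1,\dots,n\}$. A tableau is increasing (respectively, decreasing) if all its rows are strictly increasing (respectively, strictly decreasing) from left to right and all its columns are nondecreasing (respectively, nonincreasing) from top to bottom. A bitableau is a pair $(T,T')$ of tableaux of the same shape; it is antipreferred if $T$ is increasing and $T'$ is decreasing. If the $j$-th rows of $T$ and $T'$ have entry sets $I_j$ and $J_j$ ($j=1,\dots,l$), then $[T\mid T']=[I_1\mid J_1][I_2\mid J_2]\cdots[I_l\mid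 J_l]$ (equal to $1$ for the empty bitableau); it is called an antipreferred product when $(T,T')$ is antipreferred. *)

theory Defs
  imports
    "HOL-Library.Poly_Mapping"
    "HOL-Combinatorics.Permutations"
    "HOL-Algebra.Algebra"
    "HOL-Algebra.Algebraic_Closure_Type"
begin

section \<open>The free algebra on the generators \<open>X\<^sub>i\<^sub>j\<close>\<close>

text \<open>
  The free monoid is written additively, so that the convolution product of
  \<^theory>\<open>HOL-Library.Poly_Mapping\<close> turns finitely supported functions
  \<open>'g word \<Rightarrow>\<^sub>0 'k\<close> into the free associative \<open>'k\<close>-algebra on \<open>'g\<close>.
\<close>

datatype 'g word = Word (letters: "'g list")

instantiation word :: (type) monoid_add
begin

definition zero_word :: "'a word" where
  "0 = Word []"

definition plus_word :: "'a word \<Rightarrow> 'a word \<Rightarrow> 'a word" where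
  "u + v = Word (letters u @ letters v)"

instance
  by standard (simp_all add: zero_word_def plus_word_def)

end

type_synonym 'k free_alg = "(nat \<times> nat) word \<Rightarrow>\<^sub>0 'k"

definition scalar :: "'k::field \<Rightarrow> 'k free_alg" where
  "scalar c = Poly_Mapping.single 0 c"

definition Xgen :: "nat \<Rightarrow> nat \<Rightarrow> 'k::field free_alg" where
  "Xgen i j = Poly_Mapping.single (Word [(i, j)]) 1"

text \<open>Only the letters \<open>(i, j)\<close> with \<open>1 \<le> i, j \<le> n\<close> are generators.\<close>

definition free_algebra :: "nat \<Rightarrow> 'k::field free_alg ring" where
  "free_algebra n =
     \<lparr>carrier = {f. \<forall>w \<in> Poly_Mapping.keys f. set (letters w) \<subseteq> {1..n} \<times> {1..n}},
      monoid.mult = (*), one = 1, ring.zero = 0, add = (+)\<rparr>"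


section \<open>Quantum matrices\<close>

definition qmat_relations :: "nat \<Rightarrow> 'k::field \<Rightarrow> 'k free_alg set" where
  "qmat_relations n q =
     {Xgen i j * Xgen l j - scalar q * Xgen l j * Xgen i j | i j l.
        {i, j, l} \<subseteq> {1..n} \<and> i < l} \<union>
     {Xgen i j * Xgen i m - scalar q * Xgen i m * Xgen i j | i j m.
        {i, j, m} \<subseteq> {1..n} \<and> j < m} \<union>
     {Xgen i j * Xgen l m - Xgen l m * Xgen i j | i j l m.
        {i, j, l, m} \<subseteq> {1..n} \<and> i < l \<and> j > m} \<union>
     {Xgen i j * Xgen l m - Xgen l m * Xgen i j - scalar (q - inverse q) * Xgen i m * Xgen l j | i j l m.
        {i, j, l, m} \<subseteq> {1..n} \<and> i < l \<and> j < m}"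

definition qmat_ideal :: "nat \<Rightarrow> 'k::field \<Rightarrow> 'k free_alg set" where
  "qmat_ideal n q = Idl\<^bsub>free_algebra n\<^esub> (qmat_relations n q)"

definition qmat_class :: "nat \<Rightarrow> 'k::field \<Rightarrow> 'k free_alg \<Rightarrow> 'k free_alg set" where
  "qmat_class n q f = qmat_ideal n q +>\<^bsub>free_algebra n\<^esub> f"

text \<open>
  The quotient ring together with its \<open>k\<close>-module structure; a scalar acts as
  multiplication by the class of the corresponding constant.
\<close>

definition qmat :: "nat \<Rightarrow> 'k::field \<Rightarrow> ('k, 'k free_alg set) module" where
  "qmat n q =
     (let Q = free_algebra n Quot qmat_ideal n q in
       \<lparr>carrier = carrier Q, monoid.mult = (\<lambda>a b. a \<otimes>\<^bsub>Q\<^esub> b), one = \<one>\<^bsub>Q\<^esub>,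
        ring.zero = \<zero>\<^bsub>Q\<^esub>, add = (\<lambda>a b. a \<oplus>\<^bsub>Q\<^esub> b),
        module.smult = (\<lambda>c a. qmat_class n q (scalar c) \<otimes>\<^bsub>Q\<^esub> a)\<rparr>)"


section \<open>Quantum minors\<close>

definition perm_length :: "nat \<Rightarrow> (nat \<Rightarrow> nat) \<Rightarrow> nat" where
  "perm_length s \<sigma> = card {(a, b). a < b \<and> b < s \<and> \<sigma> b < \<sigma> a}"

definition ordered_prod :: "('a, 'm) monoid_scheme \<Rightarrow> 'a list \<Rightarrow> 'a" where
  "ordered_prod M xs = foldr (\<lambda>x y. x \<otimes>\<^bsub>M\<^esub> y) xs \<one>\<^bsub>M\<^esub>"

text \<open>
  Positions in \<open>I\<close> and \<open>J\<close> are counted from \<open>0\<close>, so \<open>S\<^sub>s\<close> acts on \<open>{..<s}\<close>.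
  Only used for \<open>card I = card J\<close>.
\<close>

definition qminor :: "nat \<Rightarrow> 'k::field \<Rightarrow> nat set \<Rightarrow> nat set \<Rightarrow> 'k free_alg set" where
  "qminor n q I J =
     (\<Oplus>\<^bsub>qmat n q\<^esub> \<sigma> \<in> {\<sigma>. \<sigma> permutes {..<card I}}.
        (- q) ^ perm_length (card I) \<sigma> \<odot>\<^bsub>qmat n q\<^esub>
        ordered_prod (qmat n q)
          (map (\<lambda>a. qmat_class n q
                 (Xgen (sorted_list_of_set I ! a) (sorted_list_of_set J ! \<sigma> a)))
             [0..<card I]))"


section \<open>Tableaux and bitableaux\<close>

text \<open>A tableau is the list of its rows, from top to bottom; there are no empty rows.\<close>

type_synonym tableau = "nat list list"

definition is_tableau :: "nat \<Rightarrow> tableau \<Rightarrow> bool" where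
  "is_tableau n T \<longleftrightarrow>
     [] \<notin> set T \<and> sorted_wrt (\<ge>) (map length T) \<and> (\<forall>r \<in> set T. set r \<subseteq> {1..n})"

definition increasing_tableau :: "tableau \<Rightarrow> bool" where
  "increasing_tableau T \<longleftrightarrow>
     (\<forall>r \<in> set T. sorted_wrt (<) r) \<and>
     (\<forall>a b c. a < b \<and> b < length T \<and> c < length (T ! b) \<longrightarrow> T ! a ! c \<le> T ! b ! c)"

definition decreasing_tableau :: "tableau \<Rightarrow> bool" where
  "decreasing_tableau T \<longleftrightarrow>
     (\<forall>r \<in> set T. sorted_wrt (>) r) \<and>
     (\<forall>a b c. a < b \<and> b < length T \<and> c < length (T ! b) \<longrightarrow> T ! a ! c \<ge> T ! b ! c)"

definition bitableaux :: "nat \<Rightarrow> (tableau \<times> tableau) set" where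
  "bitableaux n =
     {(T, T'). is_tableau n T \<and> is_tableau n T' \<and> map length T = map length T'}"

definition antipreferred_bitableaux :: "nat \<Rightarrow> (tableau \<times> tableau) set" where
  "antipreferred_bitableaux n =
     {(T, T') \<in> bitableaux n. increasing_tableau T \<and> decreasing_tableau T'}"

definition bitableau_prod ::
  "nat \<Rightarrow> 'k::field \<Rightarrow> tableau \<times> tableau \<Rightarrow> 'k free_alg set" where
  "bitableau_prod n q = (\<lambda>(T, T').
     ordered_prod (qmat n q) (map2 (\<lambda>r r'. qminor n q (set r) (set r')) T T'))"


section \<open>Bases\<close>

text \<open>A basis is an indexed family, so in particular its members are pairwise distinct.\<close>

definition is_basis ::
  "('k, 'r) ring_scheme \<Rightarrow> ('k, 'a, 'm) module_scheme \<Rightarrow> 'i set \<Rightarrow> ('i \<Rightarrow> 'a) \<Rightarrow> bool" where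
  "is_basis K M B b \<longleftrightarrow>
     b \<in> B \<rightarrow> carrier M \<and>
     (\<forall>F c. finite F \<and> F \<subseteq> B \<and> c \<in> F \<rightarrow> carrier K \<and>
        (\<Oplus>\<^bsub>M\<^esub> i \<in> F. c i \<odot>\<^bsub>M\<^esub> b i) = \<zero>\<^bsub>M\<^esub> \<longrightarrow> (\<forall>i \<in> F. c i = \<zero>\<^bsub>K\<^esub>)) \<and>
     (\<forall>x \<in> carrier M. \<exists>F c. finite F \<and> F \<subseteq> B \<and> c \<in> F \<rightarrow> carrier K \<and>
        x = (\<Oplus>\<^bsub>M\<^esub> i \<in> F. c i \<odot>\<^bsub>M\<^esub> b i))"


section \<open>Well-formedness of the construction\<close>

lemma keys_free_mult:
  fixes f g :: "'k::field free_alg"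
  assumes "w \<in> Poly_Mapping.keys (f * g)"
  obtains u v where "u \<in> Poly_Mapping.keys f" "v \<in> Poly_Mapping.keys g" "w = u + v"
  using assms keys_mult[of f g] by blast

lemma free_algebra_ring: "ring (free_algebra n :: 'k::field free_alg ring)"
proof (rule ringI)
  let ?F = "free_algebra n :: 'k free_alg ring"
  have add: "x + y \<in> carrier ?F" if "x \<in> carrier ?F" "y \<in> carrier ?F" for x y
    using that keys_add[of x y] by (auto simp: free_algebra_def)
  have neg: "- x \<in> carrier ?F" if "x \<in> carrier ?F" for x
    using that by (auto simp: free_algebra_def in_keys_iff)
  have mult: "x * y \<in> carrier ?F" if xy: "x \<in> carrier ?F" "y \<in> carrier ?F" for x y
    unfolding free_algebra_def
  proof (simp, rule ballI)
    fix w assume "w \<in> Poly_Mapping.keys (x * y)"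
    then obtain u v where "u \<in> Poly_Mapping.keys x" "v \<in> Poly_Mapping.keys y" "w = u + v"
      by (rule keys_free_mult)
    then show "set (letters w) \<subseteq> {Suc 0..n} \<times> {Suc 0..n}"
      using xy by (auto simp: free_algebra_def plus_word_def)
  qed
  have zero: "0 \<in> carrier ?F" and one: "1 \<in> carrier ?F"
    by (auto simp: free_algebra_def zero_word_def)
  have ops: "\<And>x y. x \<oplus>\<^bsub>?F\<^esub> y = x + y" "\<And>x y. x \<otimes>\<^bsub>?F\<^esub> y = x * y"
    "\<zero>\<^bsub>?F\<^esub> = 0" "\<one>\<^bsub>?F\<^esub> = 1"
    by (simp_all add: free_algebra_def)
  show "abelian_group ?F"
  proof (rule abelian_groupI, unfold ops)
    fix x assume "x \<in> carrier ?F"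
    then show "\<exists>y\<in>carrier ?F. y + x = 0"
      by (intro bexI[of _ "- x"] neg) simp_all
  qed (simp_all add: add zero add.assoc add.commute)
  show "Group.monoid ?F"
    by (rule monoidI) (simp_all add: ops mult one mult.assoc)
qed (simp_all add: free_algebra_def distrib_left distrib_right)

lemma scalar_mult: "scalar c * scalar d = scalar (c * d)"
  by (simp add: scalar_def mult_single)

lemma scalar_in_carrier [simp]: "scalar c \<in> carrier (free_algebra n)"
  by (auto simp: free_algebra_def scalar_def zero_word_def)

lemma Xgen_in_carrier: "i \<in> {1..n} \<Longrightarrow> j \<in> {1..n} \<Longrightarrow> Xgen i j \<in> carrier (free_algebra n)"
  by (auto simp: free_algebra_def Xgen_def)

lemma qmat_relations_carrier: "qmat_relations n q \<subseteq> carrier (free_algebra n)"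
proof -
  interpret R: ring "free_algebra n :: 'a free_alg ring" by (rule free_algebra_ring)
  let ?F = "free_algebra n :: 'a free_alg ring"
  have m: "x * y \<in> carrier ?F" if "x \<in> carrier ?F" "y \<in> carrier ?F" for x y
    using R.m_closed[OF that] by (simp add: free_algebra_def)
  have d: "x - y \<in> carrier ?F" if "x \<in> carrier ?F" "y \<in> carrier ?F" for x y
    using that keys_diff[of x y] by (auto simp: free_algebra_def)
  show ?thesis
    by (auto simp: qmat_relations_def intro!: m d Xgen_in_carrier)
qed

lemma qmat_ideal_ideal: "ideal (qmat_ideal n q) (free_algebra n)"
  unfolding qmat_ideal_def
  by (intro ring.genideal_ideal free_algebra_ring qmat_relations_carrier)

lemma qmat_class_ring_hom:
  "qmat_class n q \<in> ring_hom (free_algebra n) (free_algebra n Quot qmat_ideal n q)"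
  using ideal.rcos_ring_hom[OF qmat_ideal_ideal]
  by (simp add: qmat_class_def[abs_def])

lemma qmat_ring: "ring (qmat n q)"
proof -
  interpret Q: ring "free_algebra n Quot qmat_ideal n q"
    by (intro ideal.quotient_is_ring qmat_ideal_ideal)
  show ?thesis
  proof (rule ringI)
    show "abelian_group (qmat n q)"
    proof (rule abelian_groupI)
      fix x assume "x \<in> carrier (qmat n q)"
      then show "\<exists>y\<in>carrier (qmat n q). y \<oplus>\<^bsub>qmat n q\<^esub> x = \<zero>\<^bsub>qmat n q\<^esub>"
        using Q.l_neg Q.a_inv_closed by (auto simp: qmat_def Let_def)
    qed (auto simp: qmat_def Let_def Q.a_ac)
    show "Group.monoid (qmat n q)"
      by (rule monoidI) (auto simp: qmat_def Let_def Q.m_assoc)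
  qed (auto simp: qmat_def Let_def Q.l_distr Q.r_distr)
qed

lemma qmat_module: "module ring_of_type_algebra (qmat n (q :: 'k::field))"
proof -
  let ?F = "free_algebra n :: 'k free_alg ring"
  interpret Q: ring "?F Quot qmat_ideal n q"
    by (intro ideal.quotient_is_ring qmat_ideal_ideal)
  interpret A: ring "qmat n q" by (rule qmat_ring)
  note h = qmat_class_ring_hom[of n q]
  have cl: "qmat_class n q (scalar c) \<in> carrier (?F Quot qmat_ideal n q)" for c
    using h by (simp add: ring_hom_closed)
  have ca: "scalar (c + d) = scalar c \<oplus>\<^bsub>?F\<^esub> scalar d" for c d :: 'k
    by (simp add: free_algebra_def scalar_def single_add)
  have cm: "scalar (c * d) = scalar c \<otimes>\<^bsub>?F\<^esub> scalar d" for c d :: 'k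
    by (simp add: free_algebra_def scalar_mult)
  have c1: "scalar 1 = \<one>\<^bsub>?F\<^esub>"
    by (simp add: free_algebra_def scalar_def)
  show ?thesis
    by (rule moduleI)
      (auto simp: ring_of_type_algebra_def qmat_def Let_def cl ca cm c1
         ring_hom_add[OF h] ring_hom_mult[OF h] ring_hom_one[OF h]
         Q.l_distr Q.r_distr Q.m_assoc
       intro: A.abelian_group_axioms[unfolded qmat_def Let_def]
         cring_from_type_algebra[unfolded ring_of_type_algebra_def])
qed

end

theory Submission
  imports Defs "HOL-Combinatorics.Multiset_Permutations" "HOL-Library.Fun_Lexorder"
begin

text \<open>
  Independence. The algebra acts on functions on the exponents of a quantum torus through a product
  of \<open>3 n\<close> bidiagonal quantum matrices with mutually commuting entries: \<open>n\<close> lower ones, \<open>n\<close> upper ones,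
  \<open>n\<close> lower ones. By Cauchy--Binet the minor \<open>[I | J]\<close> becomes a sum over families of disjoint
  paths from \<open>I\<close> to \<open>J\<close>. Ordered lexicographically by time there is a unique leading family: \<open>I\<close> falls
  greedily to \<open>{1, \<dots>, s}\<close>, rises to \<open>{n - s + 1, \<dots>, n}\<close>, and falls to \<open>J\<close> as late as possible. Leading
  exponents add up in products; the first third of the exponent of an antipreferred product determines \<open>T\<close>
  and the last third determines \<open>T'\<close>, so distinct antipreferred products have distinct leading exponents.

  Spanning. In degree \<open>d\<close> the algebra is spanned by the lexicographically sorted words, which correspond to the
  matrices over the naturals with entry sum \<open>d\<close>. The Robinson--Schensted--Knuth correspondence, in
  its growth diagram form, injects these matrices into the antipreferred bitableaux with \<open>d\<close> boxes.
  Since the antipreferred products are independent, they span each degree.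
\<close>


section \<open>Quantum matrices over a ring\<close>

text \<open>The three thirds serve to separate \<open>I\<close> from \<open>J\<close>. Falling paths
  record entries by the times at which they fall, and in the first third these times depend on
  \<open>I\<close> alone. The rising third lifts every family of \<open>s\<close> paths to the same
  top positions and so erases \<open>I\<close>, after which the falls depend on \<open>J\<close>
  alone. Crossing all positions takes fewer than \<open>n\<close> steps, hence \<open>n\<close>
  layers each. An entry that already has the least value possible in its column never falls; it is
  recovered from the shape, which the start of the middle third displays.

  Every minor of a bidiagonal layer is zero or one monomial, so each leading coefficient is a power
  of \<open>q\<close>, and roots of unity call for no special care.

  For spanning, each sorted word of length \<open>d\<close> yields one bitableau. Expanding the
  products in sorted words gives a square matrix; a linear relation among its rows would be a
  relation among antipreferred products modulo the ideal, so the matrix is invertible and every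
  sorted word is a combination of the products.\<close>

text \<open>
  Laplace expansion along the first row. The rows form an arbitrary list, so that the alternating
  property becomes a statement about swapping adjacent rows.
\<close>

fun qdet :: "'r::ring_1 \<Rightarrow> (nat \<Rightarrow> nat \<Rightarrow> 'r) \<Rightarrow> nat list \<Rightarrow> nat set \<Rightarrow> 'r" where
  "qdet z Y [] J = (if J = {} then 1 else 0)"
| "qdet z Y (i # is) J =
     (\<Sum>j\<in>J. (- z) ^ card {j' \<in> J. j' < j} * Y i j * qdet z Y is (J - {j}))"

definition mat_prod :: "nat set \<Rightarrow> (nat \<Rightarrow> nat \<Rightarrow> 'r::ring_1) \<Rightarrow> (nat \<Rightarrow> nat \<Rightarrow> 'r) \<Rightarrow> nat \<Rightarrow> nat \<Rightarrow> 'r" where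
  "mat_prod S M N i j = (\<Sum>k\<in>S. M i k * N k j)"

text \<open>The parameter is a central unit of the ring itself; in the application it is the
  operator of multiplication by \<open>q\<close>.\<close>

locale quantum_parameter =
  fixes z w :: "'r::ring_1" and S :: "nat set"
  assumes inv: "z * w = 1" and central: "\<And>x. z * x = x * z" and fin: "finite S"
begin

lemma inv': "w * z = 1"
  using inv central by metis

lemma central': "w * x = x * w"
  by (metis central inv inv' mult.assoc mult.left_neutral mult.right_neutral)

lemma central_pow: "(- z) ^ k * x = x * (- z) ^ k"
  by (metis central power_commuting_commutes mult_minus_left mult_minus_right)

lemma central_pow_left: "x * ((- z) ^ k * y) = (- z) ^ k * (x * y)"
  by (metis central_pow mult.assoc)

text \<open>
  All defining relations in the single form \<open>R T\<^sub>1 T\<^sub>2 = T\<^sub>2 T\<^sub>1 R\<close>, which is visibly stable under products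
  of matrices whose entries commute with each other.
\<close>

definition qmatrix :: "(nat \<Rightarrow> nat \<Rightarrow> 'r) \<Rightarrow> bool" where
  "qmatrix Y \<longleftrightarrow> (\<forall>i\<in>S. \<forall>l\<in>S. \<forall>j\<in>S. \<forall>m\<in>S.
     (if i = l then z else 1) * (Y l j * Y i m) + (if i < l then z - w else 0) * (Y i j * Y l m) =
     (if j = m then z else 1) * (Y i m * Y l j) + (if j < m then z - w else 0) * (Y i j * Y l m))"

lemma qmatrixD:
  assumes "qmatrix Y" "i \<in> S" "l \<in> S" "j \<in> S" "m \<in> S"
  shows "(if i = l then z else 1) * (Y l j * Y i m) + (if i < l then z - w else 0) * (Y i j * Y l m) =
     (if j = m then z else 1) * (Y i m * Y l j) + (if j < m then z - w else 0) * (Y i j * Y l m)"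
  using assms unfolding qmatrix_def by blast

lemma qmatrix_row:
  assumes "qmatrix Y" "i \<in> S" "j \<in> S" "m \<in> S" "j < m"
  shows "Y i j * Y i m = z * (Y i m * Y i j)"
proof -
  have "z * (Y i j * Y i m) = Y i m * Y i j + (z - w) * (Y i j * Y i m)"
    using qmatrixD[OF assms(1,2,2,3,4)] assms(5) by simp
  then have "w * (Y i j * Y i m) = Y i m * Y i j"
    by (simp add: algebra_simps)
  then have "z * w * (Y i j * Y i m) = z * (Y i m * Y i j)"
    by (simp add: mult.assoc)
  then show ?thesis by (simp add: inv)
qed

lemma qmatrix_col:
  assumes "qmatrix Y" "i \<in> S" "l \<in> S" "j \<in> S" "i < l"
  shows "Y i j * Y l j = z * (Y l j * Y i j)"
proof -
  have "Y l j * Y i j + (z - w) * (Y i j * Y l j) = z * (Y i j * Y l j)"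
    using qmatrixD[OF assms(1,2,3,4,4)] assms(5) by simp
  then have "w * (Y i j * Y l j) = Y l j * Y i j"
    by (simp add: algebra_simps)
  then have "z * w * (Y i j * Y l j) = z * (Y l j * Y i j)"
    by (simp add: mult.assoc)
  then show ?thesis by (simp add: inv)
qed

lemma qmatrix_anti:
  assumes "qmatrix Y" "i \<in> S" "l \<in> S" "j \<in> S" "m \<in> S" "i < l" "j < m"
  shows "Y i m * Y l j = Y l j * Y i m"
  using qmatrixD[OF assms(1-5)] assms(6,7) by simp

lemma qmatrix_diag:
  assumes "qmatrix Y" "i \<in> S" "l \<in> S" "j \<in> S" "m \<in> S" "i < l" "j < m"
  shows "Y i j * Y l m - Y l m * Y i j = (z - w) * (Y i m * Y l j)"
  using qmatrixD[OF assms(1,3,2,4,5)] assms(6,7) qmatrix_anti[OF assms] by simp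

text \<open>Both sides are double sums over intermediate indices \<open>a\<close>, \<open>b\<close>.
  The relation of \<open>M\<close> moves the coefficients from the rows \<open>i\<close>,
  \<open>l\<close> to \<open>a\<close>, \<open>b\<close>; exchanging the names \<open>a\<close> and
  \<open>b\<close> in the terms with the symmetric coefficient \<open>c\<close> produces an
  expression to which the relation of \<open>N\<close> applies, and that moves the coefficients on
  to the columns \<open>j\<close>, \<open>m\<close>.\<close>

lemma qmatrix_prod:
  assumes M: "qmatrix M" and N: "qmatrix N"
    and comm: "\<And>i j k l. i \<in> S \<Longrightarrow> j \<in> S \<Longrightarrow> k \<in> S \<Longrightarrow> l \<in> S \<Longrightarrow> M i j * N k l = N k l * M i j"
  shows "qmatrix (mat_prod S M N)"
  unfolding qmatrix_def
proof (intro ballI)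
  fix i l j m assume s: "i \<in> S" "l \<in> S" "j \<in> S" "m \<in> S"
  define c where "c = (\<lambda>(a::nat) b. if a = b then z else (1::'r))"
  define e where "e = (\<lambda>(a::nat) b. if a < b then z - w else (0::'r))"
  have cc: "c a b * x = x * c a b" "e a b * x = x * e a b" for a b x
    by (auto simp: c_def e_def central central' algebra_simps)
  have cs: "c a b = c b a" for a b by (auto simp: c_def)
  have exp: "mat_prod S M N i' j' * mat_prod S M N l' m' =
      (\<Sum>a\<in>S. \<Sum>b\<in>S. M i' a * M l' b * (N a j' * N b m'))"
    if "i' \<in> S" "j' \<in> S" "l' \<in> S" "m' \<in> S" for i' j' l' m'
    unfolding mat_prod_def sum_product
  proof (intro sum.cong refl)
    fix a b assume "a \<in> S" "b \<in> S"
    then have "M l' b * N a j' = N a j' * M l' b" using comm that by blast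
    then show "M i' a * N a j' * (M l' b * N b m') = M i' a * M l' b * (N a j' * N b m')"
      by (metis mult.assoc)
  qed
  let ?P = "mat_prod S M N"
  have "c i l * (?P l j * ?P i m) + e i l * (?P i j * ?P l m) =
      (\<Sum>a\<in>S. \<Sum>b\<in>S. (c i l * (M l a * M i b) + e i l * (M i a * M l b)) * (N a j * N b m))"
    using s by (simp add: exp sum_distrib_left sum.distrib distrib_right mult.assoc)
  also have "\<dots> = (\<Sum>a\<in>S. \<Sum>b\<in>S. (c a b * (M i b * M l a) + e a b * (M i a * M l b)) * (N a j * N b m))"
    using qmatrixD[OF M s(1,2)] by (intro sum.cong refl) (simp add: c_def e_def)
  also have "\<dots> = (\<Sum>a\<in>S. \<Sum>b\<in>S. c a b * (M i b * M l a) * (N a j * N b m)) +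
      (\<Sum>a\<in>S. \<Sum>b\<in>S. e a b * (M i a * M l b) * (N a j * N b m))"
    by (simp add: distrib_right sum.distrib)
  also have "\<dots> = (\<Sum>a\<in>S. \<Sum>b\<in>S. c a b * (M i a * M l b) * (N b j * N a m)) +
      (\<Sum>a\<in>S. \<Sum>b\<in>S. e a b * (M i a * M l b) * (N a j * N b m))"
    by (subst sum.swap) (simp add: cs)
  also have "\<dots> =
      (\<Sum>a\<in>S. \<Sum>b\<in>S. (M i a * M l b) * (c a b * (N b j * N a m) + e a b * (N a j * N b m)))"
    unfolding cc(1)[of _ _ "M _ _ * _"] cc(2)[of _ _ "M _ _ * _"] by (simp add: distrib_left sum.distrib mult.assoc)
  also have "\<dots> = (\<Sum>a\<in>S. \<Sum>b\<in>S. (M i a * M l b) * (c j m * (N a m * N b j) + e j m * (N a j * N b m)))"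
    using qmatrixD[OF N _ _ s(3,4)] by (intro sum.cong refl) (simp add: c_def e_def)
  also have "\<dots> = c j m * (?P i m * ?P l j) + e j m * (?P i j * ?P l m)"
  proof -
    have "(M i a * M l b) * (c j m * (N a m * N b j) + e j m * (N a j * N b m)) =
       c j m * (M i a * M l b * (N a m * N b j)) + e j m * (M i a * M l b * (N a j * N b m))" for a b
      by (simp add: distrib_left) (metis cc mult.assoc)
    then show ?thesis
      using s by (simp add: exp sum_distrib_left sum.distrib)
  qed
  finally show "(if i = l then z else 1) * (?P l j * ?P i m) + (if i < l then z - w else 0) * (?P i j * ?P l m) =
     (if j = m then z else 1) * (?P i m * ?P l j) + (if j < m then z - w else 0) * (?P i j * ?P l m)"
    by (simp add: c_def e_def)
qed

section \<open>The alternating property in the rows\<close>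

text \<open>Two columns \<open>j < m\<close> are taken by the first two rows in both orders, and
  together these give a 2 by 2 minor. Taking \<open>j\<close> first removes it from the columns left
  of \<open>m\<close>, hence the \<open>- 1\<close> in the exponent; the other order loses nothing
  and keeps one more factor \<open>- z\<close>.\<close>

lemma qdet_two_rows:
  assumes "finite J"
  shows "qdet z Y (a # b # is) J =
    (\<Sum>(j, m)\<in>{(j, m). j \<in> J \<and> m \<in> J \<and> j < m}.
       (- z) ^ (card {j' \<in> J. j' < j} + card {j' \<in> J. j' < m} - 1) *
       (Y a j * Y b m - z * (Y a m * Y b j)) * qdet z Y is (J - {j, m}))"
proof -
  define A where "A = (\<lambda>j. card {j' \<in> J. j' < j})"
  define f where "f = (\<lambda>(j, m). (- z) ^ A j * Y a j *
     ((- z) ^ card {j' \<in> J - {j}. j' < m} * Y b m * qdet z Y is (J - {j} - {m})))"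
  let ?L = "{(j, m). j \<in> J \<and> m \<in> J \<and> j < m}" and ?G = "{(j, m). j \<in> J \<and> m \<in> J \<and> m < j}"
  have finL: "finite ?L" "finite ?G"
    by (rule finite_subset[of _ "J \<times> J"]; use assms in auto)+
  have "qdet z Y (a # b # is) J = (\<Sum>j\<in>J. \<Sum>m\<in>J - {j}. f (j, m))"
    by (simp add: f_def A_def sum_distrib_left)
  also have "\<dots> = sum f (SIGMA j:J. J - {j})"
    by (subst sum.Sigma) (use assms in simp_all)
  also have "\<dots> = sum f (?L \<union> ?G)"
  proof -
    have "p \<in> (SIGMA j:J. J - {j}) \<longleftrightarrow> p \<in> ?L \<union> ?G" for p
      by (cases p) (simp only: mem_Sigma_iff Diff_iff Un_iff mem_Collect_eq prod.case singleton_iff nat_neq_iff, blast)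
    then have "(SIGMA j:J. J - {j}) = ?L \<union> ?G" by (rule Set.set_eqI)
    then show ?thesis by (rule arg_cong)
  qed
  also have "\<dots> = sum f ?L + sum f ?G"
    using finL by (rule sum.union_disjoint) force
  also have "\<dots> = sum f ?L + (\<Sum>(j, m)\<in>?L. f (m, j))"
    by (rule arg_cong[where f = "(+) (sum f ?L)"],
      rule sum.reindex_bij_witness[of _ "\<lambda>(j, m). (m, j)" "\<lambda>(j, m). (m, j)"]) auto
  also have "\<dots> = (\<Sum>(j, m)\<in>?L. f (j, m) + f (m, j))"
    by (simp add: sum.distrib case_prod_beta)
  also have "\<dots> = (\<Sum>(j, m)\<in>?L. (- z) ^ (A j + A m - 1) *
       (Y a j * Y b m - z * (Y a m * Y b j)) * qdet z Y is (J - {j, m}))"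
  proof (intro sum.cong refl, clarify)
    fix j m assume jm: "j \<in> J" "m \<in> J" "j < m"
    have "{j' \<in> J. j' < m} = insert j {j' \<in> J - {j}. j' < m}" using jm by auto
    then have Am: "A m = Suc (card {j' \<in> J - {j}. j' < m})"
      using assms unfolding A_def by (subst \<open>_ = insert j _\<close>, subst card_insert_disjoint) auto
    have "{j' \<in> J - {m}. j' < j} = {j' \<in> J. j' < j}" using jm by auto
    then have Aj: "card {j' \<in> J - {m}. j' < j} = A j" by (simp add: A_def)
    obtain k where k: "A m = Suc k" "card {j' \<in> J - {j}. j' < m} = k" using Am by blast
    have J: "J - {j} - {m} = J - {j, m}" "J - {m} - {j} = J - {j, m}" by auto
    have mv: "(- z) ^ p * x * ((- z) ^ r * y * D) = (- z) ^ (p + r) * (x * y) * D" for p r x y D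
      by (simp only: mult.assoc central_pow_left[where k = r] power_add)
    show "f (j, m) + f (m, j) = (- z) ^ (A j + A m - 1) *
       (Y a j * Y b m - z * (Y a m * Y b j)) * qdet z Y is (J - {j, m})"
    proof -
      define P where "P = (- z) ^ (A j + k)"
      have 1: "(- z) ^ (Suc k + A j) = P * - z" and 2: "(- z) ^ (A j + Suc k - 1) = P"
        by (simp_all only: P_def add_Suc power_Suc2 add.commute[of k] add_Suc_right diff_Suc_1)
      show ?thesis
        unfolding f_def prod.case mv Aj k J 1 2 P_def[symmetric]
        by (simp add: right_diff_distrib left_diff_distrib mult.assoc)
    qed
  qed
  finally show ?thesis by (simp add: A_def)
qed

text \<open>By the row relation, every 2 by 2 minor of two equal rows vanishes.\<close>

lemma qdet_repeat:
  assumes Y: "qmatrix Y" and "J \<subseteq> S" "a \<in> S"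
  shows "qdet z Y (a # a # is) J = 0"
proof -
  have "finite J" using assms fin finite_subset by blast
  show ?thesis
    unfolding qdet_two_rows[OF \<open>finite J\<close>]
    using qmatrix_row[OF Y \<open>a \<in> S\<close>] \<open>J \<subseteq> S\<close>
    by (intro sum.neutral) (clarify, simp add: subset_iff)
qed

text \<open>It suffices to treat 2 by 2 minors: antidiagonal entries commute, and the correction
  term \<open>z - w\<close> of the diagonal relation is absorbed by
  \<open>z * w = 1\<close>.\<close>

lemma qdet_swap:
  assumes Y: "qmatrix Y" and "J \<subseteq> S" "a \<in> S" "b \<in> S" "a < b"
  shows "qdet z Y (b # a # is) J = - z * qdet z Y (a # b # is) J"
proof -
  have "finite J" using assms fin finite_subset by blast
  have *: "Y b j * Y a m - z * (Y b m * Y a j) = - z * (Y a j * Y b m - z * (Y a m * Y b j))"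
    if "j \<in> J" "m \<in> J" "j < m" for j m
  proof -
    have s: "j \<in> S" "m \<in> S" using that assms by auto
    have 1: "Y b j * Y a m = Y a m * Y b j" using qmatrix_anti[OF Y assms(3,4) s assms(5) that(3)] by simp
    have 2: "Y b m * Y a j = Y a j * Y b m - (z - w) * (Y a m * Y b j)"
      using qmatrix_diag[OF Y assms(3,4) s assms(5) that(3)] by (simp add: algebra_simps)
    have 3: "z * (w * x) = x" for x by (simp add: mult.assoc[symmetric] inv)
    show ?thesis unfolding 1 2 by (simp add: algebra_simps 3)
  qed
  show ?thesis
    unfolding qdet_two_rows[OF \<open>finite J\<close>] sum_distrib_left
  proof (intro sum.cong refl, clarify)
    fix j m assume "j \<in> J" "m \<in> J" "j < m"
    note eq = *[OF this]
    show "(- z) ^ (card {j' \<in> J. j' < j} + card {j' \<in> J. j' < m} - 1) *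
        (Y b j * Y a m - z * (Y b m * Y a j)) * qdet z Y is (J - {j, m}) =
      - z * ((- z) ^ (card {j' \<in> J. j' < j} + card {j' \<in> J. j' < m} - 1) *
        (Y a j * Y b m - z * (Y a m * Y b j)) * qdet z Y is (J - {j, m}))"
      unfolding eq by (simp only: mult.assoc[symmetric] power_commutes)
  qed
qed

text \<open>Row \<open>k\<close> moves into place by adjacent swaps, passing exactly the smaller
  rows at the price \<open>- z\<close> each; meeting an equal row annihilates the determinant.
  Cauchy-Binet uses this to sort the rows of the second factor.\<close>

lemma qdet_insert_row:
  assumes Y: "qmatrix Y" and "sorted_wrt (<) ks" "set ks \<subseteq> S" "k \<in> S" "J \<subseteq> S"
  shows "qdet z Y (k # ks) J =
    (if k \<in> set ks then 0
     else (- z) ^ card {k' \<in> set ks. k' < k} * qdet z Y (sorted_list_of_set (insert k (set ks))) J)"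
  using assms(2-)
proof (induction ks arbitrary: J)
  case Nil
  then show ?case by simp
next
  case (Cons a ks)
  have srt: "sorted_wrt (<) ks" and al: "\<forall>b\<in>set ks. a < b" and S: "a \<in> S" "set ks \<subseteq> S" "k \<in> S" "J \<subseteq> S"
    using Cons.prems by auto
  consider "k = a" | "k < a" | "a < k" by linarith
  then show ?case
  proof cases
    case 1
    then show ?thesis using qdet_repeat[OF Y S(4,1)] by simp
  next
    case 2
    then have e: "{k' \<in> set (a # ks). k' < k} = {}" and nk: "k \<notin> set (a # ks)" using al by auto
    have "sorted_wrt (<) (k # a # ks)" using 2 al srt by auto
    then have "sorted_list_of_set (set (k # a # ks)) = k # a # ks"
      by (metis sorted_list_of_set.idem_if_sorted_distinct strict_sorted_iff)
    then have "sorted_list_of_set (insert k (set (a # ks))) = k # a # ks"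
      by (simp only: list.set(2))
    then show ?thesis unfolding e if_not_P[OF nk] by simp
  next
    case 3
    have sw: "qdet z Y (k # a # ks) J = - z * qdet z Y (a # k # ks) J"
      by (rule qdet_swap[OF Y S(4,1,3) 3])
    have IH: "qdet z Y (k # ks) (J - {j}) = (if k \<in> set ks then 0
     else (- z) ^ card {k' \<in> set ks. k' < k} * qdet z Y (sorted_list_of_set (insert k (set ks))) (J - {j}))" for j
      using Cons.IH[OF srt S(2,3)] S(4) by blast
    show ?thesis
    proof (cases "k \<in> set ks")
      case True
      then show ?thesis unfolding sw qdet.simps(2)[of z Y a] IH by simp
    next
      case False
      define L where "L = sorted_list_of_set (insert k (set ks))"
      define r where "r = card {k' \<in> set ks. k' < k}"
      have "sorted_wrt (<) L" "set L = insert k (set ks)"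
        unfolding L_def by (rule strict_sorted_list_of_set, rule set_sorted_list_of_set, simp)
      then have "sorted_wrt (<) (a # L)" "set (a # L) = insert k (set (a # ks))"
        using 3 al by auto
      then have aL: "sorted_list_of_set (insert k (set (a # ks))) = a # L"
        by (metis sorted_list_of_set.idem_if_sorted_distinct strict_sorted_iff)
      have "{k' \<in> set (a # ks). k' < k} = insert a {k' \<in> set ks. k' < k}" using 3 by auto
      moreover have "a \<notin> {k' \<in> set ks. k' < k}" using al by auto
      ultimately have c: "card {k' \<in> set (a # ks). k' < k} = Suc r" by (simp add: r_def)
      have "qdet z Y (a # k # ks) J = (- z) ^ r * qdet z Y (a # L) J"
        unfolding qdet.simps(2)[of z Y a] IH sum_distrib_left if_not_P[OF False]
          L_def[symmetric] r_def[symmetric]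
        by (simp only: mult.assoc central_pow_left[where k = r])
      then show ?thesis unfolding sw aL c using False 3 by (simp add: mult.assoc)
    qed
  qed
qed

lemma qdet_commute:
  assumes "\<And>i j. i \<in> S \<Longrightarrow> j \<in> S \<Longrightarrow> Y i j * y = y * Y i j" "set is \<subseteq> S" "J \<subseteq> S"
  shows "qdet z Y is J * y = y * qdet z Y is J"
  using assms(2,3)
proof (induction "is" arbitrary: J)
  case (Cons i "is")
  have "qdet z Y is (J - {j}) * y = y * qdet z Y is (J - {j})" "Y i j * y = y * Y i j" if "j \<in> J" for j
    using that assms(1)[of i j] Cons.IH[of "J - {j}"] Cons.prems by auto
  then have "(- z) ^ r * Y i j * qdet z Y is (J - {j}) * y = y * ((- z) ^ r * Y i j * qdet z Y is (J - {j}))"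
    if "j \<in> J" for j r
    using that by (simp only: mult.assoc central_pow_left) (simp only: mult.assoc[symmetric])
  then show ?case by (simp add: sum_distrib_left sum_distrib_right)
qed auto

text \<open>Quantum Cauchy-Binet. Expanding the first row of the product puts a row \<open>k\<close>
  of \<open>N\<close> in front of the rows \<open>K\<close> supplied by the induction hypothesis.
  Sorting it in costs a power of \<open>- z\<close> that is exactly the Laplace sign of column
  \<open>k\<close> of \<open>M\<close> among the columns \<open>insert k K\<close>.\<close>

theorem qdet_mat_prod:
  assumes N: "qmatrix N"
    and comm: "\<And>i j k l. i \<in> S \<Longrightarrow> j \<in> S \<Longrightarrow> k \<in> S \<Longrightarrow> l \<in> S \<Longrightarrow> M i j * N k l = N k l * M i j"
    and "set is \<subseteq> S" "J \<subseteq> S"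
  shows "qdet z (mat_prod S M N) is J =
    (\<Sum>K\<in>Pow S. qdet z M is K * qdet z N (sorted_list_of_set K) J)"
  using assms(3,4)
proof (induction "is" arbitrary: J)
  case Nil
  have "(\<Sum>K\<in>Pow S. qdet z M [] K * qdet z N (sorted_list_of_set K) J) =
     (\<Sum>K\<in>{{}}. qdet z M [] K * qdet z N (sorted_list_of_set K) J)"
    using fin by (intro sum.mono_neutral_right) auto
  then show ?case by simp
next
  case (Cons i "is")
  have iS: "i \<in> S" "set is \<subseteq> S" "J \<subseteq> S" using Cons.prems by auto
  let ?D = "qdet z M is" and ?E = "\<lambda>K. qdet z N (sorted_list_of_set K)"
  let ?s = "\<lambda>j. (- z) ^ card {j' \<in> J. j' < j}"
  have sl: "sorted_wrt (<) (sorted_list_of_set K)" "K \<subseteq> S \<Longrightarrow> set (sorted_list_of_set K) = K" for K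
    by (rule strict_sorted_list_of_set) (simp add: finite_subset[OF _ fin])
  have "qdet z (mat_prod S M N) (i # is) J =
    (\<Sum>j\<in>J. ?s j * (\<Sum>k\<in>S. M i k * N k j) * (\<Sum>K\<in>Pow S. ?D K * ?E K (J - {j})))"
    unfolding qdet.simps(2) mat_prod_def
  proof (intro sum.cong refl arg_cong2[where f = "(*)"], goal_cases)
    case (1 j)
    then have "J - {j} \<subseteq> S" using iS(3) by auto
    then show ?case
      using Cons.IH[OF iS(2)] by (simp add: mat_prod_def[abs_def])
  qed
  also have "\<dots> = (\<Sum>j\<in>J. \<Sum>k\<in>S. \<Sum>K\<in>Pow S. ?s j * (M i k * N k j) * (?D K * ?E K (J - {j})))"
    unfolding sum_distrib_left sum_distrib_right by (rule sum.cong[OF refl], rule sum.swap)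
  also have "\<dots> = (\<Sum>j\<in>J. \<Sum>k\<in>S. \<Sum>K\<in>Pow S. M i k * ?D K * (?s j * N k j * ?E K (J - {j})))"
  proof (intro sum.cong refl)
    fix j k K assume a: "j \<in> J" "k \<in> S" "K \<in> Pow S"
    then have j: "j \<in> S" using iS by auto
    have 1: "?D K * N k j = N k j * ?D K"
      by (rule qdet_commute) (use comm a iS j in auto)
    show "?s j * (M i k * N k j) * (?D K * ?E K (J - {j})) = M i k * ?D K * (?s j * N k j * ?E K (J - {j}))"
      by (simp only: mult.assoc central_pow_left) (simp only: mult.assoc[symmetric] 1)
  qed
  \<comment> \<open>For fixed \<open>k\<close> and \<open>K\<close> the sum over \<open>j\<close> is
    the Laplace expansion of the minor of \<open>N\<close> with row \<open>k\<close> placed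
    first.\<close>
  also have "\<dots> = (\<Sum>k\<in>S. \<Sum>K\<in>Pow S. M i k * ?D K * qdet z N (k # sorted_list_of_set K) J)"
    by (subst sum.swap, rule sum.cong[OF refl], subst sum.swap, rule sum.cong[OF refl])
      (simp add: sum_distrib_left)
  also have "\<dots> = (\<Sum>k\<in>S. \<Sum>K\<in>Pow S. if k \<in> K then 0 else
      (- z) ^ card {k' \<in> K. k' < k} * M i k * ?D K * ?E (insert k K) J)"
  proof (intro sum.cong refl)
    fix k K assume a: "k \<in> S" "K \<in> Pow S"
    then have K: "set (sorted_list_of_set K) = K" using sl by auto
    have "qdet z N (k # sorted_list_of_set K) J = (if k \<in> K then 0
     else (- z) ^ card {k' \<in> K. k' < k} * ?E (insert k K) J)"
      using qdet_insert_row[OF N sl(1)[of K], of k J] a iS unfolding K by auto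
    then show "M i k * ?D K * qdet z N (k # sorted_list_of_set K) J = (if k \<in> K then 0 else
      (- z) ^ card {k' \<in> K. k' < k} * M i k * ?D K * ?E (insert k K) J)"
      by (simp only: if_distrib[of "(*) _"] mult_zero_right mult.assoc central_pow_left)
  qed
  also have "\<dots> = (\<Sum>k\<in>S. \<Sum>K\<in>{K \<in> Pow S. k \<notin> K}. (- z) ^ card {k' \<in> K. k' < k} * M i k * ?D K * ?E (insert k K) J)"
    using fin by (intro sum.cong refl sum.mono_neutral_cong_right) auto
  \<comment> \<open>Adding \<open>k\<close> matches the sets without \<open>k\<close> with the sets
    containing it and does not change the number of elements below \<open>k\<close>.\<close>
  also have "\<dots> = (\<Sum>k\<in>S. \<Sum>K\<in>{K \<in> Pow S. k \<in> K}.
      (- z) ^ card {k' \<in> K. k' < k} * M i k * ?D (K - {k}) * ?E K J)"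
  proof (rule sum.cong[OF refl])
    fix k assume "k \<in> S"
    have e: "{k'. (k' = k \<or> k' \<in> K) \<and> k' < k} = {k' \<in> K. k' < k}" for K by auto
    show "(\<Sum>K\<in>{K \<in> Pow S. k \<notin> K}. (- z) ^ card {k' \<in> K. k' < k} * M i k * ?D K * ?E (insert k K) J) =
      (\<Sum>K\<in>{K \<in> Pow S. k \<in> K}. (- z) ^ card {k' \<in> K. k' < k} * M i k * ?D (K - {k}) * ?E K J)"
      by (rule sum.reindex_bij_witness[of _ "\<lambda>K. K - {k}" "insert k"])
        (use \<open>k \<in> S\<close> in \<open>auto simp: insert_absorb e\<close>)
  qed
  also have "\<dots> = (\<Sum>k\<in>S. \<Sum>K\<in>Pow S. if k \<in> K then
      (- z) ^ card {k' \<in> K. k' < k} * M i k * ?D (K - {k}) * ?E K J else 0)"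
    using fin by (intro sum.cong refl sum.mono_neutral_cong_left) auto
  also have "\<dots> = (\<Sum>K\<in>Pow S. \<Sum>k\<in>S. if k \<in> K then
      (- z) ^ card {k' \<in> K. k' < k} * M i k * ?D (K - {k}) * ?E K J else 0)"
    by (rule sum.swap)
  also have "\<dots> = (\<Sum>K\<in>Pow S. qdet z M (i # is) K * ?E K J)"
  proof (rule sum.cong[OF refl])
    fix K assume "K \<in> Pow S"
    have "(\<Sum>k\<in>S. if k \<in> K then (- z) ^ card {k' \<in> K. k' < k} * M i k * ?D (K - {k}) * ?E K J else 0) =
      (\<Sum>k\<in>K. (- z) ^ card {k' \<in> K. k' < k} * M i k * ?D (K - {k}) * ?E K J)"
      using fin \<open>K \<in> Pow S\<close> by (intro sum.mono_neutral_cong_right) auto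
    then show "(\<Sum>k\<in>S. if k \<in> K then (- z) ^ card {k' \<in> K. k' < k} * M i k * ?D (K - {k}) * ?E K J else 0) =
       qdet z M (i # is) K * ?E K J"
      by (simp add: sum_distrib_right)
  qed
  finally show ?case .
qed

end

context quantum_parameter begin

lemma qmatrixI:
  assumes row: "\<And>i j m. i \<in> S \<Longrightarrow> j \<in> S \<Longrightarrow> m \<in> S \<Longrightarrow> j < m \<Longrightarrow> Y i j * Y i m = z * (Y i m * Y i j)"
    and col: "\<And>i j l. i \<in> S \<Longrightarrow> j \<in> S \<Longrightarrow> l \<in> S \<Longrightarrow> i < l \<Longrightarrow> Y i j * Y l j = z * (Y l j * Y i j)"
    and anti: "\<And>i j l m. i \<in> S \<Longrightarrow> j \<in> S \<Longrightarrow> l \<in> S \<Longrightarrow> m \<in> S \<Longrightarrow> i < l \<Longrightarrow> j < m \<Longrightarrow>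
      Y i m * Y l j = Y l j * Y i m"
    and diag: "\<And>i j l m. i \<in> S \<Longrightarrow> j \<in> S \<Longrightarrow> l \<in> S \<Longrightarrow> m \<in> S \<Longrightarrow> i < l \<Longrightarrow> j < m \<Longrightarrow>
      Y i j * Y l m - Y l m * Y i j = (z - w) * (Y i m * Y l j)"
  shows "qmatrix Y"
  unfolding qmatrix_def
proof (intro ballI)
  fix i l j m assume s: "i \<in> S" "l \<in> S" "j \<in> S" "m \<in> S"
  have wz: "w * (z * x) = x" for x by (simp add: mult.assoc[symmetric] inv')
  show "(if i = l then z else 1) * (Y l j * Y i m) + (if i < l then z - w else 0) * (Y i j * Y l m) =
     (if j = m then z else 1) * (Y i m * Y l j) + (if j < m then z - w else 0) * (Y i j * Y l m)"
  proof (cases i l rule: linorder_cases)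
    case equal
    then show ?thesis
      using row[of i j m] row[of i m j] s
      by (cases j m rule: linorder_cases) (auto simp: left_diff_distrib wz)
  next
    case less
    then show ?thesis
      using col[of i j l] anti[of i j l m] diag[of i m l j] s
      by (cases j m rule: linorder_cases) (auto simp: left_diff_distrib wz algebra_simps)
  next
    case greater
    then show ?thesis
      using col[of l j i] anti[of l m i j] anti[of l j i m] diag[of l j i m] s
      by (cases j m rule: linorder_cases) (auto simp: left_diff_distrib wz algebra_simps)
  qed
qed

end

section \<open>Minors of matrices without crossings\<close>

lemma qdet_card:
  "finite J \<Longrightarrow> qdet z Y is J \<noteq> 0 \<Longrightarrow> card J = length is"
proof (induction "is" arbitrary: J)
  case Nil
  then show ?case by (simp split: if_splits)
next
  case (Cons i "is")
  then obtain j where j: "j \<in> J" "qdet z Y is (J - {j}) \<noteq> 0"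
    by (auto elim!: sum.not_neutral_contains_not_neutral) (metis mult_zero_right)
  then show ?case using Cons.IH[of "J - {j}"] Cons.prems
    by (simp add: card_Diff_singleton) (metis Suc_pred card_gt_0_iff empty_iff)
qed

lemma qdet_zero_column:
  assumes "\<And>i. i \<in> set is \<Longrightarrow> Y i k = 0" "k \<in> J"
  shows "qdet z Y is J = 0"
  using assms
proof (induction "is" arbitrary: J)
  case (Cons i "is")
  have "Y i j * qdet z Y is (J - {j}) = 0" for j
    using Cons by (cases "j = k") auto
  then show ?case by (simp add: mult.assoc)
qed auto

text \<open>The first assumption says that nonzero entries never cross. If the first row took a
  column above the smallest one, that smallest column would vanish on all later rows. Only the
  order-preserving matching of rows and columns survives, and it carries no power of
  \<open>z\<close>.\<close>

lemma qdet_bidiagonal: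
  assumes Y: "\<And>i i' j k. i < i' \<Longrightarrow> k < j \<Longrightarrow> Y i j \<noteq> 0 \<Longrightarrow> Y i' k = 0"
    and "sorted_wrt (<) is" "sorted_wrt (<) ks" "length is = length ks"
  shows "qdet z Y is (set ks) = prod_list (map2 Y is ks)"
  using assms(4,2,3)
proof (induction "is" ks rule: list_induct2)
  case (Cons i "is" k ks)
  have e: "{j' \<in> set (k # ks). j' < k} = {}" "set (k # ks) - {k} = set ks" using Cons.prems by auto
  have "qdet z Y (i # is) (set (k # ks)) =
    (\<Sum>j\<in>{k}. (- z) ^ card {j' \<in> set (k # ks). j' < j} * Y i j * qdet z Y is (set (k # ks) - {j}))"
    unfolding qdet.simps
  proof (rule sum.mono_neutral_right, goal_cases)
    case 3
    show ?case
    proof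
      fix j assume j: "j \<in> set (k # ks) - {k}"
      then have "k < j" using Cons.prems by auto
      show "(- z) ^ card {j' \<in> set (k # ks). j' < j} * Y i j * qdet z Y is (set (k # ks) - {j}) = 0"
      proof (cases "Y i j = 0")
        case False
        have "qdet z Y is (set (k # ks) - {j}) = 0"
          by (rule qdet_zero_column[of _ _ k]) (use Y[OF _ \<open>k < j\<close> False] Cons.prems \<open>k < j\<close> in auto)
        then show ?thesis by simp
      qed simp
    qed
  qed auto
  also have "\<dots> = Y i k * qdet z Y is (set ks)" by (simp only: sum.insert finite.emptyI empty_iff sum.empty not_False_eq_True e card.empty
      power_0 mult_1_left add_0_right)
  finally show ?case using Cons by simp
qed simp

section \<open>Linear operators on functions as a ring\<close>

typedef (overloaded) ('a, 'k) lin_op =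
  "{f :: ('a \<Rightarrow> 'k::field) \<Rightarrow> ('a \<Rightarrow> 'k).
     (\<forall>u v. f (\<lambda>x. u x + v x) = (\<lambda>x. f u x + f v x)) \<and> (\<forall>c u. f (\<lambda>x. c * u x) = (\<lambda>x. c * f u x))}"
  morphisms app Lin_op
  by (rule exI[of _ "\<lambda>u. u"]) simp

setup_lifting type_definition_lin_op

lemma lin_op_eqI: "(\<And>v x. app a v x = app b v x) \<Longrightarrow> a = b"
  by (metis app_inject ext)

lemma app_add: "app a (\<lambda>x. u x + v x) = (\<lambda>x. app a u x + app a v x)"
  and app_scale: "app a (\<lambda>x. c * u x) = (\<lambda>x. c * app a u x)"
  using app[of a] by simp_all

instantiation lin_op :: (type, field) ring_1
begin

lift_definition zero_lin_op :: "('a, 'k::field) lin_op" is "\<lambda>u x. 0" by simp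
lift_definition one_lin_op :: "('a, 'k::field) lin_op" is "\<lambda>u. u" by simp
lift_definition plus_lin_op :: "('a, 'k::field) lin_op \<Rightarrow> ('a, 'k) lin_op \<Rightarrow> ('a, 'k) lin_op"
  is "\<lambda>f g u x. f u x + g u x" by (simp add: distrib_left add_ac)
lift_definition uminus_lin_op :: "('a, 'k::field) lin_op \<Rightarrow> ('a, 'k) lin_op"
  is "\<lambda>f u x. - f u x" by simp
lift_definition times_lin_op :: "('a, 'k::field) lin_op \<Rightarrow> ('a, 'k) lin_op \<Rightarrow> ('a, 'k) lin_op"
  is "\<lambda>f g u. f (g u)" by simp
definition minus_lin_op :: "('a, 'k::field) lin_op \<Rightarrow> ('a, 'k) lin_op \<Rightarrow> ('a, 'k) lin_op" where
  "minus_lin_op f g = f + - g"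

lemmas app_ring_simps = zero_lin_op.rep_eq one_lin_op.rep_eq plus_lin_op.rep_eq
  uminus_lin_op.rep_eq times_lin_op.rep_eq

instance
proof
  fix a b c :: "('a, 'k::field) lin_op"
  show "a + b + c = a + (b + c)" by (rule lin_op_eqI) (simp add: app_ring_simps)
  show "a + b = b + a" by (rule lin_op_eqI) (simp add: app_ring_simps)
  show "0 + a = a" by (rule lin_op_eqI) (simp add: app_ring_simps)
  show "- a + a = 0" by (rule lin_op_eqI) (simp add: app_ring_simps)
  show "a - b = a + - b" by (rule minus_lin_op_def)
  show "a * b * c = a * (b * c)" by (rule lin_op_eqI) (simp add: app_ring_simps)
  show "1 * a = a" "a * 1 = a" by (rule lin_op_eqI, simp add: app_ring_simps)+
  show "(a + b) * c = a * c + b * c" by (rule lin_op_eqI) (simp add: app_ring_simps)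
  show "a * (b + c) = a * b + a * c" by (rule lin_op_eqI) (simp add: app_ring_simps app_add)
  show "(0::('a, 'k::field) lin_op) \<noteq> 1"
  proof
    assume "(0::('a, 'k::field) lin_op) = 1"
    then have "app (0::('a, 'k) lin_op) (\<lambda>_. 1) = app 1 (\<lambda>_. 1)" by simp
    then show False by (simp add: app_ring_simps fun_eq_iff)
  qed
qed

end

lift_definition scalar_op :: "'k::field \<Rightarrow> ('a, 'k) lin_op" is "\<lambda>c u x. c * u x"
  by (simp add: distrib_left mult.left_commute)

text \<open>With \<open>g\<close> a translation of exponents, this is multiplication by a twisted
  monomial, seen on coefficient functions.\<close>

lift_definition weighted_comp :: "('a \<Rightarrow> 'k::field) \<Rightarrow> ('a \<Rightarrow> 'a) \<Rightarrow> ('a, 'k) lin_op" is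
  "\<lambda>w g u x. w x * u (g x)"
  by (simp add: distrib_left mult.left_commute)

lemma app_simps [simp]:
  "app 0 v = (\<lambda>x. 0)" "app 1 v = v" "app (a + b) v = (\<lambda>x. app a v x + app b v x)"
  "app (a * b) v = app a (app b v)" "app (scalar_op c) v = (\<lambda>x. c * v x)"
  "app (weighted_comp w g) v = (\<lambda>x. w x * v (g x))"
  by (simp_all add: app_ring_simps scalar_op.rep_eq weighted_comp.rep_eq)

lemma app_sum: "app (sum f A) v x = (\<Sum>a\<in>A. app (f a) v x)"
  by (induction A rule: infinite_finite_induct) auto

lemma scalar_op_commute: "scalar_op c * a = a * scalar_op c"
  by (rule lin_op_eqI) (simp add: app_scale)

lemma scalar_op_mult: "scalar_op (c * d) = scalar_op c * scalar_op d"
  by (rule lin_op_eqI) (simp add: mult.assoc)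

lemma scalar_op_add: "scalar_op (c + d) = scalar_op c + scalar_op d"
  by (rule lin_op_eqI) (simp add: distrib_right)

lemma scalar_op_1 [simp]: "scalar_op 1 = 1"
  by (rule lin_op_eqI) simp

lemma scalar_op_0 [simp]: "scalar_op 0 = 0"
  by (rule lin_op_eqI) simp

lemma scalar_op_minus: "scalar_op (- c) = - scalar_op c"
  by (metis add.right_inverse add_eq_0_iff scalar_op_0 scalar_op_add)

lemma scalar_op_power: "scalar_op (c ^ k) = scalar_op c ^ k"
  by (induction k) (auto simp: scalar_op_mult)

section \<open>The network representation\<close>

type_synonym edge = "nat \<times> nat \<times> nat"

definition unit_exp :: "edge \<Rightarrow> edge \<Rightarrow> int" where
  "unit_exp e = (\<lambda>f. if f = e then 1 else 0)"

text \<open>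
  In layer \<open>p\<close> write \<open>a\<^sub>k\<close> for the edge \<open>(p, k, k)\<close> and \<open>b\<^sub>k\<close> for the edge between \<open>k\<close> and \<open>k + 1\<close>. The twist
  realises \<open>a\<^sub>k b\<^sub>k = q b\<^sub>k a\<^sub>k\<close> and \<open>b\<^sub>k a\<^sub>k\<^sub>+\<^sub>1 = q a\<^sub>k\<^sub>+\<^sub>1 b\<^sub>k\<close>; all other edges commute. A layer uses only one of the two
  directions of \<open>b\<^sub>k\<close>.
\<close>

fun twist :: "edge \<Rightarrow> (edge \<Rightarrow> int) \<Rightarrow> int" where
  "twist (p, i, k) \<alpha> = (if i = k
     then \<alpha> (p, Suc k, k) + \<alpha> (p, k, Suc k) - \<alpha> (p, k, k - 1) - \<alpha> (p, k - 1, k) else 0)"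

locale network =
  fixes n :: nat and q :: "'k::field"
  assumes q: "q \<noteq> 0"
begin

text \<open>Left multiplication by a generator of the quantum torus: the coefficient at
  \<open>\<alpha>\<close> comes from the exponent \<open>\<alpha> - e\<close>, and the power of
  \<open>q\<close> is the cost of normal ordering.\<close>

definition edge_op :: "edge \<Rightarrow> (edge \<Rightarrow> int, 'k) lin_op" where
  "edge_op e = weighted_comp (\<lambda>\<alpha>. q powi twist e (\<lambda>x. \<alpha> x - unit_exp e x)) (\<lambda>\<alpha> x. \<alpha> x - unit_exp e x)"

definition up :: "nat \<Rightarrow> bool" where
  "up p \<longleftrightarrow> n \<le> p \<and> p < 2 * n"

definition step :: "nat \<Rightarrow> nat \<Rightarrow> nat \<Rightarrow> bool" where
  "step p i k \<longleftrightarrow> k = i \<or> (if up p then k = Suc i else i = Suc k)"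

definition layer :: "nat \<Rightarrow> nat \<Rightarrow> nat \<Rightarrow> (edge \<Rightarrow> int, 'k) lin_op" where
  "layer p i k = (if step p i k then edge_op (p, i, k) else 0)"

text \<open>The product of the last \<open>d\<close> layers. Growing it from the far end means that
  a path family is extended at its front, so that its continuation is already understood.\<close>

fun tail_mat :: "nat \<Rightarrow> nat \<Rightarrow> nat \<Rightarrow> (edge \<Rightarrow> int, 'k) lin_op" where
  "tail_mat 0 = (\<lambda>i j. if i = j then 1 else 0)"
| "tail_mat (Suc d) = mat_prod {1..n} (layer (3 * n - Suc d)) (tail_mat d)"

sublocale quantum_parameter "scalar_op q :: (edge \<Rightarrow> int, 'k) lin_op" "scalar_op (inverse q)" "{1..n}"
proof
  show "scalar_op q * scalar_op (inverse q) = (1 :: (edge \<Rightarrow> int, 'k) lin_op)"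
    using q by (simp add: scalar_op_mult[symmetric])
qed (rule scalar_op_commute, simp)

text \<open>Both orders translate the exponent by the same amount. Since \<open>twist\<close> is
  linear, the two weights differ only in the cross terms.\<close>

lemma edge_op_commute:
  "edge_op e * edge_op f = scalar_op (q powi (twist e (unit_exp f) - twist f (unit_exp e))) * (edge_op f * edge_op e)"
proof (rule lin_op_eqI)
  fix v \<alpha>
  obtain p i k p' i' k' where e: "e = (p, i, k)" "f = (p', i', k')" by (metis surj_pair)
  have 1: "twist e (\<lambda>x. \<alpha> x - \<beta> x) = twist e \<alpha> - twist e \<beta>" for e \<alpha> \<beta>
    by (cases e) simp
  have 2: "(\<lambda>x. \<alpha> x - unit_exp e x - unit_exp f x) = (\<lambda>x. \<alpha> x - unit_exp f x - unit_exp e x)" by auto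
  show "app (edge_op e * edge_op f) v \<alpha> =
    app (scalar_op (q powi (twist e (unit_exp f) - twist f (unit_exp e))) * (edge_op f * edge_op e)) v \<alpha>"
    unfolding edge_op_def app_simps 2
    by (simp add: 1 mult.assoc[symmetric] power_int_add[symmetric] q) (simp add: algebra_simps)
qed

lemma edge_op_qcommute:
  assumes "twist e (unit_exp f) - twist f (unit_exp e) = 1"
  shows "edge_op e * edge_op f = scalar_op q * (edge_op f * edge_op e)"
  using edge_op_commute[of e f] assms by simp

lemma edge_op_commute_free:
  assumes "twist e (unit_exp f) = twist f (unit_exp e)"
  shows "edge_op e * edge_op f = edge_op f * edge_op e"
  using edge_op_commute[of e f] assms by simp

lemma layer_commute:
  assumes "p \<noteq> p'" "0 < i" "0 < k" "0 < i'" "0 < k'"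
  shows "layer p i k * layer p' i' k' = layer p' i' k' * layer p i k"
  using assms unfolding layer_def
  by (auto intro!: edge_op_commute_free simp: unit_exp_def)

text \<open>Two nonzero entries in one row or column are adjacent generators \<open>a\<close>,
  \<open>b\<close>, for which the twist was made. Two entries in antidiagonal position are never
  both nonzero, so the right-hand side of the diagonal relation vanishes and the relation reduces to
  commutation.\<close>

lemma qmatrix_layer: "qmatrix (layer p)"
proof (rule qmatrixI, goal_cases)
  case (1 i j m)
  show ?case
  proof (cases "step p i j \<and> step p i m")
    case True
    then have "if up p then j = i \<and> m = Suc i else i = Suc j \<and> m = i"
      using \<open>j < m\<close> by (auto simp: step_def split: if_splits)
    then have "twist (p, i, j) (unit_exp (p, i, m)) - twist (p, i, m) (unit_exp (p, i, j)) = 1"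
      using 1 by (cases "up p") (auto simp: unit_exp_def)
    then show ?thesis using True edge_op_qcommute by (simp add: layer_def)
  qed (auto simp: layer_def)
next
  case (2 i j l)
  show ?case
  proof (cases "step p i j \<and> step p l j")
    case True
    then have "if up p then j = Suc i \<and> l = j else j = i \<and> l = Suc j"
      using \<open>i < l\<close> by (auto simp: step_def split: if_splits)
    then have "twist (p, i, j) (unit_exp (p, l, j)) - twist (p, l, j) (unit_exp (p, i, j)) = 1"
      using 2 by (cases "up p") (auto simp: unit_exp_def)
    then show ?thesis using True edge_op_qcommute by (simp add: layer_def)
  qed (auto simp: layer_def)
next
  case (3 i j l m)
  have "\<not> (step p i m \<and> step p l j)"
    using 3 by (auto simp: step_def split: if_splits)
  then show ?case by (auto simp: layer_def)
next
  case (4 i j l m)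
  have "layer p i j * layer p l m = layer p l m * layer p i j"
  proof (cases "step p i j \<and> step p l m")
    case True
    have eq: "twist (p, i, j) (unit_exp (p, l, m)) = 0 \<and> twist (p, l, m) (unit_exp (p, i, j)) = 0"
    proof (cases "up p")
      case True
      then have "j = i \<or> j = Suc i" "m = l \<or> m = Suc l"
        using \<open>step p i j \<and> step p l m\<close> by (auto simp: step_def)
      then show ?thesis
        using \<open>i < l\<close> \<open>j < m\<close> by (elim disjE) (simp_all add: unit_exp_def, auto?)
    next
      case False
      then have "i = j \<or> i = Suc j" "l = m \<or> l = Suc m"
        using \<open>step p i j \<and> step p l m\<close> by (auto simp: step_def)
      then show ?thesis
        using \<open>j < m\<close> \<open>i < l\<close> by (elim disjE) (simp_all add: unit_exp_def)
    qed
    then show ?thesis using True edge_op_commute_free eq by (simp add: layer_def del: twist.simps)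
  qed (auto simp: layer_def)
  moreover have "\<not> (step p i m \<and> step p l j)"
    using 4 by (auto simp: step_def split: if_splits)
  then have "layer p i m * layer p l j = 0"
    by (auto simp: layer_def)
  ultimately show ?case by simp
qed

lemma tail_mat_commute:
  assumes "\<And>p i k. 3 * n - d \<le> p \<Longrightarrow> i \<in> {1..n} \<Longrightarrow> k \<in> {1..n} \<Longrightarrow> layer p i k * y = y * layer p i k"
    "i \<in> {1..n}" "k \<in> {1..n}" "d \<le> 3 * n"
  shows "tail_mat d i k * y = y * tail_mat d i k"
  using assms
proof (induction d arbitrary: i k)
  case (Suc d)
  have "layer (3 * n - Suc d) i j * tail_mat d j k * y = y * (layer (3 * n - Suc d) i j * tail_mat d j k)"
    if "j \<in> {1..n}" for j
  proof -
    have 1: "layer (3 * n - Suc d) i j * y = y * layer (3 * n - Suc d) i j"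
      using Suc.prems(2,4) that by (intro Suc.prems(1)) auto
    have 2: "tail_mat d j k * y = y * tail_mat d j k"
      using Suc.prems that by (intro Suc.IH) auto
    show ?thesis
      by (simp only: mult.assoc 2) (simp only: mult.assoc[symmetric] 1)
  qed
  then show ?case by (simp add: mat_prod_def sum_distrib_left sum_distrib_right)
qed auto

lemma layer_tail_commute:
  assumes "Suc d \<le> 3 * n" "i \<in> {1..n}" "j \<in> {1..n}" "k \<in> {1..n}" "l \<in> {1..n}"
  shows "layer (3 * n - Suc d) i j * tail_mat d k l = tail_mat d k l * layer (3 * n - Suc d) i j"
  using assms by (intro tail_mat_commute[symmetric] layer_commute) auto

lemma qmatrix_tail_mat: "d \<le> 3 * n \<Longrightarrow> qmatrix (tail_mat d)"
proof (induction d)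
  case 0
  show ?case by (rule qmatrixI) auto
next
  case (Suc d)
  then show ?case
    unfolding tail_mat.simps by (intro qmatrix_prod qmatrix_layer layer_tail_commute) auto
qed

end

section \<open>Leading exponents\<close>

context network begin

abbreviation z :: "(edge \<Rightarrow> int, 'k) lin_op" where "z \<equiv> scalar_op q"

text \<open>
  The sign makes low positions leading in the first third of the network and high positions leading
  afterwards.
\<close>

definition sgn_at :: "nat \<Rightarrow> int" where
  "sgn_at p = (if p < n then - 1 else 1)"

text \<open>Edges are weighted by their target only. For a path family the value at \<open>p\<close>
  is, up to sign, the sum of the positions after step \<open>p\<close>, so lexicographic comparison
  of degrees compares families time by time.\<close>

definition deg :: "(edge \<Rightarrow> int) \<Rightarrow> nat \<Rightarrow> int" where
  "deg \<alpha> p = sgn_at p * (\<Sum>i\<in>{1..n}. \<Sum>k\<in>{1..n}. int k * \<alpha> (p, i, k))"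

lemma deg_add: "deg (\<lambda>e. \<alpha> e + \<beta> e) p = deg \<alpha> p + deg \<beta> p"
  by (simp add: deg_def sum.distrib distrib_left)

lemma deg_diff: "deg (\<lambda>e. \<alpha> e - \<beta> e) p = deg \<alpha> p - deg \<beta> p"
  by (simp add: deg_def sum_subtractf right_diff_distrib)

lemma deg_0 [simp]: "deg (\<lambda>e. 0) p = 0"
  by (simp add: deg_def)

lemma deg_unit:
  assumes "i \<in> {1..n}" "k \<in> {1..n}"
  shows "deg (unit_exp (p', i, k)) p = (if p = p' then sgn_at p * int k else 0)"
proof (cases "p = p'")
  case True
  have "(\<Sum>i'\<in>{1..n}. \<Sum>k'\<in>{1..n}. int k' * unit_exp (p', i, k) (p, i', k')) =
    (\<Sum>i'\<in>{1..n}. if i' = i then (\<Sum>k'\<in>{1..n}. if k' = k then int k else 0) else 0)"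
    using True by (intro sum.cong refl) (auto simp: unit_exp_def if_distrib cong: if_cong)
  also have "\<dots> = int k"
    using assms by simp
  finally show ?thesis using True by (simp add: deg_def)
qed (simp add: deg_def unit_exp_def)

definition layer_exp :: "nat \<Rightarrow> nat list \<Rightarrow> nat list \<Rightarrow> edge \<Rightarrow> int" where
  "layer_exp p is ks e = int (count_list (map (Pair p) (zip is ks)) e)"

lemma deg_layer_exp:
  assumes "length is = length ks" "set is \<subseteq> {1..n}" "set ks \<subseteq> {1..n}"
  shows "deg (layer_exp p' is ks) p = (if p = p' then sgn_at p * int (sum_list ks) else 0)"
  using assms
proof (induction "is" ks rule: list_induct2)
  case Nil
  then show ?case by (simp add: deg_def layer_exp_def)
next
  case (Cons i "is" k ks)
  have "layer_exp p' (i # is) (k # ks) = (\<lambda>e. unit_exp (p', i, k) e + layer_exp p' is ks e)"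
    by (auto simp: layer_exp_def unit_exp_def)
  then show ?case using Cons
    by (simp add: deg_add deg_unit distrib_left)
qed

definition monomial_op :: "(edge \<Rightarrow> int, 'k) lin_op \<Rightarrow> (edge \<Rightarrow> int) \<Rightarrow> bool" where
  "monomial_op E \<gamma> \<longleftrightarrow> (\<exists>u. (\<forall>\<alpha>. u \<alpha> \<noteq> 0) \<and> (\<forall>v \<alpha>. app E v \<alpha> = u \<alpha> * v (\<lambda>e. \<alpha> e - \<gamma> e)))"

lemma monomial_edge_op: "monomial_op (edge_op e) (unit_exp e)"
  unfolding monomial_op_def edge_op_def using q
  by (intro exI[of _ "\<lambda>\<alpha>. q powi twist e (\<lambda>x. \<alpha> x - unit_exp e x)"]) simp

lemma monomial_mult:
  assumes "monomial_op E \<gamma>" "monomial_op E' \<gamma>'"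
  shows "monomial_op (E * E') (\<lambda>e. \<gamma> e + \<gamma>' e)"
proof -
  obtain u u' where "\<forall>\<alpha>. u \<alpha> \<noteq> 0" "\<forall>v \<alpha>. app E v \<alpha> = u \<alpha> * v (\<lambda>e. \<alpha> e - \<gamma> e)"
    "\<forall>\<alpha>. u' \<alpha> \<noteq> 0" "\<forall>v \<alpha>. app E' v \<alpha> = u' \<alpha> * v (\<lambda>e. \<alpha> e - \<gamma>' e)"
    using assms unfolding monomial_op_def by blast
  then show ?thesis unfolding monomial_op_def
    by (intro exI[of _ "\<lambda>\<alpha>. u \<alpha> * u' (\<lambda>e. \<alpha> e - \<gamma> e)"]) (simp add: algebra_simps)
qed

lemma monomial_layer:
  "length is = length ks \<Longrightarrow>
    monomial_op (prod_list (map (\<lambda>e. edge_op (p, e)) (zip is ks))) (layer_exp p is ks)"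
proof (induction "is" ks rule: list_induct2)
  case Nil
  show ?case unfolding monomial_op_def by (intro exI[of _ "\<lambda>_. 1"]) (simp add: layer_exp_def)
next
  case (Cons i "is" k ks)
  have "layer_exp p (i # is) (k # ks) = (\<lambda>e. unit_exp (p, i, k) e + layer_exp p is ks e)"
    by (auto simp: layer_exp_def unit_exp_def)
  then show ?case using monomial_mult[OF monomial_edge_op Cons.IH] by simp
qed

lemma qdet_layer:
  assumes "sorted_wrt (<) is" "sorted_wrt (<) ks" "length is = length ks"
  shows "qdet z (layer p) is (set ks) = (if list_all2 (step p) is ks
    then prod_list (map (\<lambda>e. edge_op (p, e)) (zip is ks)) else 0)"
proof -
  have "qdet z (layer p) is (set ks) = prod_list (map2 (layer p) is ks)"
    by (rule qdet_bidiagonal) (use assms in \<open>auto simp: layer_def step_def split: if_splits\<close>)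
  also have "\<dots> = (if list_all2 (step p) is ks
    then prod_list (map (\<lambda>e. edge_op (p, e)) (zip is ks)) else 0)"
    using assms(3) by (induction "is" ks rule: list_induct2) (auto simp: layer_def)
  finally show ?thesis .
qed

lemma qdet_tail_Suc:
  assumes "Suc d \<le> 3 * n" "set is \<subseteq> {1..n}" "J \<subseteq> {1..n}"
  shows "qdet z (tail_mat (Suc d)) is J =
    (\<Sum>K\<in>Pow {1..n}. qdet z (layer (3 * n - Suc d)) is K * qdet z (tail_mat d) (sorted_list_of_set K) J)"
  unfolding tail_mat.simps using assms
  by (intro qdet_mat_prod qmatrix_tail_mat layer_tail_commute) auto

text \<open>What operators built from the last \<open>d\<close> layers have in common. It is phrased
  through supports, so that it passes to sums in which terms may cancel.\<close>

definition tame :: "nat \<Rightarrow> (edge \<Rightarrow> int, 'k) lin_op \<Rightarrow> bool" where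
  "tame d E \<longleftrightarrow> (\<forall>v \<alpha>. app E v \<alpha> \<noteq> 0 \<longrightarrow>
     (\<exists>\<alpha>'. v \<alpha>' \<noteq> 0 \<and> (\<forall>p<3 * n - d. deg \<alpha> p = deg \<alpha>' p)))"

lemma tame_mono: "tame d E \<Longrightarrow> d \<le> d' \<Longrightarrow> tame d' E"
  unfolding tame_def by (meson diff_le_mono2 less_le_trans)

lemma tame_mult: "tame d E \<Longrightarrow> tame d E' \<Longrightarrow> tame d (E * E')"
  unfolding tame_def app_simps by metis

lemma tame_sum: "(\<And>x. x \<in> A \<Longrightarrow> tame d (f x)) \<Longrightarrow> tame d (sum f A)"
  unfolding tame_def by (auto simp: app_sum elim!: sum.not_neutral_contains_not_neutral)

lemma tame_scalar: "tame d (scalar_op c)"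
  unfolding tame_def by auto

lemma tame_qdet:
  assumes "\<And>i j. i \<in> {1..n} \<Longrightarrow> j \<in> {1..n} \<Longrightarrow> tame d (Y i j)" "set is \<subseteq> {1..n}" "J \<subseteq> {1..n}"
  shows "tame d (qdet z Y is J)"
  using assms(2,3)
proof (induction "is" arbitrary: J)
  case Nil
  then show ?case using tame_scalar[of d 0] tame_scalar[of d 1] by simp
next
  case (Cons i "is")
  show ?case unfolding qdet.simps scalar_op_minus[symmetric] scalar_op_power[symmetric]
    by (intro tame_sum tame_mult tame_scalar Cons.IH assms(1)) (use Cons.prems in auto)
qed

lemma tame_tail:
  "d \<le> 3 * n \<Longrightarrow> i \<in> {1..n} \<Longrightarrow> j \<in> {1..n} \<Longrightarrow> tame d (tail_mat d i j)"
proof (induction d arbitrary: i j)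
  case 0
  then show ?case using tame_scalar[of 0 0] tame_scalar[of 0 1] by simp
next
  case (Suc d)
  have "tame (Suc d) (layer (3 * n - Suc d) i k)" if "k \<in> {1..n}" for k
  proof (cases "step (3 * n - Suc d) i k")
    case True
    let ?e = "(3 * n - Suc d, i, k)"
    show ?thesis
      unfolding layer_def if_P[OF True] tame_def
    proof (intro allI impI)
      fix v \<alpha> assume "app (edge_op ?e) v \<alpha> \<noteq> 0"
      then have "v (\<lambda>x. \<alpha> x - unit_exp ?e x) \<noteq> 0" by (simp add: edge_op_def)
      moreover have "deg \<alpha> p = deg (\<lambda>x. \<alpha> x - unit_exp ?e x) p" if "p < 3 * n - Suc d" for p
        using deg_unit[OF Suc.prems(2) \<open>k \<in> {1..n}\<close>] that by (simp add: deg_diff)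
      ultimately show "\<exists>\<alpha>'. v \<alpha>' \<noteq> 0 \<and> (\<forall>p<3 * n - Suc d. deg \<alpha> p = deg \<alpha>' p)" by blast
    qed
  qed (use tame_scalar[of _ 0] in \<open>simp add: layer_def\<close>)
  moreover have "tame (Suc d) (tail_mat d k j)" if "k \<in> {1..n}" for k
    using Suc.IH[of k j] Suc.prems that tame_mono[of d _ "Suc d"] by auto
  ultimately show ?case unfolding tail_mat.simps mat_prod_def
    by (intro tame_sum tame_mult)
qed

text \<open>Different exponents can have the same degree; the strict inequality demands that the top
  degree is attained by one exponent only.\<close>

definition leads :: "((edge \<Rightarrow> int) \<Rightarrow> 'k) \<Rightarrow> (edge \<Rightarrow> int) \<Rightarrow> bool" where
  "leads v \<gamma> \<longleftrightarrow> v \<gamma> \<noteq> 0 \<and> (\<forall>\<alpha>. v \<alpha> \<noteq> 0 \<longrightarrow> \<alpha> \<noteq> \<gamma> \<longrightarrow> less_fun (deg \<alpha>) (deg \<gamma>))"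

text \<open>Testing on every vector that has a leading exponent makes the notion multiplicative,
  without expanding any product.\<close>

definition leading :: "(edge \<Rightarrow> int, 'k) lin_op \<Rightarrow> (edge \<Rightarrow> int) \<Rightarrow> bool" where
  "leading E \<gamma> \<longleftrightarrow> (\<forall>v \<alpha>. leads v \<alpha> \<longrightarrow> leads (app E v) (\<lambda>e. \<alpha> e + \<gamma> e))"

lemma leading_mult:
  assumes "leading E \<gamma>" "leading E' \<gamma>'"
  shows "leading (E * E') (\<lambda>e. \<gamma> e + \<gamma>' e)"
proof -
  have "leads (app E (app E' v)) (\<lambda>e. \<alpha> e + (\<gamma> e + \<gamma>' e))" if "leads v \<alpha>" for v \<alpha>
  proof -
    have "leads (app E' v) (\<lambda>e. \<alpha> e + \<gamma>' e)" using assms that by (simp add: leading_def)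
    then have "leads (app E (app E' v)) (\<lambda>e. \<alpha> e + \<gamma>' e + \<gamma> e)" using assms(1) leading_def by blast
    then show ?thesis by (simp add: algebra_simps)
  qed
  then show ?thesis by (simp add: leading_def)
qed

lemma leading_one: "leading 1 (\<lambda>e. 0)"
  by (simp add: leading_def)

lemma less_fun_deg_add:
  "less_fun (deg \<alpha>) (deg \<beta>) \<Longrightarrow> less_fun (deg (\<lambda>e. \<alpha> e + \<gamma> e)) (deg (\<lambda>e. \<beta> e + \<gamma> e))"
  unfolding less_fun_def by (simp add: deg_add)

lemma leading_monomial: 
  assumes "monomial_op E \<gamma>"
  shows "leading E \<gamma>"
proof -
  obtain u where u: "\<forall>\<alpha>. u \<alpha> \<noteq> 0" "\<forall>v \<alpha>. app E v \<alpha> = u \<alpha> * v (\<lambda>e. \<alpha> e - \<gamma> e)"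
    using assms unfolding monomial_op_def by blast
  have "leads (app E v) (\<lambda>e. \<alpha> e + \<gamma> e)" if v: "leads v \<alpha>" for v \<alpha>
    unfolding leads_def
  proof (intro conjI allI impI)
    show "app E v (\<lambda>e. \<alpha> e + \<gamma> e) \<noteq> 0" using u v by (simp add: leads_def)
    fix \<beta> assume b: "app E v \<beta> \<noteq> 0" "\<beta> \<noteq> (\<lambda>e. \<alpha> e + \<gamma> e)"
    then have "v (\<lambda>e. \<beta> e - \<gamma> e) \<noteq> 0" "(\<lambda>e. \<beta> e - \<gamma> e) \<noteq> \<alpha>" using u by auto
    then have "less_fun (deg (\<lambda>e. \<beta> e - \<gamma> e)) (deg \<alpha>)" using v by (simp add: leads_def)
    from less_fun_deg_add[OF this, of \<gamma>] show "less_fun (deg \<beta>) (deg (\<lambda>e. \<alpha> e + \<gamma> e))" by simp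
  qed
  then show ?thesis by (simp add: leading_def)
qed

lemma leads_add:
  assumes "leads v \<gamma>" "\<And>x \<alpha>. x \<in> A \<Longrightarrow> f x \<alpha> \<noteq> 0 \<Longrightarrow> less_fun (deg \<alpha>) (deg \<gamma>)"
  shows "leads (\<lambda>\<alpha>. v \<alpha> + (\<Sum>x\<in>A. f x \<alpha>)) \<gamma>"
  unfolding leads_def
proof (intro conjI allI impI)
  have "(\<Sum>x\<in>A. f x \<gamma>) = 0"
    using assms(2) less_fun_irrefl by (intro sum.neutral) blast
  then show "v \<gamma> + (\<Sum>x\<in>A. f x \<gamma>) \<noteq> 0" using assms(1) by (simp add: leads_def)
  fix \<alpha> assume "v \<alpha> + (\<Sum>x\<in>A. f x \<alpha>) \<noteq> 0" "\<alpha> \<noteq> \<gamma>"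
  then consider "v \<alpha> \<noteq> 0" | "(\<Sum>x\<in>A. f x \<alpha>) \<noteq> 0" by fastforce
  then show "less_fun (deg \<alpha>) (deg \<gamma>)"
    by cases (use assms \<open>\<alpha> \<noteq> \<gamma>\<close> in \<open>auto simp: leads_def elim!: sum.not_neutral_contains_not_neutral\<close>)
qed

text \<open>One term of the Cauchy-Binet sum wins. By \<open>best\<close>, every other next family
  loses in layer \<open>p\<close>, and nothing later can compensate: the remaining layers leave the
  degrees up to \<open>p\<close> unchanged, and \<open>p\<close> comes before them in the
  lexicographic order.\<close>

lemma leading_step:
  assumes d: "Suc d \<le> 3 * n" and p: "p = 3 * n - Suc d"
    and isr: "sorted_wrt (<) is" "set is \<subseteq> {1..n}" and ks: "sorted_wrt (<) ks" "set ks \<subseteq> {1..n}"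
    and len: "length is = length ks" and step: "list_all2 (step p) is ks" and J: "J \<subseteq> {1..n}"
    and lead: "leading (qdet z (tail_mat d) ks J) \<gamma>" and \<gamma>: "\<And>p'. p' \<le> p \<Longrightarrow> deg \<gamma> p' = 0"
    and best: "\<And>ks'. sorted_wrt (<) ks' \<Longrightarrow> set ks' \<subseteq> {1..n} \<Longrightarrow> list_all2 (step p) is ks' \<Longrightarrow> ks' \<noteq> ks \<Longrightarrow>
      qdet z (tail_mat d) ks' J \<noteq> 0 \<Longrightarrow> sgn_at p * int (sum_list ks') < sgn_at p * int (sum_list ks)"
  shows "leading (qdet z (tail_mat (Suc d)) is J) (\<lambda>e. layer_exp p is ks e + \<gamma> e)"
proof -
  let ?T = "\<lambda>K. qdet z (layer p) is K * qdet z (tail_mat d) (sorted_list_of_set K) J"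
  have sl: "sorted_list_of_set (set ks) = ks"
    using ks(1) by (simp add: sorted_list_of_set.idem_if_sorted_distinct strict_sorted_iff)
  have split: "qdet z (tail_mat (Suc d)) is J = ?T (set ks) + sum ?T (Pow {1..n} - {set ks})"
    unfolding qdet_tail_Suc[OF d isr(2) J] p[symmetric] using ks(2) by (subst sum.remove[of _ "set ks"]) auto
  have main: "leading (?T (set ks)) (\<lambda>e. layer_exp p is ks e + \<gamma> e)"
    unfolding sl qdet_layer[OF isr(1) ks(1) len] if_P[OF step]
    by (rule leading_mult[OF leading_monomial[OF monomial_layer[OF len]] lead])
  show ?thesis
    unfolding leading_def
  proof (intro allI impI)
    fix v \<alpha>\<^sub>0 assume v: "leads v \<alpha>\<^sub>0"
    let ?\<gamma> = "\<lambda>e. \<alpha>\<^sub>0 e + (layer_exp p is ks e + \<gamma> e)"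
    have low: "less_fun (deg \<alpha>) (deg ?\<gamma>)"
      if K: "K \<in> Pow {1..n} - {set ks}" and nz: "app (?T K) v \<alpha> \<noteq> 0" for K \<alpha>
    proof -
      define ks' where "ks' = sorted_list_of_set K"
      have fK: "finite K" using K finite_subset by auto
      have ks': "sorted_wrt (<) ks'" "set ks' = K"
        unfolding ks'_def using fK by (auto simp: strict_sorted_iff)
      have nz': "qdet z (layer p) is K \<noteq> 0" "qdet z (tail_mat d) ks' J \<noteq> 0"
        using nz by (auto simp: ks'_def app_scale[of _ 0, simplified])
      have "card K = length is" using qdet_card[OF fK nz'(1)] .
      then have len': "length is = length ks'" using fK by (simp add: ks'_def)
      have st: "list_all2 (step p) is ks'"
        using nz'(1) qdet_layer[OF isr(1) ks'(1) len'] ks'(2) by (auto split: if_splits)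
      have lt: "sgn_at p * int (sum_list ks') < sgn_at p * int (sum_list ks)"
        using best[OF ks'(1) _ st _ nz'(2)] K ks'(2) by auto
      have "app (prod_list (map (\<lambda>e. edge_op (p, e)) (zip is ks'))) (app (qdet z (tail_mat d) ks' J) v) \<alpha> \<noteq> 0"
        using nz qdet_layer[OF isr(1) ks'(1) len', of p] st ks'(2) by (simp add: ks'_def)
      then have "app (qdet z (tail_mat d) ks' J) v (\<lambda>e. \<alpha> e - layer_exp p is ks' e) \<noteq> 0"
        using monomial_layer[OF len', of p] unfolding monomial_op_def by auto
      moreover have "tame d (qdet z (tail_mat d) ks' J)"
        using d ks'(2) K J by (intro tame_qdet tame_tail) auto
      ultimately obtain \<alpha>' where a': "v \<alpha>' \<noteq> 0"
        and deg': "\<And>p'. p' < 3 * n - d \<Longrightarrow> deg (\<lambda>e. \<alpha> e - layer_exp p is ks' e) p' = deg \<alpha>' p'"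
        unfolding tame_def by blast
      have dL: "deg (layer_exp p is ks') p' = (if p' = p then sgn_at p' * int (sum_list ks') else 0)"
        "deg (layer_exp p is ks) p' = (if p' = p then sgn_at p' * int (sum_list ks) else 0)" for p'
        using deg_layer_exp[OF len' isr(2)] deg_layer_exp[OF len isr(2) ks(2)] ks'(2) K by auto
      have "p < 3 * n - d" using p d by simp
      have dlt: "deg \<alpha> p' = deg \<alpha>' p'" "deg ?\<gamma> p' = deg \<alpha>\<^sub>0 p'" if "p' < p" for p'
        using deg'[of p'] that \<open>p < 3 * n - d\<close> \<gamma>[of p'] by (auto simp: deg_diff deg_add dL)
      have dp: "deg \<alpha> p = deg \<alpha>' p + sgn_at p * int (sum_list ks')"
        "deg ?\<gamma> p = deg \<alpha>\<^sub>0 p + sgn_at p * int (sum_list ks)"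
        using deg'[of p] \<open>p < 3 * n - d\<close> \<gamma>[of p] by (auto simp: deg_diff deg_add dL)
      \<comment> \<open>Either the input exponent \<open>\<alpha>'\<close> already loses strictly
        before layer \<open>p\<close>, and then that layer decides; or it is no better at
        \<open>p\<close>, and then the loss \<open>lt\<close> decides there.\<close>
      show ?thesis
      proof (cases "\<alpha>' = \<alpha>\<^sub>0")
        case True
        then show ?thesis unfolding less_fun_def using dlt dp lt by (intro exI[of _ p]) auto
      next
        case False
        then obtain r where r: "deg \<alpha>' r < deg \<alpha>\<^sub>0 r" "\<And>r'. r' < r \<Longrightarrow> deg \<alpha>' r' = deg \<alpha>\<^sub>0 r'"
          using v a' unfolding leads_def less_fun_def by blast
        show ?thesis
        proof (cases "r < p")
          case True
          then show ?thesis unfolding less_fun_def using dlt r by (intro exI[of _ r]) auto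
        next
          case False
          then have "deg \<alpha>' p \<le> deg \<alpha>\<^sub>0 p" using r by (cases "r = p") auto
          then show ?thesis unfolding less_fun_def using dlt dp lt r False by (intro exI[of _ p]) auto
        qed
      qed
    qed
    have "leads (\<lambda>\<alpha>. app (?T (set ks)) v \<alpha> + (\<Sum>K\<in>Pow {1..n} - {set ks}. app (?T K) v \<alpha>)) ?\<gamma>"
      using main v low by (intro leads_add) (auto simp: leading_def)
    then show "leads (app (qdet z (tail_mat (Suc d)) is J) v) ?\<gamma>"
      unfolding split app_simps(3) app_sum .
  qed
qed

definition path_exp :: "(nat \<Rightarrow> nat list) \<Rightarrow> nat \<Rightarrow> edge \<Rightarrow> int" where
  "path_exp F t e = (\<Sum>t'\<in>{t..<3 * n}. layer_exp t' (F t') (F (Suc t')) e)"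

text \<open>Locally best choices compose, by induction on the number of remaining layers. A choice
  competes only with next families that can still reach the final set, in the sense that their
  remaining minor is nonzero.\<close>

theorem leading_path:
  assumes F: "\<And>t. t \<le> 3 * n \<Longrightarrow> sorted_wrt (<) (F t)" "\<And>t. t \<le> 3 * n \<Longrightarrow> set (F t) \<subseteq> {1..n}"
    and step: "\<And>t. t < 3 * n \<Longrightarrow> list_all2 (step t) (F t) (F (Suc t))"
    and best: "\<And>t ks. t < 3 * n \<Longrightarrow> sorted_wrt (<) ks \<Longrightarrow> set ks \<subseteq> {1..n} \<Longrightarrow> list_all2 (step t) (F t) ks \<Longrightarrow>
      ks \<noteq> F (Suc t) \<Longrightarrow> qdet z (tail_mat (3 * n - Suc t)) ks (set (F (3 * n))) \<noteq> 0 \<Longrightarrow>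
      sgn_at t * int (sum_list ks) < sgn_at t * int (sum_list (F (Suc t)))"
  shows "leading (qdet z (tail_mat (3 * n)) (F 0) (set (F (3 * n)))) (path_exp F 0)"
proof -
  have "leading (qdet z (tail_mat d) (F (3 * n - d)) (set (F (3 * n)))) (path_exp F (3 * n - d)) \<and>
     (\<forall>p < 3 * n - d. deg (path_exp F (3 * n - d)) p = 0)" if "d \<le> 3 * n" for d
    using that
  proof (induction d)
    case 0
    have "prod_list (map2 (tail_mat 0) xs xs) = 1" for xs by (induction xs) auto
    then have "qdet z (tail_mat 0) (F (3 * n)) (set (F (3 * n))) = 1"
      using F(1)[of "3 * n"] by (subst qdet_bidiagonal) (auto split: if_splits)
    moreover have "path_exp F (3 * n) = (\<lambda>e. 0)" by (simp add: path_exp_def fun_eq_iff)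
    ultimately show ?case using leading_one by simp
  next
    case (Suc d)
    define p where "p = 3 * n - Suc d"
    have p: "Suc p = 3 * n - d" "p < 3 * n" "d = 3 * n - Suc p" "Suc p \<le> 3 * n" using Suc.prems by (auto simp: p_def)
    have IH: "leading (qdet z (tail_mat d) (F (Suc p)) (set (F (3 * n)))) (path_exp F (Suc p))"
      "\<And>p'. p' \<le> p \<Longrightarrow> deg (path_exp F (Suc p)) p' = 0"
      using Suc.IH Suc.prems unfolding p(1)[symmetric] by auto
    have len: "length (F p) = length (F (Suc p))" using step[OF p(2)] list_all2_lengthD by blast
    have e: "path_exp F p = (\<lambda>e. layer_exp p (F p) (F (Suc p)) e + path_exp F (Suc p) e)"
      using p(2) by (auto simp: path_exp_def sum.atLeast_Suc_lessThan)
    have "leading (qdet z (tail_mat (Suc d)) (F p) (set (F (3 * n)))) (path_exp F p)"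
      unfolding e
      by (rule leading_step[OF Suc.prems p_def F(1) F(2) F(1)[OF p(4)] F(2)[OF p(4)] len step[OF p(2)] F(2) IH])
        (use p(2) best[OF p(2), folded p(3)] in auto)
    moreover have "deg (path_exp F p) p' = 0" if "p' < p" for p'
      unfolding e deg_add using IH(2)[of p'] that deg_layer_exp[OF len F(2) F(2)] p(2,4) by auto
    ultimately show ?case by (simp add: p_def)
  qed
  from this[of "3 * n"] show ?thesis by simp
qed

end

section \<open>Leading path families\<close>

lemma strict_sorted_bounds:
  assumes "sorted_wrt (<) xs" "set xs \<subseteq> {1..n}" "c < length xs"
  shows "Suc c \<le> xs ! c" "xs ! c + (length xs - c) \<le> Suc n"
proof -
  have "Suc c \<le> xs ! c" if "c < length xs" for c
    using that
  proof (induction c)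
    case 0
    then have "xs ! 0 \<in> set xs" by (rule nth_mem)
    then show ?case using assms(2) by auto
  next
    case (Suc c)
    then show ?case using sorted_wrt_nth_less[OF assms(1), of c "Suc c"] by simp
  qed
  then show "Suc c \<le> xs ! c" using assms(3) by blast
  have "xs ! c + (length xs - c) \<le> Suc n" if "length xs - c = Suc m" for m c
    using that
  proof (induction m arbitrary: c)
    case 0
    then have "xs ! c \<in> set xs" by (intro nth_mem) simp
    then have "xs ! c \<in> {1..n}" using assms(2) by blast
    then show ?case using 0 by simp
  next
    case (Suc m)
    then have "xs ! c < xs ! Suc c" by (intro sorted_wrt_nth_less[OF assms(1)]) auto
    moreover have "length xs - Suc c = Suc m" using Suc.prems by simp
    ultimately show ?case using Suc.IH[of "Suc c"] Suc.prems by linarith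
  qed
  then show "xs ! c + (length xs - c) \<le> Suc n"
    using assms(3) by (metis Suc_pred zero_less_diff)
qed

lemma sum_list_strict_mono_nth:
  fixes xs ys :: "nat list"
  assumes "length xs = length ys" "\<And>c. c < length xs \<Longrightarrow> xs ! c \<le> ys ! c" "xs \<noteq> ys"
  shows "sum_list xs < sum_list ys"
  using assms
proof (induction xs ys rule: list_induct2)
  case (Cons x xs y ys)
  have le: "x \<le> y" "\<And>c. c < length xs \<Longrightarrow> xs ! c \<le> ys ! c"
    using Cons.prems(1)[of 0] Cons.prems(1)[of "Suc _"] by auto
  show ?case
  proof (cases "xs = ys")
    case True
    then show ?thesis using le Cons.prems by simp
  next
    case False
    then show ?thesis using Cons.IH[OF le(2)] le(1) by simp
  qed
qed simp

context network begin

text \<open>\<open>Suc c\<close> and \<open>n - (length is - Suc c)\<close> are the least and the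
  greatest value of the \<open>c\<close>-th element of a subset of \<open>{1..n}\<close> of that
  size: the floor and the ceiling of path \<open>c\<close>. The path falls to its floor, climbs to
  its ceiling, and stays there until the remaining \<open>3 * n - t\<close> layers just suffice to
  fall to \<open>js ! c\<close>.\<close>

definition best_pos :: "nat list \<Rightarrow> nat list \<Rightarrow> nat \<Rightarrow> nat \<Rightarrow> nat" where
  "best_pos is js t c =
     (if t \<le> n then max (Suc c) (is ! c - t)
      else if t \<le> 2 * n then min (n - (length is - Suc c)) (Suc c + (t - n))
      else min (n - (length is - Suc c)) (js ! c + (3 * n - t)))"

definition best_path :: "nat list \<Rightarrow> nat list \<Rightarrow> nat \<Rightarrow> nat list" where
  "best_path is js t = map (best_pos is js t) [0..<length is]"

text \<open>In the last third a path falls by at most one per layer and paths keep their order, so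
  the \<open>c\<close>-th start lies at most \<open>d\<close> above the \<open>c\<close>-th end.
  This bound makes the latest possible fall optimal.\<close>

lemma reach:
  assumes "d \<le> n" "sorted_wrt (<) ks" "set ks \<subseteq> {1..n}" "J \<subseteq> {1..n}"
    "qdet z (tail_mat d) ks J \<noteq> 0"
  shows "length ks = card J \<and> (\<forall>c<length ks. ks ! c \<le> sorted_list_of_set J ! c + d)"
  using assms
proof (induction d arbitrary: ks)
  case 0
  have J: "finite J" using 0 finite_subset by auto
  have len: "length ks = card J" using qdet_card[OF J 0(5)] by simp
  define js where "js = sorted_list_of_set J"
  have js: "sorted_wrt (<) js" "set js = J" "length js = length ks"
    unfolding js_def using J len by (auto simp: strict_sorted_iff)
  have "qdet z (tail_mat 0) ks (set js) = prod_list (map2 (tail_mat 0) ks js)"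
    by (rule qdet_bidiagonal) (use 0(2) js in \<open>auto split: if_splits\<close>)
  then have "prod_list (map2 (tail_mat 0) ks js) \<noteq> 0"
    using 0(5) js(2) by metis
  moreover have "prod_list (map2 (tail_mat 0) ks js) = (if ks = js then 1 else 0)"
    using js(3)[symmetric] by (induction ks js rule: list_induct2) auto
  ultimately have "ks = js" by metis
  then show ?case using len by (simp add: js_def)
next
  case (Suc d)
  have d: "Suc d \<le> 3 * n" using Suc.prems(1) by simp
  obtain K where K: "K \<subseteq> {1..n}" "qdet z (layer (3 * n - Suc d)) ks K \<noteq> 0"
    "qdet z (tail_mat d) (sorted_list_of_set K) J \<noteq> 0"
  proof -
    have "(\<Sum>K\<in>Pow {1..n}. qdet z (layer (3 * n - Suc d)) ks K * qdet z (tail_mat d) (sorted_list_of_set K) J) \<noteq> 0"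
      using Suc.prems(5) qdet_tail_Suc[OF d Suc.prems(3,4)] by simp
    then obtain K where "K \<in> Pow {1..n}"
      "qdet z (layer (3 * n - Suc d)) ks K * qdet z (tail_mat d) (sorted_list_of_set K) J \<noteq> 0"
      by (rule sum.not_neutral_contains_not_neutral)
    then show thesis using that[of K] by (metis PowD mult_zero_left mult_zero_right)
  qed
  have fK: "finite K" using K finite_subset by auto
  define ls where "ls = sorted_list_of_set K"
  have ls: "sorted_wrt (<) ls" "set ls = K" "length ks = length ls"
    unfolding ls_def using fK qdet_card[OF fK K(2)] by (auto simp: strict_sorted_iff)
  have "list_all2 (step (3 * n - Suc d)) ks ls"
    using K(2) qdet_layer[OF Suc.prems(2) ls(1,3)] ls(2) by (auto split: if_splits)
  then have st: "step (3 * n - Suc d) (ks ! c) (ls ! c)" if "c < length ks" for c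
    using that by (simp add: list_all2_conv_all_nth)
  have "\<not> up (3 * n - Suc d)" using Suc.prems(1) unfolding up_def by arith
  then have "ks ! c \<le> Suc (ls ! c)" if "c < length ks" for c
    using st[OF that] by (auto simp: step_def)
  moreover have "length ls = card J \<and> (\<forall>c<length ls. ls ! c \<le> sorted_list_of_set J ! c + d)"
    using Suc.IH[OF _ ls(1)] Suc.prems K ls(2) by (simp add: ls_def)
  ultimately show ?case using ls(3) by (metis (no_types, lifting) Suc_le_mono add_Suc_right le_trans)
qed

context
  fixes "is" js :: "nat list"
  assumes isr: "sorted_wrt (<) is" "set is \<subseteq> {1..n}" and jsr: "sorted_wrt (<) js" "set js \<subseteq> {1..n}"
    and len: "length is = length js"
begin

lemma is_bounds: "c < length is \<Longrightarrow> Suc c \<le> is ! c" "c < length is \<Longrightarrow> is ! c \<le> n - (length is - Suc c)"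
  "c < length is \<Longrightarrow> length is - c \<le> n"
  using strict_sorted_bounds[OF isr, of c] by auto

lemma js_bounds: "c < length is \<Longrightarrow> Suc c \<le> js ! c" "c < length is \<Longrightarrow> js ! c \<le> n - (length is - Suc c)"
  using strict_sorted_bounds[OF jsr, of c] len by auto

lemma is_less: "c < c' \<Longrightarrow> c' < length is \<Longrightarrow> is ! c < is ! c' \<and> js ! c < js ! c'"
  using sorted_wrt_nth_less[OF isr(1)] sorted_wrt_nth_less[OF jsr(1)] len by auto

lemma best_pos_range: "c < length is \<Longrightarrow> Suc c \<le> best_pos is js t c \<and> best_pos is js t c \<le> n - (length is - Suc c)"
  using is_bounds[of c] js_bounds[of c] unfolding best_pos_def by auto

lemma best_pos_less:
  assumes "c < c'" "c' < length is"
  shows "best_pos is js t c < best_pos is js t c'"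
  using is_less[OF assms] is_bounds[of c'] js_bounds[of c'] assms unfolding best_pos_def by auto

lemma best_path_sorted: "sorted_wrt (<) (best_path is js t)"
  unfolding best_path_def sorted_wrt_iff_nth_less using best_pos_less by simp

lemma best_path_set: "set (best_path is js t) \<subseteq> {1..n}"
proof -
  have "best_pos is js t c \<in> {1..n}" if "c < length is" for c
    using best_pos_range[OF that, of t] by auto
  then show ?thesis by (auto simp: best_path_def)
qed

lemma best_path_start: "best_path is js 0 = is"
  unfolding best_path_def using is_bounds(1)
  by (intro nth_equalityI) (auto simp: best_pos_def max_def not_le)

lemma best_path_end: "best_path is js (3 * n) = js"
proof (cases "n = 0")
  case True
  then have "is = []" "js = []" using isr(2) jsr(2) by auto
  then show ?thesis by (simp add: best_path_def)
next
  case False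
  then show ?thesis unfolding best_path_def using js_bounds(2) len
    by (intro nth_equalityI) (auto simp: best_pos_def min_def le_antisym)
qed

lemma best_pos_step:
  assumes "c < length is" "t < 3 * n"
  shows "step t (best_pos is js t c) (best_pos is js (Suc t) c)"
proof -
  note b = is_bounds[OF assms(1)] js_bounds[OF assms(1)]
  consider "t < n" | "n \<le> t" "t < 2 * n" | "2 * n \<le> t" by linarith
  then show ?thesis
  proof cases
    case 1
    then show ?thesis unfolding step_def up_def best_pos_def by auto
  next
    case 2
    \<comment> \<open>At the switching time \<open>t = n\<close> the formulas of both thirds give
      the floor.\<close>
    have "best_pos is js t c = min (n - (length is - Suc c)) (Suc c + (t - n))"
      using 2 b unfolding best_pos_def by (cases "t = n") auto
    moreover have "best_pos is js (Suc t) c = min (n - (length is - Suc c)) (Suc c + (Suc t - n))"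
      using 2 unfolding best_pos_def by auto
    ultimately show ?thesis using 2 unfolding step_def up_def by (auto simp: Suc_diff_le min_def)
  next
    case 3
    \<comment> \<open>At the switching time \<open>t = 2 * n\<close> the formulas of both thirds
      give the ceiling.\<close>
    have "best_pos is js t c = min (n - (length is - Suc c)) (js ! c + (3 * n - t))"
      using 3 b assms unfolding best_pos_def by (cases "t = 2 * n") auto
    moreover have "best_pos is js (Suc t) c = min (n - (length is - Suc c)) (js ! c + (3 * n - Suc t))"
      using 3 unfolding best_pos_def by auto
    moreover have "3 * n - t = Suc (3 * n - Suc t)" using assms by simp
    ultimately show ?thesis using 3 unfolding step_def up_def by (auto simp: min_def)
  qed
qed

lemma best_path_step: "t < 3 * n \<Longrightarrow> list_all2 (step t) (best_path is js t) (best_path is js (Suc t))"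
  unfolding best_path_def by (simp add: list_all2_conv_all_nth best_pos_step)

text \<open>The comparison holds for each path separately. In the first third lower is better, and
  no path can fall faster than by one or below its floor; in the middle none can rise faster than by
  one or above its ceiling; in the last third \<open>reach\<close> and the ceiling bound every
  family that still arrives at \<open>js\<close>.\<close>

lemma best_path_best:
  assumes t: "t < 3 * n" and ks: "sorted_wrt (<) ks" "set ks \<subseteq> {1..n}"
    and st: "list_all2 (step t) (best_path is js t) ks" and ne: "ks \<noteq> best_path is js (Suc t)"
    and nz: "qdet z (tail_mat (3 * n - Suc t)) ks (set js) \<noteq> 0"
  shows "sgn_at t * int (sum_list ks) < sgn_at t * int (sum_list (best_path is js (Suc t)))"
proof -
  have lk: "length ks = length is"
    using list_all2_lengthD[OF st] by (simp add: best_path_def)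
  have sc: "step t (best_pos is js t c) (ks ! c)" if "c < length is" for c
    using st that lk by (auto simp: list_all2_conv_all_nth best_path_def)
  have kb: "Suc c \<le> ks ! c" "ks ! c \<le> n - (length is - Suc c)" if "c < length is" for c
    using strict_sorted_bounds[OF ks, of c] that lk by auto
  have nth: "best_path is js (Suc t) ! c = best_pos is js (Suc t) c" if "c < length is" for c
    using that by (simp add: best_path_def)
  have lb: "length (best_path is js (Suc t)) = length is" by (simp add: best_path_def)
  show ?thesis
  proof (cases "t < n")
    case True
    have "best_pos is js (Suc t) c \<le> ks ! c" if "c < length is" for c
    proof -
      have "ks ! c = best_pos is js t c \<or> best_pos is js t c = Suc (ks ! c)"
        using sc[OF that] True by (auto simp: step_def up_def)
      then show ?thesis using kb(1)[OF that] True unfolding best_pos_def by auto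
    qed
    then have "sum_list (best_path is js (Suc t)) < sum_list ks"
      using lk lb nth ne by (intro sum_list_strict_mono_nth) auto
    then show ?thesis using True by (simp add: sgn_at_def)
  next
    case False
    have "ks ! c \<le> best_pos is js (Suc t) c" if c: "c < length is" for c
    proof (cases "t < 2 * n")
      case True
      have "ks ! c \<le> Suc (best_pos is js t c)"
        using sc[OF c] by (auto simp: step_def split: if_splits)
      then show ?thesis using kb[OF c] is_bounds[OF c] True False unfolding best_pos_def
        by (cases "t = n") (auto simp: Suc_diff_le min_def)
    next
      case F2: False
      have "length ks = card (set js) \<and> (\<forall>c<length ks. ks ! c \<le> sorted_list_of_set (set js) ! c + (3 * n - Suc t))"
        using F2 ks jsr nz by (intro reach) auto
      moreover have "sorted_list_of_set (set js) = js"
        using jsr(1) by (simp add: sorted_list_of_set.idem_if_sorted_distinct strict_sorted_iff)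
      ultimately have "ks ! c \<le> js ! c + (3 * n - Suc t)" using c lk by simp
      then show ?thesis using kb[OF c] F2 unfolding best_pos_def by auto
    qed
    then have "sum_list ks < sum_list (best_path is js (Suc t))"
      using lk lb nth ne by (intro sum_list_strict_mono_nth) auto
    then show ?thesis using False by (simp add: sgn_at_def)
  qed
qed

definition "pair_exp = path_exp (best_path is js) 0"

theorem leading_minor: "leading (qdet z (tail_mat (3 * n)) is (set js)) pair_exp"
proof -
  have "leading (qdet z (tail_mat (3 * n)) (best_path is js 0) (set (best_path is js (3 * n)))) pair_exp"
    unfolding pair_exp_def
    by (rule leading_path)
      (use best_path_sorted best_path_set best_path_step best_path_best best_path_end in auto)
  then show ?thesis by (simp add: best_path_start best_path_end)
qed

lemma pair_exp_edge:
  assumes "t < 3 * n"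
  shows "pair_exp (t, i, k) = int (card {c. c < length is \<and> best_pos is js t c = i \<and> best_pos is js (Suc t) c = k})"
proof -
  have "pair_exp (t, i, k) = (\<Sum>t'\<in>{t}. layer_exp t' (best_path is js t') (best_path is js (Suc t')) (t, i, k))"
    unfolding pair_exp_def path_exp_def
    by (rule sum.mono_neutral_right) (use assms in \<open>auto simp: layer_exp_def count_list_0_iff\<close>)
  also have "\<dots> = int (length (filter ((=) (t, i, k)) (map (Pair t) (zip (best_path is js t) (best_path is js (Suc t))))))"
    by (simp add: layer_exp_def count_list_eq_length_filter)
  also have "\<dots> = int (card {c. c < length is \<and> best_pos is js t c = i \<and> best_pos is js (Suc t) c = k})"
    unfolding length_filter_conv_card by (auto simp: best_path_def intro!: arg_cong[where f = card])
  finally show ?thesis .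
qed

text \<open>Path \<open>c\<close> uses this falling edge exactly if it stands at
  \<open>Suc k\<close> at time \<open>t\<close> and is still above its floor. An entry equal to
  \<open>Suc c\<close> therefore leaves no trace here.\<close>

lemma pair_exp_first:
  assumes "t < n"
  shows "pair_exp (t, Suc k, k) = int (card {c. c < length is \<and> c < k \<and> is ! c = Suc (k + t)})"
proof -
  have "{c. c < length is \<and> best_pos is js t c = Suc k \<and> best_pos is js (Suc t) c = k} =
    {c. c < length is \<and> c < k \<and> is ! c = Suc (k + t)}"
    using assms unfolding best_pos_def by auto
  then show ?thesis using assms by (subst pair_exp_edge) auto
qed

text \<open>At time \<open>n\<close> all paths stand on their floors, so \<open>Suc c\<close> is
  occupied exactly when path \<open>c\<close> exists, whichever edge it takes next. Summed over
  rows, this gives the column lengths of a tableau.\<close>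

lemma pair_exp_middle:
  assumes "0 < n"
  shows "pair_exp (n, Suc c, Suc c) + pair_exp (n, Suc c, Suc (Suc c)) = (if c < length is then 1 else 0)"
proof -
  have pos: "best_pos is js n c' = Suc c'" if "c' < length is" for c'
    using is_bounds[OF that] unfolding best_pos_def by auto
  have "{c'. c' < length is \<and> best_pos is js n c' = Suc c \<and> best_pos is js (Suc n) c' = k} =
    (if c < length is \<and> best_pos is js (Suc n) c = k then {c} else {})" for k
    using pos by auto
  moreover have "best_pos is js (Suc n) c = Suc c \<or> best_pos is js (Suc n) c = Suc (Suc c)" if "c < length is"
    using best_pos_step[OF that, of n] pos[OF that] assms by (auto simp: step_def up_def)
  ultimately show ?thesis using assms by (auto simp: pair_exp_edge)
qed

text \<open>The mirror image of \<open>pair_exp_first\<close>: time is counted back from the end,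
  and positions are reflected by \<open>Suc n - x\<close>. Reflection turns the ceiling of path
  \<open>c\<close> into the floor of the path with index \<open>length is - Suc c\<close>, which is
  why the row is reversed.\<close>

lemma pair_exp_last:
  assumes "d < n" "0 < k" "k < n"
  shows "pair_exp (3 * n - Suc d, Suc k, k) =
    int (card {c. c < length is \<and> c < n - k \<and> Suc n - rev js ! c = Suc (n - k + d)})"
proof -
  let ?s = "length is"
  define t where "t = 3 * n - Suc d"
  have t: "3 * n - t = Suc d" "3 * n - Suc t = d" "2 * n \<le> t" "t < 3 * n" "2 * n < Suc t"
    using assms by (auto simp: t_def)
  have "best_pos is js t c = Suc k \<and> best_pos is js (Suc t) c = k \<longleftrightarrow>
    ?s - Suc c < n - k \<and> Suc n - rev js ! (?s - Suc c) = Suc (n - k + d)" if c: "c < ?s" for c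
  proof -
    note b = is_bounds[OF c] js_bounds[OF c]
    define N where "N = n - (?s - Suc c)"
    have N: "?s - Suc c < n - k \<longleftrightarrow> k < N"
      using b(3) assms unfolding N_def by arith
    have "best_pos is js t c = min (n - (?s - Suc c)) (js ! c + Suc d)"
      using t b c unfolding best_pos_def by (cases "t = 2 * n") auto
    moreover have "best_pos is js (Suc t) c = min (n - (?s - Suc c)) (js ! c + d)"
      using t unfolding best_pos_def by auto
    moreover have "rev js ! (?s - Suc c) = js ! c"
      using c len by (simp add: rev_nth)
    moreover have "min N (js ! c + Suc d) = Suc k \<and> min N (js ! c + d) = k \<longleftrightarrow> k < N \<and> js ! c + d = k"
      unfolding min_def by auto
    moreover have "Suc n - js ! c = Suc (n - k + d) \<longleftrightarrow> js ! c + d = k"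
      using b(5) \<open>k < n\<close> by arith
    ultimately show ?thesis unfolding N N_def[symmetric] by metis
  qed
  then have "{c. c < ?s \<and> best_pos is js t c = Suc k \<and> best_pos is js (Suc t) c = k} =
    {c. c < ?s \<and> ?s - Suc c < n - k \<and> Suc n - rev js ! (?s - Suc c) = Suc (n - k + d)}"
    by blast
  moreover have "bij_betw (\<lambda>c. ?s - Suc c)
    {c. c < ?s \<and> ?s - Suc c < n - k \<and> Suc n - rev js ! (?s - Suc c) = Suc (n - k + d)}
    {c. c < ?s \<and> c < n - k \<and> Suc n - rev js ! c = Suc (n - k + d)}"
    by (rule bij_betwI[where g = "\<lambda>c. ?s - Suc c"]) auto
  ultimately show ?thesis
    using pair_exp_edge[OF t(4), of "Suc k" k] by (simp add: t_def[symmetric] bij_betw_same_card)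
qed

end

end

section \<open>Exponents of antipreferred bitableaux\<close>

text \<open>A finite downward closed set of indices is an initial segment, so membership is
  comparison with the cardinality. This is how columns are rebuilt from multiplicities.\<close>

lemma less_card_down_closed:
  assumes "\<And>r r'. r' < r \<Longrightarrow> r < L \<Longrightarrow> P r \<Longrightarrow> P r'"
  shows "r < card {r. r < L \<and> P r} \<longleftrightarrow> r < L \<and> P r"
proof -
  obtain m where m: "{r. r < L \<and> P r} = {..<m}"
  proof (cases "\<exists>r<L. \<not> P r")
    case True
    define m where "m = (LEAST r. r < L \<and> \<not> P r)"
    have "m < L \<and> \<not> P m" unfolding m_def using True by (rule LeastI_ex)
    moreover have "r < L \<and> P r" if "r < m" for r
      using not_less_Least[OF that[unfolded m_def]] that calculation by auto
    ultimately have "{r. r < L \<and> P r} = {..<m}"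
      using assms[of m] by (auto simp: not_less[symmetric]) (metis linorder_neqE_nat)
    then show thesis by (rule that)
  qed (use that in auto)
  then show ?thesis by (metis card_lessThan lessThan_iff mem_Collect_eq)
qed

lemma is_tableau_lengths:
  assumes "is_tableau n T" "r' < r" "r < length T"
  shows "length (T ! r) \<le> length (T ! r')"
  using assms unfolding is_tableau_def
  by (auto simp: sorted_wrt_iff_nth_less[of _ "map length T"])

lemma increasing_tableau_bounds:
  assumes "is_tableau n T" "increasing_tableau T" "r < length T" "c < length (T ! r)"
  shows "Suc c \<le> T ! r ! c" "T ! r ! c \<le> n"
proof -
  have r: "T ! r \<in> set T" using assms(3) by simp
  have "sorted_wrt (<) (T ! r)" "set (T ! r) \<subseteq> {1..n}"
    using assms(1,2) r unfolding is_tableau_def increasing_tableau_def by blast+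
  then show "Suc c \<le> T ! r ! c" using strict_sorted_bounds(1) assms(4) by blast
  have "T ! r ! c \<in> {1..n}" using \<open>set (T ! r) \<subseteq> {1..n}\<close> assms(4) nth_mem by blast
  then show "T ! r ! c \<le> n" by simp
qed

definition column_count :: "tableau \<Rightarrow> nat \<Rightarrow> nat \<Rightarrow> nat" where
  "column_count T i c = (\<Sum>r<length T. if c < length (T ! r) \<and> T ! r ! c = i then 1 else 0)"

lemma sum_if_card: "finite A \<Longrightarrow> (\<Sum>x\<in>A. if P x then 1 else 0 :: nat) = card {x \<in> A. P x}"
  by (simp add: sum.If_cases Int_def)

lemma tableau_shape_iff:
  assumes "is_tableau n T"
  shows "r < length T \<and> c < length (T ! r) \<longleftrightarrow> r < (\<Sum>r<length T. if c < length (T ! r) then 1 else 0)"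
proof -
  have "(\<Sum>r<length T. if c < length (T ! r) then 1 else 0) = card {r. r < length T \<and> c < length (T ! r)}"
    by (subst sum_if_card) auto
  moreover have "r < card {r. r < length T \<and> c < length (T ! r)} \<longleftrightarrow> r < length T \<and> c < length (T ! r)"
    by (rule less_card_down_closed) (use is_tableau_lengths[OF assms] in fastforce)
  ultimately show ?thesis by simp
qed

text \<open>Columns are nondecreasing, so the entries up to \<open>i\<close> in a column fill an
  initial segment of rows.\<close>

lemma tableau_entry_iff:
  assumes "is_tableau n T" "increasing_tableau T"
  shows "r < length T \<and> c < length (T ! r) \<and> T ! r ! c \<le> i \<longleftrightarrow> r < (\<Sum>i'\<le>i. column_count T i' c)"
proof -
  have "(\<Sum>i'\<le>i. column_count T i' c) = (\<Sum>r<length T. \<Sum>i'\<le>i. if c < length (T ! r) \<and> T ! r ! c = i' then 1 else 0)"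
    unfolding column_count_def by (rule sum.swap)
  also have "\<dots> = (\<Sum>r<length T. if c < length (T ! r) \<and> T ! r ! c \<le> i then 1 else 0)"
    by (intro sum.cong refl) auto
  also have "\<dots> = card {r. r < length T \<and> c < length (T ! r) \<and> T ! r ! c \<le> i}"
    by (subst sum_if_card) auto
  finally have "(\<Sum>i'\<le>i. column_count T i' c) = card {r. r < length T \<and> c < length (T ! r) \<and> T ! r ! c \<le> i}" .
  moreover have "r < card {r. r < length T \<and> c < length (T ! r) \<and> T ! r ! c \<le> i} \<longleftrightarrow>
     r < length T \<and> c < length (T ! r) \<and> T ! r ! c \<le> i"
  proof (rule less_card_down_closed)
    fix r r' assume h: "r' < r" "r < length T" "c < length (T ! r) \<and> T ! r ! c \<le> i"
    then have "T ! r' ! c \<le> T ! r ! c" using assms(2) unfolding increasing_tableau_def by blast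
    then show "c < length (T ! r') \<and> T ! r' ! c \<le> i"
      using is_tableau_lengths[OF assms(1) h(1,2)] h by simp
  qed
  ultimately show ?thesis by simp
qed

text \<open>The assumptions are exactly what the network shows. Differences of the counts in
  \<open>k\<close> give the multiplicity of \<open>i\<close> in column \<open>c\<close> for
  \<open>i > Suc c\<close>; values below \<open>Suc c\<close> cannot occur in column
  \<open>c\<close>; and the multiplicity of \<open>Suc c\<close> is what remains of the column
  length.\<close>

lemma increasing_tableau_eqI:
  assumes T: "is_tableau n T" "increasing_tableau T" and U: "is_tableau n U" "increasing_tableau U"
    and shape: "\<And>c. (\<Sum>r<length T. if c < length (T ! r) then 1 else 0 :: nat) =
      (\<Sum>r<length U. if c < length (U ! r) then 1 else 0)"
    and count: "\<And>k i. k < i \<Longrightarrow> i \<le> n \<Longrightarrow>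
      (\<Sum>r<length T. card {c. c < length (T ! r) \<and> c < k \<and> T ! r ! c = i}) =
      (\<Sum>r<length U. card {c. c < length (U ! r) \<and> c < k \<and> U ! r ! c = i})"
  shows "T = U"
proof -
  have step: "(\<Sum>r<length V. card {c. c < length (V ! r) \<and> c < Suc k \<and> V ! r ! c = i}) =
    (\<Sum>r<length V. card {c. c < length (V ! r) \<and> c < k \<and> V ! r ! c = i}) + column_count V i k" for V k i
  proof -
    have "card {c. c < length (V ! r) \<and> c < Suc k \<and> V ! r ! c = i} =
      card {c. c < length (V ! r) \<and> c < k \<and> V ! r ! c = i} + (if k < length (V ! r) \<and> V ! r ! k = i then 1 else 0)" for r
    proof (cases "k < length (V ! r) \<and> V ! r ! k = i")
      case True
      then have "{c. c < length (V ! r) \<and> c < Suc k \<and> V ! r ! c = i} =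
        insert k {c. c < length (V ! r) \<and> c < k \<and> V ! r ! c = i}" by auto
      then show ?thesis using True by simp
    next
      case False
      then have "{c. c < length (V ! r) \<and> c < Suc k \<and> V ! r ! c = i} =
        {c. c < length (V ! r) \<and> c < k \<and> V ! r ! c = i}" by (auto simp: less_Suc_eq)
      then show ?thesis using False by simp
    qed
    then show ?thesis by (simp only: sum.distrib column_count_def)
  qed
  have large: "column_count V i c = 0" if "is_tableau n V" "increasing_tableau V" "i < Suc c \<or> n < i" for V i c
    unfolding column_count_def
    using increasing_tableau_bounds[OF that(1,2)] that(3) by (intro sum.neutral) force
  have high: "column_count T i c = column_count U i c" if "Suc c < i" for i c
  proof (cases "i \<le> n")
    case True
    then show ?thesis
      using step[where V = T and k = c and i = i] step[where V = U and k = c and i = i] count[of "Suc c" i] count[of c i] that by simp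
  qed (use large[OF T] large[OF U] in simp)
  have total: "(\<Sum>r<length V. if c < length (V ! r) then 1 else 0) = (\<Sum>i\<le>n. column_count V i c)"
    if "is_tableau n V" "increasing_tableau V" for V c
    unfolding column_count_def
    by (subst sum.swap) (use increasing_tableau_bounds(2)[OF that] in \<open>auto intro!: sum.cong\<close>)
  have "column_count T i c = column_count U i c" for i c
  proof (cases "i = Suc c \<and> i \<le> n")
    case True
    have rest: "(\<Sum>i'\<in>{..n} - {i}. column_count T i' c) = (\<Sum>i'\<in>{..n} - {i}. column_count U i' c)"
    proof (rule sum.cong[OF refl])
      fix i' assume "i' \<in> {..n} - {i}"
      then show "column_count T i' c = column_count U i' c"
        using True high[of c i'] large[OF T, of i' c] large[OF U, of i' c] by (cases "Suc c < i'") auto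
    qed
    have "(\<Sum>i'\<le>n. column_count V i' c) = column_count V i c + (\<Sum>i'\<in>{..n} - {i}. column_count V i' c)" for V
      using True by (intro sum.remove) auto
    then show ?thesis using total[OF T, of c] total[OF U, of c] shape[of c] rest by simp
  next
    case False
    then have "Suc c < i \<or> i < Suc c \<or> n < i" by arith
    then show ?thesis using high[of c i] large[OF T, of i c] large[OF U, of i c]
      by (elim disjE) auto
  qed
  then have entry: "r < length T \<and> c < length (T ! r) \<and> T ! r ! c \<le> i \<longleftrightarrow>
      r < length U \<and> c < length (U ! r) \<and> U ! r ! c \<le> i" for r c i
    unfolding tableau_entry_iff[OF T] tableau_entry_iff[OF U] by simp
  have box: "r < length T \<and> c < length (T ! r) \<longleftrightarrow> r < length U \<and> c < length (U ! r)" for r c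
    unfolding tableau_shape_iff[OF T(1)] tableau_shape_iff[OF U(1)] by (simp add: shape)
  have ne: "T ! r \<noteq> []" if "r < length T" for r
    using T(1) that unfolding is_tableau_def by (metis nth_mem)
  have ne': "U ! r \<noteq> []" if "r < length U" for r
    using U(1) that unfolding is_tableau_def by (metis nth_mem)
  have rows: "r < length T \<longleftrightarrow> r < length U" for r
    using box[of r 0] ne[of r] ne'[of r] by auto
  then have len: "length T = length U" by (metis linorder_neqE_nat less_irrefl)
  show ?thesis
  proof (rule nth_equalityI[OF len])
    fix r assume r: "r < length T"
    have "c < length (T ! r) \<longleftrightarrow> c < length (U ! r)" for c using box[of r c] r len by auto
    then have lr: "length (T ! r) = length (U ! r)" by (metis linorder_neqE_nat less_irrefl)
    show "T ! r = U ! r"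
    proof (rule nth_equalityI[OF lr])
      fix c assume c: "c < length (T ! r)"
      show "T ! r ! c = U ! r ! c"
        using entry[of r c "T ! r ! c"] entry[of r c "U ! r ! c"] r c len lr by auto
    qed
  qed
qed

text \<open>Reversing the alphabet exchanges increasing and decreasing tableaux of one shape, so
  that reconstruction is only carried out for increasing ones.\<close>

definition flip_tableau :: "nat \<Rightarrow> tableau \<Rightarrow> tableau" where
  "flip_tableau n T = map (map (\<lambda>x. Suc n - x)) T"

lemma length_flip [simp]: "length (flip_tableau n T) = length T"
  "r < length T \<Longrightarrow> length (flip_tableau n T ! r) = length (T ! r)"
  "r < length T \<Longrightarrow> c < length (T ! r) \<Longrightarrow> flip_tableau n T ! r ! c = Suc n - T ! r ! c"
  by (simp_all add: flip_tableau_def)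

lemma is_tableau_entry: "is_tableau n T \<Longrightarrow> r < length T \<Longrightarrow> c < length (T ! r) \<Longrightarrow> T ! r ! c \<in> {1..n}"
  unfolding is_tableau_def by (meson nth_mem subsetD)

lemma is_tableau_flip:
  assumes "is_tableau n T"
  shows "is_tableau n (flip_tableau n T)"
proof -
  have "map length (flip_tableau n T) = map length T" by (simp add: flip_tableau_def)
  moreover have "[] \<notin> set (flip_tableau n T)" using assms by (auto simp: flip_tableau_def is_tableau_def)
  moreover have "set r \<subseteq> {1..n}" if "r \<in> set (flip_tableau n T)" for r
  proof -
    obtain r' where "r' \<in> set T" "r = map (\<lambda>x. Suc n - x) r'" using \<open>r \<in> _\<close> by (auto simp: flip_tableau_def)
    moreover from this have "set r' \<subseteq> {1..n}" using assms by (auto simp: is_tableau_def)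
    ultimately show ?thesis by fastforce
  qed
  ultimately show ?thesis using assms unfolding is_tableau_def by simp
qed

lemma flip_flip:
  assumes "is_tableau n T"
  shows "flip_tableau n (flip_tableau n T) = T"
proof (rule nth_equalityI)
  fix r assume "r < length (flip_tableau n (flip_tableau n T))"
  then show "flip_tableau n (flip_tableau n T) ! r = T ! r"
  proof (intro nth_equalityI)
    fix c assume "c < length (flip_tableau n (flip_tableau n T) ! r)"
    then have "c < length (T ! r)" using \<open>r < _\<close> by simp
    then show "flip_tableau n (flip_tableau n T) ! r ! c = T ! r ! c"
      using is_tableau_entry[OF assms, of r c] \<open>r < _\<close> by simp
  qed simp
qed simp

lemma increasing_flip:
  assumes "is_tableau n T" "decreasing_tableau T"
  shows "increasing_tableau (flip_tableau n T)"
  unfolding increasing_tableau_def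
proof (intro conjI ballI allI impI)
  fix r assume "r \<in> set (flip_tableau n T)"
  then obtain r' where r': "r' \<in> set T" "r = map (\<lambda>x. Suc n - x) r'" by (auto simp: flip_tableau_def)
  have "set r' \<subseteq> {1..n}" "sorted_wrt (>) r'"
    using assms r'(1) by (auto simp: is_tableau_def decreasing_tableau_def)
  then show "sorted_wrt (<) r" unfolding r'(2) sorted_wrt_map
    by (elim sorted_wrt_mono_rel[rotated]) fastforce
next
  fix a b c assume h: "a < b \<and> b < length (flip_tableau n T) \<and> c < length (flip_tableau n T ! b)"
  then have "c < length (T ! a)" using is_tableau_lengths[OF assms(1), of a b] h by auto
  moreover have "T ! b ! c \<le> T ! a ! c"
    using assms(2) h length_flip(2)[of b T n] unfolding decreasing_tableau_def length_flip(1) by metis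
  ultimately show "flip_tableau n T ! a ! c \<le> flip_tableau n T ! b ! c"
    using h length_flip(2)[of b T n] length_flip(3)[of b T c n] length_flip(3)[of a T c n] by auto
qed

lemma antipreferredD:
  assumes "(T, T') \<in> antipreferred_bitableaux n"
  shows "is_tableau n T" "is_tableau n T'" "increasing_tableau T" "decreasing_tableau T'"
    "length T = length T'" "r < length T \<Longrightarrow> length (T ! r) = length (T' ! r)"
    "r < length T \<Longrightarrow> sorted_wrt (<) (T ! r) \<and> set (T ! r) \<subseteq> {1..n}"
    "r < length T \<Longrightarrow> sorted_wrt (<) (rev (T' ! r)) \<and> set (rev (T' ! r)) \<subseteq> {1..n}"
proof -
  show *: "is_tableau n T" "is_tableau n T'" "increasing_tableau T" "decreasing_tableau T'"
    using assms by (auto simp: antipreferred_bitableaux_def bitableaux_def)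
  have ml: "map length T = map length T'"
    using assms by (auto simp: antipreferred_bitableaux_def bitableaux_def)
  then show len: "length T = length T'" by (metis length_map)
  show "length (T ! r) = length (T' ! r)" if "r < length T" using ml that len by (metis nth_map)
  show "sorted_wrt (<) (T ! r) \<and> set (T ! r) \<subseteq> {1..n}" if "r < length T"
    using * that by (simp add: increasing_tableau_def is_tableau_def)
  show "sorted_wrt (<) (rev (T' ! r)) \<and> set (rev (T' ! r)) \<subseteq> {1..n}" if "r < length T"
    using * that len by (simp add: decreasing_tableau_def is_tableau_def sorted_wrt_rev)
qed

context network begin

text \<open>Rows of the decreasing tableau are reversed because path families are increasing
  lists.\<close>

definition bitableau_exp :: "tableau \<times> tableau \<Rightarrow> edge \<Rightarrow> int" where
  "bitableau_exp = (\<lambda>(T, T') e. \<Sum>r<length T. pair_exp (T ! r) (rev (T' ! r)) e)"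

definition bitableau_op :: "tableau \<times> tableau \<Rightarrow> (edge \<Rightarrow> int, 'k) lin_op" where
  "bitableau_op = (\<lambda>(T, T'). prod_list (map2 (\<lambda>r r'. qdet z (tail_mat (3 * n)) r (set r')) T T'))"

lemma leading_prod_list:
  "(\<And>r. r < length xs \<Longrightarrow> leading (xs ! r) (g r)) \<Longrightarrow> leading (prod_list xs) (\<lambda>e. \<Sum>r<length xs. g r e)"
proof (induction xs arbitrary: g)
  case Nil
  then show ?case using leading_one by simp
next
  case (Cons x xs)
  have "leading x (g 0)" using Cons.prems[of 0] by simp
  moreover have "leading (prod_list xs) (\<lambda>e. \<Sum>r<length xs. g (Suc r) e)"
    by (rule Cons.IH) (use Cons.prems[of "Suc _"] in simp)
  ultimately have "leading (x * prod_list xs) (\<lambda>e. g 0 e + (\<Sum>r<length xs. g (Suc r) e))"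
    by (rule leading_mult)
  then show ?case by (simp only: sum.lessThan_Suc_shift prod_list.Cons length_Cons)
qed

lemma leading_bitableau:
  assumes "(T, T') \<in> antipreferred_bitableaux n"
  shows "leading (bitableau_op (T, T')) (bitableau_exp (T, T'))"
proof -
  note a = antipreferredD[OF assms]
  let ?xs = "map2 (\<lambda>r r'. qdet z (tail_mat (3 * n)) r (set r')) T T'"
  have "leading (prod_list ?xs) (\<lambda>e. \<Sum>r<length ?xs. pair_exp (T ! r) (rev (T' ! r)) e)"
  proof (rule leading_prod_list)
    fix r assume r: "r < length ?xs"
    then have r': "r < length T" "r < length T'" using a(5) by auto
    have "leading (qdet z (tail_mat (3 * n)) (T ! r) (set (rev (T' ! r)))) (pair_exp (T ! r) (rev (T' ! r)))"
      by (rule leading_minor) (use a(6-8)[OF r'(1)] in auto)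
    then show "leading (?xs ! r) (pair_exp (T ! r) (rev (T' ! r)))" using r' by simp
  qed
  then show ?thesis using a(5) by (simp add: bitableau_op_def bitableau_exp_def)
qed

text \<open>Three groups of edges are read: those of layer \<open>n\<close> give the shape, the
  falling edges of the first third give \<open>T\<close>, and those of the last third give
  \<open>T'\<close> after flipping.\<close>

lemma bitableau_exp_inj:
  assumes n: "0 < n" and A: "(T, T') \<in> antipreferred_bitableaux n" and B: "(U, U') \<in> antipreferred_bitableaux n"
    and eq: "bitableau_exp (T, T') = bitableau_exp (U, U')"
  shows "(T, T') = (U, U')"
proof -
  have shape: "bitableau_exp (V, V') (n, Suc c, Suc c) + bitableau_exp (V, V') (n, Suc c, Suc (Suc c)) =
      int (\<Sum>r<length V. if c < length (V ! r) then 1 else 0)"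
    if V: "(V, V') \<in> antipreferred_bitableaux n" for V V' c
  proof -
    note a = antipreferredD[OF V]
    have "pair_exp (V ! r) (rev (V' ! r)) (n, Suc c, Suc c) + pair_exp (V ! r) (rev (V' ! r)) (n, Suc c, Suc (Suc c)) =
      (if c < length (V ! r) then 1 else 0)" if "r < length V" for r
      by (rule pair_exp_middle) (use a(6-8)[OF that] n in auto)
    then show ?thesis unfolding bitableau_exp_def prod.case sum.distrib[symmetric] of_nat_sum
      by (intro sum.cong refl) auto
  qed
  have count: "bitableau_exp (V, V') (i - Suc k, Suc k, k) =
      int (\<Sum>r<length V. card {c. c < length (V ! r) \<and> c < k \<and> V ! r ! c = i})"
    if V: "(V, V') \<in> antipreferred_bitableaux n" and ki: "k < i" "i \<le> n" for V V' k i
  proof -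
    note a = antipreferredD[OF V]
    have i: "Suc (k + (i - Suc k)) = i" using ki by simp
    have "pair_exp (V ! r) (rev (V' ! r)) (i - Suc k, Suc k, k) =
      int (card {c. c < length (V ! r) \<and> c < k \<and> V ! r ! c = Suc (k + (i - Suc k))})" if "r < length V" for r
      by (rule pair_exp_first) (use a(6-8)[OF that] ki in auto)
    then show ?thesis unfolding bitableau_exp_def prod.case of_nat_sum i
      by (intro sum.cong refl) auto
  qed
  have count': "bitableau_exp (V, V') (3 * n - Suc (i - Suc k), Suc (n - k), n - k) =
      int (\<Sum>r<length (flip_tableau n V'). card {c. c < length (flip_tableau n V' ! r) \<and> c < k \<and> flip_tableau n V' ! r ! c = i})"
    if V: "(V, V') \<in> antipreferred_bitableaux n" and ki: "0 < k" "k < i" "i \<le> n" for V V' k i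
  proof -
    note a = antipreferredD[OF V]
    have i: "n - (n - k) = k" "Suc (k + (i - Suc k)) = i" using ki by auto
    have "pair_exp (V ! r) (rev (V' ! r)) (3 * n - Suc (i - Suc k), Suc (n - k), n - k) =
      int (card {c. c < length (V ! r) \<and> c < n - (n - k) \<and> Suc n - V' ! r ! c = Suc (n - (n - k) + (i - Suc k))})"
      if "r < length V" for r
    proof -
      have p: "sorted_wrt (<) (V ! r)" "set (V ! r) \<subseteq> {1..n}" "sorted_wrt (<) (rev (V' ! r))"
        "set (rev (V' ! r)) \<subseteq> {1..n}" "length (V ! r) = length (rev (V' ! r))"
        using a(6-8)[OF that] by auto
      have "i - Suc k < n" "0 < n - k" "n - k < n" using ki by auto
      from pair_exp_last[OF p this] show ?thesis by (simp only: rev_rev_ident)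
    qed
    moreover have "{c. c < length (V ! r) \<and> c < k \<and> Suc n - V' ! r ! c = i} =
      {c. c < length (flip_tableau n V' ! r) \<and> c < k \<and> flip_tableau n V' ! r ! c = i}" if "r < length V" for r
      using that a(5) a(6)[OF that] by auto
    ultimately show ?thesis unfolding bitableau_exp_def prod.case of_nat_sum i length_flip a(5)[symmetric]
      by (intro sum.cong refl) simp
  qed
  note a = antipreferredD[OF A] and b = antipreferredD[OF B]
  have sh: "(\<Sum>r<length T. if c < length (T ! r) then 1 else 0 :: nat) = (\<Sum>r<length U. if c < length (U ! r) then 1 else 0)" for c
    using shape[OF A, of c] shape[OF B, of c] unfolding eq by linarith
  have TU: "T = U"
  proof (rule increasing_tableau_eqI[OF a(1,3) b(1,3) sh])
    fix k i assume ki: "k < i" "i \<le> n"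
    show "(\<Sum>r<length T. card {c. c < length (T ! r) \<and> c < k \<and> T ! r ! c = i}) =
      (\<Sum>r<length U. card {c. c < length (U ! r) \<and> c < k \<and> U ! r ! c = i})"
      using count[OF A ki] count[OF B ki] unfolding eq by linarith
  qed
  have "flip_tableau n T' = flip_tableau n U'"
  proof (rule increasing_tableau_eqI[OF is_tableau_flip[OF a(2)] increasing_flip[OF a(2,4)]
      is_tableau_flip[OF b(2)] increasing_flip[OF b(2,4)]])
    fix c
    have "(\<Sum>r<length (flip_tableau n V'). if c < length (flip_tableau n V' ! r) then 1 else 0 :: nat) =
      (\<Sum>r<length V. if c < length (V ! r) then 1 else 0)"
      if "(V, V') \<in> antipreferred_bitableaux n" for V V'
      using antipreferredD(5,6)[OF that] by (auto intro!: sum.cong)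
    then show "(\<Sum>r<length (flip_tableau n T'). if c < length (flip_tableau n T' ! r) then 1 else 0 :: nat) =
      (\<Sum>r<length (flip_tableau n U'). if c < length (flip_tableau n U' ! r) then 1 else 0)"
      using A B TU by metis
  next
    fix k i assume ki: "k < i" "i \<le> n"
    show "(\<Sum>r<length (flip_tableau n T'). card {c. c < length (flip_tableau n T' ! r) \<and> c < k \<and> flip_tableau n T' ! r ! c = i}) =
      (\<Sum>r<length (flip_tableau n U'). card {c. c < length (flip_tableau n U' ! r) \<and> c < k \<and> flip_tableau n U' ! r ! c = i})"
    \<comment> \<open>\<open>k = 0\<close> would correspond to an edge leaving position
      \<open>Suc n\<close>; both counts are then empty.\<close>
    proof (cases "k = 0")
      case False
      then have k: "0 < k" by simp
      show ?thesis using count'[OF A k ki] count'[OF B k ki] unfolding eq by linarith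
    qed simp
  qed
  then have "T' = U'" using flip_flip a(2) b(2) by metis
  then show ?thesis using TU by simp
qed

text \<open>A vanishing combination is applied to the unit vector at exponent 0 and evaluated at a
  maximal one among the leading exponents of its nonzero terms. Only the corresponding term
  contributes there.\<close>

theorem bitableau_op_independent:
  assumes n: "0 < n" and F: "finite F" "F \<subseteq> antipreferred_bitableaux n"
    and zero: "(\<Sum>b\<in>F. scalar_op (c b) * bitableau_op b) = 0" and b: "b \<in> F"
  shows "c b = 0"
proof (rule ccontr)
  assume "c b \<noteq> 0"
  define v where "v = (\<lambda>\<alpha>::edge \<Rightarrow> int. if \<alpha> = (\<lambda>e. 0) then 1 else (0::'k))"
  have v: "leads v (\<lambda>e. 0)" by (simp add: v_def leads_def)
  have L: "leads (app (bitableau_op x) v) (bitableau_exp x)" if "x \<in> F" for x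
  proof -
    have "leading (bitableau_op x) (bitableau_exp x)"
      using leading_bitableau F(2) that by (cases x) blast
    then have "leads (app (bitableau_op x) v) (\<lambda>e. 0 + bitableau_exp x e)"
      using v unfolding leading_def by blast
    then show ?thesis by simp
  qed
  define G where "G = {x \<in> F. c x \<noteq> 0}"
  have G: "finite G" "G \<noteq> {}" using F(1) b \<open>c b \<noteq> 0\<close> unfolding G_def by (simp, blast)
  obtain m where m: "m \<in> G" "\<And>x. x \<in> G \<Longrightarrow> \<not> less_fun (deg (bitableau_exp m)) (deg (bitableau_exp x))"
  proof -
    have "\<exists>m\<in>G. \<forall>x\<in>G. \<not> less_fun (deg (bitableau_exp m)) (deg (bitableau_exp x))"
      using G
    proof (induction G rule: finite_ne_induct)
      case (singleton x)
      then show ?case using less_fun_irrefl by blast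
    next
      case (insert x G)
      then obtain m where m: "m \<in> G" "\<forall>x\<in>G. \<not> less_fun (deg (bitableau_exp m)) (deg (bitableau_exp x))" by blast
      show ?case
      proof (cases "less_fun (deg (bitableau_exp m)) (deg (bitableau_exp x))")
        case True
        then have "\<forall>y\<in>insert x G. \<not> less_fun (deg (bitableau_exp x)) (deg (bitableau_exp y))"
          using m(2) less_fun_trans less_fun_irrefl by blast
        then show ?thesis by blast
      qed (use m in blast)
    qed
    then show thesis using that by blast
  qed
  have "app (bitableau_op x) v (bitableau_exp m) = 0" if x: "x \<in> G" "x \<noteq> m" for x
  proof (rule ccontr)
    assume nz: "app (bitableau_op x) v (bitableau_exp m) \<noteq> 0"
    \<comment> \<open>Degrees of different terms may agree; it is the distinctness of the exponents
      themselves that excludes a second contribution.\<close>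
    have "bitableau_exp m \<noteq> bitableau_exp x"
      using bitableau_exp_inj[OF n, of "fst m" "snd m" "fst x" "snd x"] x m(1) F(2) by (auto simp: G_def)
    then have "less_fun (deg (bitableau_exp m)) (deg (bitableau_exp x))"
      using L[of x] nz x by (auto simp: leads_def G_def)
    then show False using m(2) x by blast
  qed
  note low = this
  have "(\<Sum>x\<in>F. c x * app (bitableau_op x) v (bitableau_exp m)) = c m * app (bitableau_op m) v (bitableau_exp m)"
  proof -
    have "c x * app (bitableau_op x) v (bitableau_exp m) = 0" if "x \<in> F - {m}" for x
      using that low[of x] unfolding G_def by (cases "c x = 0") auto
    then have "(\<Sum>x\<in>F - {m}. c x * app (bitableau_op x) v (bitableau_exp m)) = 0"
      by (intro sum.neutral ballI)
    moreover have "m \<in> F" using m(1) by (simp add: G_def)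
    ultimately show ?thesis using F(1) by (simp add: sum.remove[of F m])
  qed
  moreover have "app (\<Sum>x\<in>F. scalar_op (c x) * bitableau_op x) v (bitableau_exp m) =
      (\<Sum>x\<in>F. c x * app (bitableau_op x) v (bitableau_exp m))"
    by (simp add: app_sum)
  moreover have "c m \<noteq> 0" "app (bitableau_op m) v (bitableau_exp m) \<noteq> 0"
    using m(1) L[of m] by (auto simp: G_def leads_def)
  ultimately show False using zero by simp
qed

end

section \<open>Linear equations and the permutation expansion of minors\<close>

text \<open>Gaussian elimination: a pivot \<open>b\<^sub>0\<close> with nonzero entry in equation
  \<open>j\<close> removes one equation and one unknown, and its own coefficient is afterwards
  chosen to satisfy equation \<open>j\<close>.\<close>

lemma nontrivial_relation:
  fixes M :: "'b \<Rightarrow> 'j \<Rightarrow> 'k::field"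
  assumes "finite J" "finite B" "card J < card B"
  shows "\<exists>c. (\<exists>b\<in>B. c b \<noteq> 0) \<and> (\<forall>j\<in>J. (\<Sum>b\<in>B. c b * M b j) = 0)"
  using assms
proof (induction J arbitrary: B M rule: finite_induct)
  case empty
  then have "B \<noteq> {}" by auto
  then show ?case by (intro exI[of _ "\<lambda>_. 1"]) auto
next
  case (insert j J)
  show ?case
  proof (cases "\<forall>b\<in>B. M b j = 0")
    case True
    have "card J < card B" using insert by simp
    then obtain c where "\<exists>b\<in>B. c b \<noteq> 0" "\<forall>j\<in>J. (\<Sum>b\<in>B. c b * M b j) = 0"
      using insert.IH[OF insert.prems(1)] by blast
    then show ?thesis using True by (intro exI[of _ c]) auto
  next
    case False
    then obtain b\<^sub>0 where b0: "b\<^sub>0 \<in> B" "M b\<^sub>0 j \<noteq> 0" by blast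
    let ?B = "B - {b\<^sub>0}"
    have "card J < card ?B" using insert b0 by simp
    then obtain c where c: "\<exists>b\<in>?B. c b \<noteq> 0"
      "\<forall>j'\<in>J. (\<Sum>b\<in>?B. c b * (M b j' - M b j / M b\<^sub>0 j * M b\<^sub>0 j')) = 0"
      using insert.IH[of ?B "\<lambda>b j'. M b j' - M b j / M b\<^sub>0 j * M b\<^sub>0 j'"] insert.prems(1) by auto
    define s where "s = (\<Sum>b\<in>?B. c b * M b j) / M b\<^sub>0 j"
    define c' where "c' = c(b\<^sub>0 := - s)"
    have split: "(\<Sum>b\<in>B. c' b * M b j') = (\<Sum>b\<in>?B. c b * M b j') - s * M b\<^sub>0 j'" for j'
      using b0 insert.prems(1) by (subst sum.remove[of _ b\<^sub>0]) (auto simp: c'_def intro!: sum.cong)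
    have "(\<Sum>b\<in>B. c' b * M b j') = 0" if "j' \<in> insert j J" for j'
    proof (cases "j' = j")
      case True
      then show ?thesis using b0 split[of j] by (simp add: s_def)
    next
      case False
      have "(\<Sum>b\<in>?B. c b * (M b j' - M b j / M b\<^sub>0 j * M b\<^sub>0 j')) =
        (\<Sum>b\<in>?B. c b * M b j') - s * M b\<^sub>0 j'"
        by (simp add: s_def right_diff_distrib sum_subtractf sum_distrib_right sum_divide_distrib mult.assoc[symmetric])
      then show ?thesis using split[of j'] c(2) that False by simp
    qed
    then show ?thesis using c(1) by (intro exI[of _ c']) (auto simp: c'_def)
  qed
qed

text \<open>The target is adjoined as one more row, indexed by \<open>None\<close>. Now there are
  more rows than columns, so some relation is nontrivial; independence forces the coefficient of the
  target to be nonzero, and dividing by it solves the system.\<close>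

lemma solvable_if_independent:
  fixes M :: "'b \<Rightarrow> 'j \<Rightarrow> 'k::field"
  assumes fin: "finite J" "finite B" and card: "card J = card B" and j0: "j\<^sub>0 \<in> J"
    and indep: "\<And>c b. (\<forall>j\<in>J. (\<Sum>b\<in>B. c b * M b j) = 0) \<Longrightarrow> b \<in> B \<Longrightarrow> c b = 0"
  shows "\<exists>c. \<forall>j\<in>J. (\<Sum>b\<in>B. c b * M b j) = (if j = j\<^sub>0 then 1 else 0)"
proof -
  define N where "N = (\<lambda>b j. case b of None \<Rightarrow> if j = j\<^sub>0 then 1 else 0 | Some b \<Rightarrow> M b j)"
  let ?B = "insert None (Some ` B)"
  have "finite ?B" "card J < card ?B" using fin card by (simp_all add: card_image)
  then obtain c where c: "\<exists>b\<in>?B. c b \<noteq> 0" "\<forall>j\<in>J. (\<Sum>b\<in>?B. c b * N b j) = 0"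
    using nontrivial_relation[OF fin(1), of ?B N] by blast
  have e: "(\<Sum>b\<in>?B. c b * N b j) = c None * (if j = j\<^sub>0 then 1 else 0) + (\<Sum>b\<in>B. c (Some b) * M b j)" for j
    using fin(2) by (simp add: N_def sum.reindex)
  have "c None \<noteq> 0"
  proof
    assume n: "c None = 0"
    then have "\<forall>j\<in>J. (\<Sum>b\<in>B. c (Some b) * M b j) = 0" using c(2) e by simp
    then have "c (Some b) = 0" if "b \<in> B" for b using indep[of "\<lambda>b. c (Some b)"] that by blast
    then show False using c(1) n by auto
  qed
  then have "(\<Sum>b\<in>B. - c (Some b) / c None * M b j) = (if j = j\<^sub>0 then 1 else 0)" if "j \<in> J" for j
  proof -
    have "(\<Sum>b\<in>B. - c (Some b) / c None * M b j) = - (\<Sum>b\<in>B. c (Some b) * M b j) / c None"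
      by (simp add: sum_negf sum_divide_distrib)
    also have "\<dots> = (if j = j\<^sub>0 then 1 else 0)"
      using c(2) e[of j] that \<open>c None \<noteq> 0\<close> by (auto simp: add_eq_0_iff)
    finally show ?thesis .
  qed
  then show ?thesis by (intro exI[of _ "\<lambda>b. - c (Some b) / c None"]) blast
qed

section \<open>Inversions and sums over permutations\<close>

fun inversions :: "nat list \<Rightarrow> nat" where
  "inversions [] = 0"
| "inversions (x # xs) = card {y \<in> set xs. y < x} + inversions xs"

lemma inversions_eq_card:
  "distinct xs \<Longrightarrow> inversions xs = card {(a, b). a < b \<and> b < length xs \<and> xs ! b < xs ! a}"
proof (induction xs)
  case (Cons x xs)
  let ?P = "{(a, b). a < b \<and> b < length xs \<and> xs ! b < xs ! a}"
  have fin: "finite ?P" by (rule finite_subset[of _ "{..<length xs} \<times> {..<length xs}"]) auto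
  have "{(a, b). a < b \<and> b < length (x # xs) \<and> (x # xs) ! b < (x # xs) ! a} =
    (\<lambda>b. (0, Suc b)) ` {b. b < length xs \<and> xs ! b < x} \<union> map_prod Suc Suc ` ?P"
  proof (intro equalityI subsetI)
    fix p assume "p \<in> {(a, b). a < b \<and> b < length (x # xs) \<and> (x # xs) ! b < (x # xs) ! a}"
    then obtain a b where p: "p = (a, Suc b)" "a < Suc b" "b < length xs" "xs ! b < (x # xs) ! a"
      by (auto simp: less_Suc_eq_0_disj)
    show "p \<in> (\<lambda>b. (0, Suc b)) ` {b. b < length xs \<and> xs ! b < x} \<union> map_prod Suc Suc ` ?P"
    proof (cases a)
      case (Suc a')
      then have "(a', b) \<in> ?P" using p by auto
      then show ?thesis using p Suc by (auto intro!: image_eqI[of _ "map_prod Suc Suc" "(a', b)"])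
    qed (use p in auto)
  qed auto
  moreover have "card ((\<lambda>b. (0::nat, Suc b)) ` {b. b < length xs \<and> xs ! b < x} \<union> map_prod Suc Suc ` ?P) =
    card {b. b < length xs \<and> xs ! b < x} + card ?P"
    using fin by (subst card_Un_disjoint) (auto simp: card_image inj_on_def)
  moreover have "bij_betw ((!) xs) {b. b < length xs \<and> xs ! b < x} {y \<in> set xs. y < x}"
    using Cons.prems by (auto simp: bij_betw_def inj_on_def nth_eq_iff_index_eq in_set_conv_nth)
  ultimately show ?case using Cons by (simp add: bij_betw_same_card)
qed simp

context quantum_parameter begin

text \<open>The Laplace sign of a chosen column counts the smaller columns still available, that is,
  the inversions starting at that column.\<close>

lemma qdet_permutations:
  assumes "finite J" "length is = card J"
  shows "qdet z Y is J = (\<Sum>ys\<in>permutations_of_set J. (- z) ^ inversions ys * prod_list (map2 Y is ys))"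
  using assms
proof (induction "is" arbitrary: J)
  case Nil
  then show ?case by simp
next
  case (Cons i "is")
  have ne: "J \<noteq> {}" and fin: "finite J" using Cons.prems by auto
  have perm: "set ys = J - {j} \<and> distinct ys" if "ys \<in> permutations_of_set (J - {j})" for ys j
    using permutations_of_setD[OF that] by simp
  have "(\<Sum>ys\<in>permutations_of_set J. (- z) ^ inversions ys * prod_list (map2 Y (i # is) ys)) =
    (\<Sum>j\<in>J. \<Sum>ys\<in>(#) j ` permutations_of_set (J - {j}). (- z) ^ inversions ys * prod_list (map2 Y (i # is) ys))"
    unfolding permutations_of_set_nonempty[OF ne] using fin
    by (intro sum.UNION_disjoint) auto
  also have "\<dots> = (\<Sum>j\<in>J. (- z) ^ card {j' \<in> J. j' < j} * Y i j * qdet z Y is (J - {j}))"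
  proof (rule sum.cong[OF refl])
    fix j assume j: "j \<in> J"
    have "{y \<in> J - {j}. y < j} = {j' \<in> J. j' < j}" by auto
    then have inv: "inversions (j # ys) = card {j' \<in> J. j' < j} + inversions ys"
      if "ys \<in> permutations_of_set (J - {j})" for ys
      using perm[OF that] by simp
    have "(\<Sum>ys\<in>(#) j ` permutations_of_set (J - {j}). (- z) ^ inversions ys * prod_list (map2 Y (i # is) ys)) =
      (\<Sum>ys\<in>permutations_of_set (J - {j}). (- z) ^ inversions (j # ys) * (Y i j * prod_list (map2 Y is ys)))"
      by (subst sum.reindex) auto
    also have "\<dots> = (\<Sum>ys\<in>permutations_of_set (J - {j}).
        (- z) ^ card {j' \<in> J. j' < j} * Y i j * ((- z) ^ inversions ys * prod_list (map2 Y is ys)))"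
    proof (rule sum.cong[OF refl])
      fix ys assume ys: "ys \<in> permutations_of_set (J - {j})"
      define r where "r = inversions ys"
      show "(- z) ^ inversions (j # ys) * (Y i j * prod_list (map2 Y is ys)) =
        (- z) ^ card {j' \<in> J. j' < j} * Y i j * ((- z) ^ inversions ys * prod_list (map2 Y is ys))"
        unfolding inv[OF ys] r_def[symmetric] power_add
        by (simp only: mult.assoc central_pow_left[where k = r and x = "Y i j"])
    qed
    also have "\<dots> = (- z) ^ card {j' \<in> J. j' < j} * Y i j * qdet z Y is (J - {j})"
      using Cons.IH[of "J - {j}"] Cons.prems j by (simp add: sum_distrib_left)
    finally show "(\<Sum>ys\<in>(#) j ` permutations_of_set (J - {j}). (- z) ^ inversions ys * prod_list (map2 Y (i # is) ys)) =
       (- z) ^ card {j' \<in> J. j' < j} * Y i j * qdet z Y is (J - {j})" .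
  qed
  finally show ?case by simp
qed

text \<open>Composing a permutation with the increasing enumeration of \<open>J\<close> gives each
  ordering of \<open>J\<close> once and preserves inversions. This connects the Laplace form with
  the definition of quantum minors.\<close>

lemma qdet_permutes:
  assumes "finite J" "length is = card J"
  shows "(\<Sum>\<sigma> | \<sigma> permutes {..<card J}. (- z) ^ perm_length (card J) \<sigma> *
     prod_list (map (\<lambda>a. Y (is ! a) (sorted_list_of_set J ! \<sigma> a)) [0..<card J])) = qdet z Y is J"
proof -
  let ?js = "sorted_list_of_set J" and ?s = "card J"
  let ?f = "\<lambda>\<sigma>. map (\<lambda>a. ?js ! \<sigma> a) [0..<?s]"
  have js: "distinct ?js" "set ?js = J" "length ?js = ?s" "sorted_wrt (<) ?js"
    using assms by (auto simp: strict_sorted_iff)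
  have lt: "\<sigma> a < ?s" if "\<sigma> permutes {..<?s}" "a < ?s" for \<sigma> a
    using permutes_in_image[OF that(1), of a] that(2) by simp
  have inj: "inj_on ?f {\<sigma>. \<sigma> permutes {..<?s}}"
  proof (rule inj_onI, clarify)
    fix \<sigma> \<tau> assume st: "\<sigma> permutes {..<?s}" "\<tau> permutes {..<?s}" "?f \<sigma> = ?f \<tau>"
    show "\<sigma> = \<tau>"
    proof
      fix a
      show "\<sigma> a = \<tau> a"
      proof (cases "a < ?s")
        case True
        then have "?js ! \<sigma> a = ?js ! \<tau> a" using st(3) by simp
        then show ?thesis using js lt[OF st(1) True] lt[OF st(2) True] by (simp add: nth_eq_iff_index_eq)
      next
        case False
        then show ?thesis using st(1,2) by (simp add: permutes_def)
      qed
    qed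
  qed
  have sub: "?f ` {\<sigma>. \<sigma> permutes {..<?s}} \<subseteq> permutations_of_set J"
  proof (rule image_subsetI, clarify)
    fix \<sigma> assume s: "\<sigma> permutes {..<?s}"
    have d: "distinct (?f \<sigma>)"
      using lt[OF s] js permutes_inj[OF s] by (auto simp: distinct_map inj_on_def nth_eq_iff_index_eq dest: injD)
    have "set (?f \<sigma>) \<subseteq> J" using lt[OF s] js by (auto simp: nth_mem)
    moreover have "card (set (?f \<sigma>)) = card J" using distinct_card[OF d] by simp
    ultimately have "set (?f \<sigma>) = J" using assms(1) card_subset_eq by blast
    then show "?f \<sigma> \<in> permutations_of_set J" using d by (rule permutations_of_setI)
  qed
  have "card (?f ` {\<sigma>. \<sigma> permutes {..<?s}}) = card (permutations_of_set J)"
    using card_image[OF inj] assms(1) by (simp add: card_permutations)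
  then have img: "?f ` {\<sigma>. \<sigma> permutes {..<?s}} = permutations_of_set J"
    using sub assms(1) by (intro card_subset_eq) auto
  have "qdet z Y is J = (\<Sum>\<sigma> | \<sigma> permutes {..<?s}. (- z) ^ inversions (?f \<sigma>) * prod_list (map2 Y is (?f \<sigma>)))"
    unfolding qdet_permutations[OF assms] img[symmetric] by (subst sum.reindex[OF inj]) simp
  also have "\<dots> = (\<Sum>\<sigma> | \<sigma> permutes {..<?s}. (- z) ^ perm_length ?s \<sigma> *
     prod_list (map (\<lambda>a. Y (is ! a) (?js ! \<sigma> a)) [0..<?s]))"
  proof (rule sum.cong[OF refl], clarify)
    fix \<sigma> assume s: "\<sigma> permutes {..<?s}"
    have "?f \<sigma> \<in> permutations_of_set J" using sub s by blast
    then have "inversions (?f \<sigma>) = card {(a, b). a < b \<and> b < ?s \<and> ?f \<sigma> ! b < ?f \<sigma> ! a}"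
      using inversions_eq_card[OF permutations_of_setD(2)] by simp
    also have "{(a, b). a < b \<and> b < ?s \<and> ?f \<sigma> ! b < ?f \<sigma> ! a} = {(a, b). a < b \<and> b < ?s \<and> \<sigma> b < \<sigma> a}"
    proof -
      have "?js ! \<sigma> b < ?js ! \<sigma> a \<longleftrightarrow> \<sigma> b < \<sigma> a" if "a < ?s" "b < ?s" for a b
        using sorted_wrt_nth_less[OF js(4)] lt[OF s] that js(3) by (metis linorder_neqE_nat order_less_asym less_irrefl)
      then show ?thesis by auto
    qed
    finally have 1: "inversions (?f \<sigma>) = perm_length ?s \<sigma>" by (simp add: perm_length_def)
    have "map2 Y is (?f \<sigma>) = map (\<lambda>a. Y (is ! a) (?js ! \<sigma> a)) [0..<?s]"
      using assms(2) by (intro nth_equalityI) auto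
    then show "(- z) ^ inversions (?f \<sigma>) * prod_list (map2 Y is (?f \<sigma>)) = (- z) ^ perm_length ?s \<sigma> *
     prod_list (map (\<lambda>a. Y (is ! a) (?js ! \<sigma> a)) [0..<?s])" unfolding 1 by simp
  qed
  finally show ?thesis by simp
qed

end

section \<open>The free algebra and its quotient\<close>

abbreviation free_carrier :: "nat \<Rightarrow> 'k::field free_alg set" where
  "free_carrier n \<equiv> carrier (free_algebra n)"

definition word_monom :: "(nat \<times> nat) list \<Rightarrow> 'k::field free_alg" where
  "word_monom w = Poly_Mapping.single (Word w) 1"

lemma word_monom_append: "word_monom (u @ v) = word_monom u * word_monom v"
  by (simp add: word_monom_def mult_single plus_word_def)

lemma Xgen_eq: "Xgen i j = word_monom [(i, j)]"
  by (simp add: Xgen_def word_monom_def)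

lemma scalar_word_monom: "scalar c * word_monom w = Poly_Mapping.single (Word w) c"
  by (simp add: scalar_def word_monom_def mult_single)

lemma poly_mapping_sum_single: "(\<Sum>w\<in>Poly_Mapping.keys f. Poly_Mapping.single w (Poly_Mapping.lookup f w)) = f"
  by (rule poly_mapping_eqI) (auto simp: lookup_sum lookup_single when_def in_keys_iff)

lemma free_alg_expand: "f = (\<Sum>w\<in>Poly_Mapping.keys f. scalar (Poly_Mapping.lookup f w) * word_monom (letters w))"
  by (simp add: scalar_word_monom poly_mapping_sum_single)

lemma scalar_commute: "scalar c * f = f * scalar c"
proof -
  have "scalar c * f = (\<Sum>w\<in>Poly_Mapping.keys f. scalar c * Poly_Mapping.single w (Poly_Mapping.lookup f w))"
    by (subst poly_mapping_sum_single[of f, symmetric]) (simp add: sum_distrib_left)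
  also have "\<dots> = (\<Sum>w\<in>Poly_Mapping.keys f. Poly_Mapping.single w (Poly_Mapping.lookup f w) * scalar c)"
    by (simp add: scalar_def mult_single mult.commute)
  also have "\<dots> = f * scalar c"
    by (subst (3) poly_mapping_sum_single[of f, symmetric]) (simp add: sum_distrib_right)
  finally show ?thesis .
qed

lemma scalar_1 [simp]: "scalar 1 = 1"
  by (simp add: scalar_def)

lemma scalar_0 [simp]: "scalar 0 = 0"
  by (simp add: scalar_def)

lemma scalar_add: "scalar (c + d) = scalar c + scalar d"
  by (simp add: scalar_def single_add)

lemma scalar_uminus: "scalar (- c) = - scalar c"
  by (simp add: scalar_def single_uminus)

lemma scalar_sum: "scalar (sum f A) = (\<Sum>a\<in>A. scalar (f a))"
  by (induction A rule: infinite_finite_induct) (auto simp: scalar_add)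

lemma free_carrier_iff: "f \<in> free_carrier n \<longleftrightarrow> (\<forall>w\<in>Poly_Mapping.keys f. set (letters w) \<subseteq> {1..n} \<times> {1..n})"
  by (simp add: free_algebra_def)

lemma free_algebra_ops [simp]: "x \<oplus>\<^bsub>free_algebra n\<^esub> y = x + y" "x \<otimes>\<^bsub>free_algebra n\<^esub> y = x * y"
  "\<zero>\<^bsub>free_algebra n\<^esub> = 0" "\<one>\<^bsub>free_algebra n\<^esub> = 1"
  by (simp_all add: free_algebra_def)

lemma free_carrier_closed [simp, intro]:
  fixes f g :: "'k::field free_alg"
  shows "(0 :: 'k free_alg) \<in> free_carrier n" "(1 :: 'k free_alg) \<in> free_carrier n"
  "f \<in> free_carrier n \<Longrightarrow> g \<in> free_carrier n \<Longrightarrow> f + g \<in> free_carrier n"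
  "f \<in> free_carrier n \<Longrightarrow> g \<in> free_carrier n \<Longrightarrow> f * g \<in> free_carrier n"
  "f \<in> free_carrier n \<Longrightarrow> - f \<in> free_carrier n"
proof -
  interpret ring "free_algebra n :: 'k free_alg ring" by (rule free_algebra_ring)
  show "(0 :: 'k free_alg) \<in> free_carrier n" "(1 :: 'k free_alg) \<in> free_carrier n" using zero_closed one_closed by simp_all
  show "f \<in> free_carrier n \<Longrightarrow> g \<in> free_carrier n \<Longrightarrow> f + g \<in> free_carrier n" using a_closed by simp
  show "f \<in> free_carrier n \<Longrightarrow> g \<in> free_carrier n \<Longrightarrow> f * g \<in> free_carrier n" using m_closed by simp
  show "f \<in> free_carrier n \<Longrightarrow> - f \<in> free_carrier n" by (simp add: free_carrier_iff)
qed

lemma free_carrier_sum: "(\<And>a. a \<in> A \<Longrightarrow> f a \<in> free_carrier n) \<Longrightarrow> sum f A \<in> free_carrier n"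
  by (induction A rule: infinite_finite_induct) auto

lemma free_carrier_prod_list: "set xs \<subseteq> free_carrier n \<Longrightarrow> prod_list xs \<in> free_carrier n"
  by (induction xs) auto

lemma word_monom_carrier [intro]: "set w \<subseteq> {1..n} \<times> {1..n} \<Longrightarrow> word_monom w \<in> free_carrier n"
  by (simp add: free_carrier_iff word_monom_def)

section \<open>Evaluation of noncommutative polynomials at operators\<close>

definition eval_word :: "(nat \<Rightarrow> nat \<Rightarrow> ('a, 'k::field) lin_op) \<Rightarrow> 'k free_alg \<Rightarrow> ('a, 'k) lin_op" where
  "eval_word M f = (\<Sum>w\<in>Poly_Mapping.keys f. scalar_op (Poly_Mapping.lookup f w) * prod_list (map (\<lambda>(i, j). M i j) (letters w)))"

lemma eval_word_superset:
  assumes "finite A" "Poly_Mapping.keys f \<subseteq> A"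
  shows "eval_word M f = (\<Sum>w\<in>A. scalar_op (Poly_Mapping.lookup f w) * prod_list (map (\<lambda>(i, j). M i j) (letters w)))"
  unfolding eval_word_def using assms by (intro sum.mono_neutral_left) (auto simp: in_keys_iff)

lemma eval_word_add: "eval_word M (f + g) = eval_word M f + eval_word M g"
proof -
  let ?A = "Poly_Mapping.keys f \<union> Poly_Mapping.keys g"
  have A: "finite ?A" by simp
  have "Poly_Mapping.keys (f + g) \<subseteq> ?A" by (rule keys_add)
  then show ?thesis
    unfolding eval_word_superset[OF A, of "f + g" M] eval_word_superset[OF A Un_upper1] eval_word_superset[OF A Un_upper2]
    by (simp add: eval_word_superset[OF A] lookup_add scalar_op_add distrib_right sum.distrib)
qed

lemma eval_word_0 [simp]: "eval_word M 0 = 0"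
  by (simp add: eval_word_def)

lemma eval_word_sum: "eval_word M (sum f A) = (\<Sum>a\<in>A. eval_word M (f a))"
  by (induction A rule: infinite_finite_induct) (auto simp: eval_word_add)

lemma eval_word_single: "eval_word M (Poly_Mapping.single w c) = scalar_op c * prod_list (map (\<lambda>(i, j). M i j) (letters w))"
  by (cases "c = 0") (simp_all add: eval_word_def)

lemma eval_word_mult: "eval_word M (f * g) = eval_word M f * eval_word M g"
proof -
  let ?p = "\<lambda>w. prod_list (map (\<lambda>(i, j). M i j) (letters w))"
  let ?s = "\<lambda>f w. Poly_Mapping.single w (Poly_Mapping.lookup f w)"
  have s: "eval_word M (?s f u * ?s g v) = eval_word M (?s f u) * eval_word M (?s g v)" for u v
    by (simp add: mult_single eval_word_single plus_word_def scalar_op_mult mult.assoc)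
      (simp add: mult.assoc[symmetric] scalar_op_commute[of _ "?p u"])
  have "f * g = (\<Sum>u\<in>Poly_Mapping.keys f. \<Sum>v\<in>Poly_Mapping.keys g. ?s f u * ?s g v)"
    by (subst (1) poly_mapping_sum_single[of f, symmetric], subst (1) poly_mapping_sum_single[of g, symmetric])
      (simp add: sum_product)
  then have "eval_word M (f * g) = (\<Sum>u\<in>Poly_Mapping.keys f. \<Sum>v\<in>Poly_Mapping.keys g. eval_word M (?s f u) * eval_word M (?s g v))"
    by (simp add: eval_word_sum s)
  also have "\<dots> = eval_word M (\<Sum>u\<in>Poly_Mapping.keys f. ?s f u) * eval_word M (\<Sum>v\<in>Poly_Mapping.keys g. ?s g v)"
    by (simp add: eval_word_sum sum_product)
  finally show ?thesis by (simp add: poly_mapping_sum_single)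
qed

lemma eval_word_scalar [simp]: "eval_word M (scalar c) = scalar_op c"
  by (simp add: scalar_def eval_word_single zero_word_def)

lemma eval_word_1 [simp]: "eval_word M 1 = 1"
  using eval_word_scalar[of M 1] by simp

lemma eval_word_Xgen [simp]: "eval_word M (Xgen i j) = M i j"
  by (simp add: Xgen_def eval_word_single)

lemma eval_word_uminus: "eval_word M (- f) = - eval_word M f"
  using eval_word_add[of M f "- f"] by (simp add: eq_neg_iff_add_eq_0 add.commute)

lemma eval_word_diff: "eval_word M (f - g) = eval_word M f - eval_word M g"
  using eval_word_add[of M f "- g"] by (simp add: eval_word_uminus)

lemma eval_word_prod_list: "eval_word M (prod_list xs) = prod_list (map (eval_word M) xs)"
  by (induction xs) (auto simp: eval_word_mult)

section \<open>Computing in the quotient through representatives\<close>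

lemma a_inv_free: "f \<in> free_carrier n \<Longrightarrow> \<ominus>\<^bsub>free_algebra n\<^esub> f = - f"
proof -
  assume f: "f \<in> free_carrier n"
  interpret ring "free_algebra n :: 'a free_alg ring" by (rule free_algebra_ring)
  show ?thesis using f by (intro minus_equality) auto
qed

lemma a_minus_free: "f \<in> free_carrier n \<Longrightarrow> g \<in> free_carrier n \<Longrightarrow> f \<ominus>\<^bsub>free_algebra n\<^esub> g = f - g"
  by (simp add: a_minus_def a_inv_free)

lemma qmat_ideal_closed:
  assumes "f \<in> qmat_ideal n q"
  shows "g \<in> qmat_ideal n q \<Longrightarrow> f + g \<in> qmat_ideal n q" "- f \<in> qmat_ideal n q"
    "a \<in> free_carrier n \<Longrightarrow> a * f \<in> qmat_ideal n q" "a \<in> free_carrier n \<Longrightarrow> f * a \<in> qmat_ideal n q"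
proof -
  interpret ideal "qmat_ideal n q" "free_algebra n" by (rule qmat_ideal_ideal)
  show "g \<in> qmat_ideal n q \<Longrightarrow> f + g \<in> qmat_ideal n q" using additive_subgroup.a_closed[OF ideal.axioms(1)[OF qmat_ideal_ideal] assms] by simp
  show "- f \<in> qmat_ideal n q" using I_l_closed[OF assms, of "- 1"] by simp
  show "a \<in> free_carrier n \<Longrightarrow> a * f \<in> qmat_ideal n q" using I_l_closed assms by simp
  show "a \<in> free_carrier n \<Longrightarrow> f * a \<in> qmat_ideal n q" using I_r_closed assms by simp
qed

lemma zero_qmat_ideal [simp]: "0 \<in> qmat_ideal n q"
  using additive_subgroup.zero_closed[OF ideal.axioms(1)[OF qmat_ideal_ideal]] by simp

lemma qmat_ideal_sum: "(\<And>a. a \<in> A \<Longrightarrow> f a \<in> qmat_ideal n q) \<Longrightarrow> sum f A \<in> qmat_ideal n q"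
  by (induction A rule: infinite_finite_induct) (auto intro: qmat_ideal_closed)

lemma qmat_relations_ideal: "f \<in> qmat_relations n q \<Longrightarrow> f \<in> qmat_ideal n q"
  unfolding qmat_ideal_def
  using ring.genideal_self[OF free_algebra_ring qmat_relations_carrier] by blast

lemma qmat_class_hom:
  assumes "f \<in> free_carrier n" "g \<in> free_carrier n"
  shows "qmat_class n q f \<in> carrier (qmat n q)"
    "qmat_class n q (f + g) = qmat_class n q f \<oplus>\<^bsub>qmat n q\<^esub> qmat_class n q g"
    "qmat_class n q (f * g) = qmat_class n q f \<otimes>\<^bsub>qmat n q\<^esub> qmat_class n q g"
    "qmat_class n q (scalar c * f) = c \<odot>\<^bsub>qmat n q\<^esub> qmat_class n q f"
    "qmat_class n q 0 = \<zero>\<^bsub>qmat n q\<^esub>" "qmat_class n q 1 = \<one>\<^bsub>qmat n q\<^esub>"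
proof -
  note h = qmat_class_ring_hom[of n q]
  show "qmat_class n q f \<in> carrier (qmat n q)" using ring_hom_closed[OF h assms(1)] by (simp add: qmat_def Let_def)
  show "qmat_class n q (f + g) = qmat_class n q f \<oplus>\<^bsub>qmat n q\<^esub> qmat_class n q g"
    using ring_hom_add[OF h assms] by (simp add: qmat_def Let_def)
  show "qmat_class n q (f * g) = qmat_class n q f \<otimes>\<^bsub>qmat n q\<^esub> qmat_class n q g"
    using ring_hom_mult[OF h assms] by (simp add: qmat_def Let_def)
  show "qmat_class n q (scalar c * f) = c \<odot>\<^bsub>qmat n q\<^esub> qmat_class n q f"
    using ring_hom_mult[OF h _ assms(1), of "scalar c"] by (simp add: qmat_def Let_def)
  show "qmat_class n q 1 = \<one>\<^bsub>qmat n q\<^esub>"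
    using ring_hom_one[OF h] by (simp add: qmat_def Let_def)
  have "qmat_class n q \<zero>\<^bsub>free_algebra n\<^esub> = \<zero>\<^bsub>free_algebra n Quot qmat_ideal n q\<^esub>"
    by (rule ring_hom_zero[OF h free_algebra_ring ideal.quotient_is_ring[OF qmat_ideal_ideal]])
  then show "qmat_class n q 0 = \<zero>\<^bsub>qmat n q\<^esub>" by (simp add: qmat_def Let_def)
qed

lemma qmat_class_sum:
  assumes "finite A" "\<And>a. a \<in> A \<Longrightarrow> f a \<in> free_carrier n"
  shows "qmat_class n q (sum f A) = (\<Oplus>\<^bsub>qmat n q\<^esub> a\<in>A. qmat_class n q (f a))"
proof -
  interpret Q: ring "qmat n q" by (rule qmat_ring)
  show ?thesis using assms
  proof (induction A rule: finite_induct)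
    case empty
    then show ?case using qmat_class_hom(5)[of 0 n 0 q] by simp
  next
    case (insert a A)
    then show ?case using qmat_class_hom[of "f a" n "sum f A" q] qmat_class_hom(1)[of "f _" n 0 q]
      by (subst Q.finsum_insert) (auto simp: free_carrier_sum)
  qed
qed

lemma qmat_class_prod_list:
  "set xs \<subseteq> free_carrier n \<Longrightarrow> qmat_class n q (prod_list xs) = ordered_prod (qmat n q) (map (qmat_class n q) xs)"
proof (induction xs)
  case Nil
  show ?case using qmat_class_hom(6)[of 0 n 0 q] by (simp add: ordered_prod_def)
next
  case (Cons x xs)
  then show ?case using qmat_class_hom(3)[of x n "prod_list xs" q] free_carrier_prod_list[of xs n]
    by (simp add: ordered_prod_def)
qed

lemma qmat_class_eq_iff:
  assumes "f \<in> free_carrier n" "g \<in> free_carrier n"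
  shows "qmat_class n q f = qmat_class n q g \<longleftrightarrow> f - g \<in> qmat_ideal n q"
  using ring.quotient_eq_iff_same_a_r_cos[OF free_algebra_ring qmat_ideal_ideal assms, of q] a_minus_free[OF assms]
  by (auto simp: qmat_class_def)

lemma qmat_carrier: "carrier (qmat n q) = qmat_class n q ` free_carrier n"
  by (auto simp: qmat_def Let_def FactRing_def A_RCOSETS_def' qmat_class_def)

section \<open>Straightening and homogeneity\<close>

definition letter_less :: "((nat \<times> nat) \<times> (nat \<times> nat)) set" where
  "letter_less = less_than <*lex*> less_than"

definition letter_le :: "nat \<times> nat \<Rightarrow> nat \<times> nat \<Rightarrow> bool" where
  "letter_le x y \<longleftrightarrow> x = y \<or> (x, y) \<in> letter_less"

definition sorted_words :: "nat \<Rightarrow> nat \<Rightarrow> (nat \<times> nat) list set" where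
  "sorted_words n d = {w. set w \<subseteq> {1..n} \<times> {1..n} \<and> length w = d \<and> sorted_wrt letter_le w}"

lemma finite_sorted_words: "finite (sorted_words n d)"
  by (rule finite_subset[OF _ finite_lists_length_eq[of "{1..n} \<times> {1..n}" d]])
    (auto simp: sorted_words_def)

lemma letter_le_transp: "transp letter_le"
  by (rule transpI) (auto simp: letter_le_def letter_less_def)

lemma letter_le_antisym: "letter_le x y \<Longrightarrow> letter_le y x \<Longrightarrow> x = y"
  by (cases x; cases y) (auto simp: letter_le_def letter_less_def)

lemma not_letter_le: "\<not> letter_le x y \<Longrightarrow> (y, x) \<in> letter_less"
  by (cases x; cases y) (auto simp: letter_le_def letter_less_def)

lemma not_sorted_descent:
  assumes "\<not> sorted_wrt letter_le w"
  obtains u x y v where "w = u @ [x, y] @ v" "(y, x) \<in> letter_less"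
proof -
  obtain i where i: "Suc i < length w" "\<not> letter_le (w ! i) (w ! Suc i)"
    using assms sorted_wrt_iff_nth_Suc_transp[OF letter_le_transp, of w] by auto
  have "w = take i w @ [w ! i, w ! Suc i] @ drop (Suc (Suc i)) w"
    using i(1) by (simp add: Cons_nth_drop_Suc)
  then show thesis using that not_letter_le[OF i(2)] by blast
qed

definition spanned :: "nat \<Rightarrow> 'k::field \<Rightarrow> nat \<Rightarrow> 'k free_alg \<Rightarrow> bool" where
  "spanned n q d f \<longleftrightarrow> (\<exists>c. f - (\<Sum>w\<in>sorted_words n d. scalar (c w) * word_monom w) \<in> qmat_ideal n q)"

lemma spanned_0: "spanned n q d 0"
  unfolding spanned_def by (intro exI[of _ "\<lambda>_. 0"]) simp

lemma spanned_ideal_add: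
  assumes "f - g \<in> qmat_ideal n q" "spanned n q d g"
  shows "spanned n q d f"
proof -
  obtain c where "g - (\<Sum>w\<in>sorted_words n d. scalar (c w) * word_monom w) \<in> qmat_ideal n q"
    using assms(2) unfolding spanned_def by blast
  from qmat_ideal_closed(1)[OF assms(1) this] show ?thesis unfolding spanned_def by auto
qed

lemma spanned_add:
  assumes "spanned n q d f" "spanned n q d g"
  shows "spanned n q d (f + g)"
proof -
  obtain c c' where "f - (\<Sum>w\<in>sorted_words n d. scalar (c w) * word_monom w) \<in> qmat_ideal n q"
    "g - (\<Sum>w\<in>sorted_words n d. scalar (c' w) * word_monom w) \<in> qmat_ideal n q"
    using assms unfolding spanned_def by blast
  from qmat_ideal_closed(1)[OF this]
  have "f + g - (\<Sum>w\<in>sorted_words n d. scalar (c w + c' w) * word_monom w) \<in> qmat_ideal n q"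
    by (simp add: scalar_add distrib_right sum.distrib algebra_simps)
  then show ?thesis unfolding spanned_def by (intro exI[of _ "\<lambda>w. c w + c' w"])
qed

lemma spanned_scale:
  assumes "spanned n q d f"
  shows "spanned n q d (scalar a * f)"
proof -
  obtain c where "f - (\<Sum>w\<in>sorted_words n d. scalar (c w) * word_monom w) \<in> qmat_ideal n q"
    using assms unfolding spanned_def by blast
  from qmat_ideal_closed(3)[OF this scalar_in_carrier[of a]]
  have "scalar a * f - (\<Sum>w\<in>sorted_words n d. scalar (a * c w) * word_monom w) \<in> qmat_ideal n q"
    by (simp add: right_diff_distrib sum_distrib_left scalar_mult mult.assoc[symmetric])
  then show ?thesis unfolding spanned_def by (intro exI[of _ "\<lambda>w. a * c w"])
qed

lemma spanned_sum: "(\<And>a. a \<in> A \<Longrightarrow> spanned n q d (f a)) \<Longrightarrow> spanned n q d (sum f A)"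
  by (induction A rule: infinite_finite_induct) (auto intro: spanned_0 spanned_add)

lemma spanned_sorted_word:
  assumes "w \<in> sorted_words n d"
  shows "spanned n q d (word_monom w)"
proof -
  have "(\<Sum>v\<in>sorted_words n d. scalar (if v = w then 1 else 0) * word_monom v) =
    (\<Sum>v\<in>{w}. scalar (if v = w then 1 else 0) * word_monom v :: 'a free_alg)"
    by (rule sum.mono_neutral_right) (use assms finite_sorted_words in auto)
  then show ?thesis unfolding spanned_def
    by (intro exI[of _ "\<lambda>v. if v = w then 1 else 0"]) simp
qed

text \<open>
  Both words replacing \<open>[x, y]\<close> start with a letter smaller than \<open>x\<close>, so straightening terminates by
  induction on the lexicographic order of words of fixed length.
\<close>

lemma straighten_descent:
  assumes q: "q \<noteq> (0::'k::field)" and x: "x \<in> {1..n} \<times> {1..n}" and y: "y \<in> {1..n} \<times> {1..n}"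
    and yx: "(y, x) \<in> letter_less"
  obtains c c' y' x' where "(y', x) \<in> letter_less" "x' \<in> {1..n} \<times> {1..n}" "y' \<in> {1..n} \<times> {1..n}"
    "word_monom [x, y] - (scalar c * word_monom [y, x] + scalar c' * word_monom [y', x']) \<in> qmat_ideal n q"
proof -
  obtain l m i j where xy: "x = (l, m)" "y = (i, j)" by (metis surj_pair)
  have r: "i \<in> {1..n}" "j \<in> {1..n}" "l \<in> {1..n}" "m \<in> {1..n}" using x y xy by auto
  have w2: "Xgen a b * Xgen c e = (word_monom [(a, b), (c, e)] :: 'k free_alg)" for a b c e
    by (simp add: Xgen_eq word_monom_append[symmetric])
  have neg: "- f \<in> qmat_ideal n q \<Longrightarrow> f \<in> qmat_ideal n q" for f
    using qmat_ideal_closed(2)[of "- f" n q] by simp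
  note fin = that
  have qcomm: thesis
    if "word_monom [y, x] - scalar q * word_monom [x, y] \<in> qmat_relations n q"
  proof -
    \<comment> \<open>The relation carries the unsorted word with coefficient \<open>- q\<close>, so
      it is solved for that word. The second replacement word is a dummy with coefficient 0.\<close>
    have "scalar (- inverse q) * (word_monom [y, x] - scalar q * word_monom [x, y]) \<in> qmat_ideal n q"
      by (intro qmat_ideal_closed(3) qmat_relations_ideal that scalar_in_carrier)
    also have "scalar (- inverse q) * (word_monom [y, x] - scalar q * word_monom [x, y]) =
      word_monom [x, y] - (scalar (inverse q) * word_monom [y, x] + scalar 0 * word_monom [y, x])"
      using q by (simp add: right_diff_distrib mult.assoc[symmetric] scalar_mult scalar_uminus)
    finally show thesis by (rule fin[OF yx x y])
  qed
  consider "l = i" "j < m" | "i < l" "j = m" | "i < l" "m < j" | "i < l" "j < m"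
    using yx xy by (auto simp: letter_less_def) (metis linorder_neqE_nat)
  then show thesis
  proof cases
    case 1
    have "Xgen i j * Xgen i m - scalar q * Xgen i m * Xgen i j \<in> qmat_relations n q"
      using 1 r unfolding qmat_relations_def by blast
    then show thesis using qcomm 1 xy by (simp add: mult.assoc w2)
  next
    case 2
    have "Xgen i j * Xgen l j - scalar q * Xgen l j * Xgen i j \<in> qmat_relations n q"
      using 2 r unfolding qmat_relations_def by blast
    then show thesis using qcomm 2 xy by (simp add: mult.assoc w2)
  next
    case 3
    have "Xgen i j * Xgen l m - Xgen l m * Xgen i j \<in> qmat_relations n q"
      using 3 r unfolding qmat_relations_def by blast
    then have "- (word_monom [x, y] - (scalar 1 * word_monom [y, x] + scalar 0 * word_monom [y, x])) \<in> qmat_ideal n q"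
      using qmat_relations_ideal[of _ n q] xy by (simp add: w2)
    then show thesis by (rule that[OF yx x y neg])
  next
    case 4
    have R: "Xgen i j * Xgen l m - Xgen l m * Xgen i j - scalar (q - inverse q) * Xgen i m * Xgen l j \<in> qmat_relations n q"
      using 4 r unfolding qmat_relations_def by blast
    have "word_monom [x, y] - (scalar 1 * word_monom [y, x] + scalar (- (q - inverse q)) * word_monom [(i, m), (l, j)]) =
      - (Xgen i j * Xgen l m - Xgen l m * Xgen i j - scalar (q - inverse q) * Xgen i m * Xgen l j)"
      unfolding scalar_uminus mult.assoc w2 xy by simp
    also have "\<dots> \<in> qmat_ideal n q"
      by (intro qmat_ideal_closed(2) qmat_relations_ideal R)
    finally have I: "word_monom [x, y] - (scalar 1 * word_monom [y, x] + scalar (- (q - inverse q)) * word_monom [(i, m), (l, j)])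
      \<in> qmat_ideal n q" .
    \<comment> \<open>The new word starts with \<open>(i, m)\<close>, which precedes
      \<open>x = (l, m)\<close> because \<open>i < l\<close>; its second letter does not enter the
      comparison.\<close>
    have "((i, m), x) \<in> letter_less" using 4 xy by (simp add: letter_less_def)
    then show thesis using r by (intro that[OF _ _ _ I]) auto
  qed
qed

theorem spanned_word:
  assumes q: "q \<noteq> (0::'k::field)" and w: "set w \<subseteq> {1..n} \<times> {1..n}" "length w = d"
  shows "spanned n q d (word_monom w)"
  using w
proof (induction w rule: wf_induct[of "lexn letter_less d"])
  case 1
  show ?case unfolding letter_less_def by (intro wf_lexn) auto
next
  case (2 w)
  show ?case
  proof (cases "sorted_wrt letter_le w")
    case True
    then show ?thesis using 2 by (intro spanned_sorted_word) (auto simp: sorted_words_def)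
  next
    case False
    then obtain u x y v where w: "w = u @ [x, y] @ v" and yx: "(y, x) \<in> letter_less"
      by (rule not_sorted_descent)
    have xy: "x \<in> {1..n} \<times> {1..n}" "y \<in> {1..n} \<times> {1..n}" using 2(2) w by auto
    obtain c c' y' x' where s: "(y', x) \<in> letter_less" "x' \<in> {1..n} \<times> {1..n}" "y' \<in> {1..n} \<times> {1..n}"
      "word_monom [x, y] - (scalar c * word_monom [y, x] + scalar c' * word_monom [y', x']) \<in> qmat_ideal n q"
      by (rule straighten_descent[OF q xy yx])
    \<comment> \<open>Between words of equal length the first difference decides, so replacing
      \<open>x\<close> by a smaller letter gives a smaller word whatever follows.\<close>
    have lower: "spanned n q d (word_monom (u @ [a, b] @ v))"
      if "(a, x) \<in> letter_less" "a \<in> {1..n} \<times> {1..n}" "b \<in> {1..n} \<times> {1..n}" for a b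
    proof -
      have "(u @ [a, b] @ v, w) \<in> lexn letter_less d"
      proof -
        have "\<exists>xys p r xs' ys'. u @ [a, b] @ v = xys @ p # xs' \<and> w = xys @ r # ys' \<and> (p, r) \<in> letter_less"
          using w that(1)
          by (intro exI[of _ u] exI[of _ a] exI[of _ x] exI[of _ "b # v"] exI[of _ "y # v"]) simp
        then show ?thesis using 2(3) w unfolding lexn_conv by simp
      qed
      moreover have "set (u @ [a, b] @ v) \<subseteq> {1..n} \<times> {1..n}" "length (u @ [a, b] @ v) = d"
        using 2(2,3) w that by auto
      ultimately show ?thesis using 2(1) by blast
    qed
    have "set u \<subseteq> {1..n} \<times> {1..n}" "set v \<subseteq> {1..n} \<times> {1..n}" using 2(2) w by auto
    then have u: "word_monom u \<in> free_carrier n" and v: "word_monom v \<in> free_carrier n"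
      by (blast intro: word_monom_carrier)+
    have "word_monom u * (word_monom [x, y] - (scalar c * word_monom [y, x] + scalar c' * word_monom [y', x'])) * word_monom v
      \<in> qmat_ideal n q"
      by (intro qmat_ideal_closed(3,4) s(4) u v)
    also have "word_monom u * (word_monom [x, y] - (scalar c * word_monom [y, x] + scalar c' * word_monom [y', x'])) * word_monom v =
      word_monom w - (scalar c * word_monom (u @ [y, x] @ v) + scalar c' * word_monom (u @ [y', x'] @ v))"
    proof -
      have sc: "word_monom u * (scalar a * f) = scalar a * (word_monom u * f)" for a f
        by (simp add: mult.assoc[symmetric] scalar_commute[of a "word_monom u"])
      show ?thesis unfolding w word_monom_append
        by (simp add: right_diff_distrib left_diff_distrib distrib_left distrib_right sc mult.assoc)
    qed
    finally show ?thesis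
      by (rule spanned_ideal_add) (intro spanned_add spanned_scale lower s yx xy)
  qed
qed

lemma spanned_homogeneous:
  assumes q: "q \<noteq> (0::'k::field)" and f: "f \<in> free_carrier n"
    and d: "\<And>w. w \<in> Poly_Mapping.keys f \<Longrightarrow> length (letters w) = d"
  shows "spanned n q d f"
  by (subst free_alg_expand, intro spanned_sum spanned_scale spanned_word[OF q])
    (use f d in \<open>auto simp: free_carrier_iff\<close>)

section \<open>Homogeneous lifts of minors and bitableau products\<close>

definition homogeneous :: "nat \<Rightarrow> 'k::field free_alg \<Rightarrow> bool" where
  "homogeneous d f \<longleftrightarrow> (\<forall>w\<in>Poly_Mapping.keys f. length (letters w) = d)"

lemma homogeneous_mult: "homogeneous d f \<Longrightarrow> homogeneous e g \<Longrightarrow> homogeneous (d + e) (f * g)"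
  unfolding homogeneous_def by (auto simp: plus_word_def elim!: keys_free_mult)

lemma homogeneous_sum: "(\<And>a. a \<in> A \<Longrightarrow> homogeneous d (f a)) \<Longrightarrow> homogeneous d (sum f A)"
  unfolding homogeneous_def using keys_sum[of f A] by blast

lemma homogeneous_scalar: "homogeneous 0 (scalar c)"
  by (auto simp: homogeneous_def scalar_def zero_word_def)

lemma homogeneous_word: "homogeneous (length w) (word_monom w)"
  by (auto simp: homogeneous_def word_monom_def)

lemma homogeneous_prod_list:
  "list_all2 (\<lambda>d f. homogeneous d f) ds fs \<Longrightarrow> homogeneous (sum_list ds) (prod_list fs)"
  by (induction rule: list_all2_induct) (use homogeneous_scalar[of 1] homogeneous_mult in auto)

text \<open>A lift of the quantum minor to the free algebra, so that length, products and evaluation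
  can be handled before passing to classes.\<close>

definition free_minor :: "'k::field \<Rightarrow> nat set \<Rightarrow> nat set \<Rightarrow> 'k free_alg" where
  "free_minor q I J = (\<Sum>\<sigma> | \<sigma> permutes {..<card I}. scalar ((- q) ^ perm_length (card I) \<sigma>) *
     prod_list (map (\<lambda>a. Xgen (sorted_list_of_set I ! a) (sorted_list_of_set J ! \<sigma> a)) [0..<card I]))"

lemma free_minor_letters:
  fixes I J :: "nat set"
  assumes "I \<subseteq> {1..n}" "J \<subseteq> {1..n}" "card I = card J" "\<sigma> permutes {..<card I}" "a < card I"
  shows "sorted_list_of_set I ! a \<in> {1..n}" "sorted_list_of_set J ! \<sigma> a \<in> {1..n}"
proof -
  have fin: "finite I" "finite J" using finite_subset[OF assms(1) finite_atLeastAtMost] finite_subset[OF assms(2) finite_atLeastAtMost] by auto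
  have "\<sigma> a < card J" using permutes_in_image[OF assms(4), of a] assms(3,5) by simp
  then have "sorted_list_of_set I ! a \<in> I" "sorted_list_of_set J ! \<sigma> a \<in> J"
    using nth_mem[of a "sorted_list_of_set I"] nth_mem[of "\<sigma> a" "sorted_list_of_set J"] assms(5) fin by auto
  then show "sorted_list_of_set I ! a \<in> {1..n}" "sorted_list_of_set J ! \<sigma> a \<in> {1..n}" using assms by auto
qed

lemma free_minor_term_carrier:
  assumes "I \<subseteq> {1..n}" "J \<subseteq> {1..n}" "card I = card J" "\<sigma> permutes {..<card I}"
  shows "prod_list (map (\<lambda>a. Xgen (sorted_list_of_set I ! a) (sorted_list_of_set J ! \<sigma> a)) [0..<card I]) \<in> free_carrier n"
  using free_minor_letters[OF assms] by (intro free_carrier_prod_list) (auto intro!: Xgen_in_carrier)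

lemma free_minor_carrier:
  assumes "I \<subseteq> {1..n}" "J \<subseteq> {1..n}" "card I = card J"
  shows "free_minor q I J \<in> free_carrier n"
  unfolding free_minor_def
  by (intro free_carrier_sum free_carrier_closed(4) scalar_in_carrier free_minor_term_carrier[OF assms]) simp

lemma homogeneous_free_minor: "homogeneous (card I) (free_minor q I J)"
proof -
  have "homogeneous (sum_list (replicate s 1)) (prod_list (map (\<lambda>a. Xgen (f a) (g a)) [0..<s]) :: 'a free_alg)" for s f g
    by (rule homogeneous_prod_list)
      (use homogeneous_word[of "[_]"] in \<open>auto simp: list_all2_conv_all_nth Xgen_eq\<close>)
  then have "homogeneous s (prod_list (map (\<lambda>a. Xgen (f a) (g a)) [0..<s]) :: 'a free_alg)" for s f g
    by (simp add: sum_list_replicate)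
  then show ?thesis unfolding free_minor_def
    using homogeneous_mult[OF homogeneous_scalar] by (intro homogeneous_sum) fastforce
qed

lemma qminor_eq_class:
  assumes "I \<subseteq> {1..n}" "J \<subseteq> {1..n}" "card I = card J"
  shows "qminor n q I J = qmat_class n q (free_minor q I J)"
proof -
  let ?p = "\<lambda>\<sigma>. map (\<lambda>a. Xgen (sorted_list_of_set I ! a) (sorted_list_of_set J ! \<sigma> a)) [0..<card I]"
  interpret Q: ring "qmat n q" by (rule qmat_ring)
  have class_term: "qmat_class n q (scalar ((- q) ^ perm_length (card I) \<sigma>) * prod_list (?p \<sigma>)) =
      (- q) ^ perm_length (card I) \<sigma> \<odot>\<^bsub>qmat n q\<^esub>
        ordered_prod (qmat n q) (map (\<lambda>a. qmat_class n q (Xgen (sorted_list_of_set I ! a) (sorted_list_of_set J ! \<sigma> a))) [0..<card I])"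
    if "\<sigma> permutes {..<card I}" for \<sigma>
  proof -
    have "qmat_class n q (prod_list (?p \<sigma>)) = ordered_prod (qmat n q) (map (qmat_class n q) (?p \<sigma>))"
      using free_minor_letters[OF assms that] by (intro qmat_class_prod_list) (auto intro!: Xgen_in_carrier)
    then show ?thesis
      unfolding qmat_class_hom(4)[OF free_minor_term_carrier[OF assms that] free_carrier_closed(1)]
      by (simp add: comp_def)
  qed
  have car: "scalar ((- q) ^ perm_length (card I) \<sigma>) * prod_list (?p \<sigma>) \<in> free_carrier n" if "\<sigma> permutes {..<card I}" for \<sigma>
    using free_minor_term_carrier[OF assms that] by (intro free_carrier_closed(4)) auto
  have "qmat_class n q (free_minor q I J) =
    (\<Oplus>\<^bsub>qmat n q\<^esub> \<sigma>\<in>{\<sigma>. \<sigma> permutes {..<card I}}. qmat_class n q (scalar ((- q) ^ perm_length (card I) \<sigma>) * prod_list (?p \<sigma>)))"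
    unfolding free_minor_def by (rule qmat_class_sum) (use car in \<open>auto intro!: finite_permutations\<close>)
  also have "\<dots> = qminor n q I J"
    unfolding qminor_def
  proof (rule Q.finsum_cong'[OF refl])
    show "(\<lambda>\<sigma>. (- q) ^ perm_length (card I) \<sigma> \<odot>\<^bsub>qmat n q\<^esub>
        ordered_prod (qmat n q) (map (\<lambda>a. qmat_class n q (Xgen (sorted_list_of_set I ! a) (sorted_list_of_set J ! \<sigma> a))) [0..<card I]))
      \<in> {\<sigma>. \<sigma> permutes {..<card I}} \<rightarrow> carrier (qmat n q)"
    proof (intro Pi_I, unfold mem_Collect_eq)
      fix \<sigma> assume s: "\<sigma> permutes {..<card I}"
      show "(- q) ^ perm_length (card I) \<sigma> \<odot>\<^bsub>qmat n q\<^esub>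
        ordered_prod (qmat n q) (map (\<lambda>a. qmat_class n q (Xgen (sorted_list_of_set I ! a) (sorted_list_of_set J ! \<sigma> a))) [0..<card I])
        \<in> carrier (qmat n q)"
        unfolding class_term[OF s, symmetric] by (rule qmat_class_hom(1)[OF car[OF s] free_carrier_closed(1)])
    qed
  qed (use class_term in auto)
  finally show ?thesis by simp
qed

definition free_bitableau :: "'k::field \<Rightarrow> tableau \<times> tableau \<Rightarrow> 'k free_alg" where
  "free_bitableau q = (\<lambda>(T, T'). prod_list (map2 (\<lambda>r r'. free_minor q (set r) (set r')) T T'))"

lemma antipreferred_row:
  assumes "(T, T') \<in> antipreferred_bitableaux n" "(r, r') \<in> set (zip T T')"
  shows "set r \<subseteq> {1..n}" "set r' \<subseteq> {1..n}" "card (set r) = card (set r')" "length r = card (set r)"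
    "sorted_list_of_set (set r) = r" "card (set r) = length r"
proof -
  obtain k where k: "k < length T" "r = T ! k" "r' = T' ! k"
    using assms(2) by (auto simp: set_zip)
  note a = antipreferredD(6-8)[OF assms(1) k(1)]
  show "set r \<subseteq> {1..n}" "set r' \<subseteq> {1..n}" using a k by auto
  have "distinct r" "distinct (rev r')" "length r = length r'" using a k by (auto simp: strict_sorted_iff)
  then show "card (set r) = card (set r')" "length r = card (set r)" "card (set r) = length r"
    by (simp_all add: distinct_card)
  show "sorted_list_of_set (set r) = r"
    using a(2) k by (simp add: sorted_list_of_set.idem_if_sorted_distinct strict_sorted_iff)
qed

lemma free_minors_carrier:
  assumes "(T, T') \<in> antipreferred_bitableaux n"
  shows "set (map2 (\<lambda>r r'. free_minor q (set r) (set r')) T T') \<subseteq> free_carrier n"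
proof
  fix x assume "x \<in> set (map2 (\<lambda>r r'. free_minor q (set r) (set r')) T T')"
  then obtain r r' where r: "(r, r') \<in> set (zip T T')" "x = free_minor q (set r) (set r')" by auto
  show "x \<in> free_carrier n"
    unfolding r(2) by (rule free_minor_carrier[OF antipreferred_row(1-3)[OF assms r(1)]])
qed

lemma free_bitableau_carrier:
  assumes "b \<in> antipreferred_bitableaux n"
  shows "free_bitableau q b \<in> free_carrier n"
proof -
  obtain T T' where b: "b = (T, T')" by (cases b)
  show ?thesis unfolding b free_bitableau_def prod.case
    by (rule free_carrier_prod_list[OF free_minors_carrier[OF assms[unfolded b]]])
qed

lemma homogeneous_free_bitableau:
  assumes "(T, T') \<in> antipreferred_bitableaux n"
  shows "homogeneous (sum_list (map length T)) (free_bitableau q (T, T'))"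
proof -
  have "length T = length T'" using antipreferredD(5)[OF assms] .
  then have "list_all2 homogeneous (map length T) (map2 (\<lambda>r r'. free_minor q (set r) (set r')) T T')"
  proof -
    have "length (T ! i) = card (set (T ! i))" if "i < length T" for i
      using antipreferred_row(4)[OF assms, of "T ! i" "T' ! i"] that \<open>length T = length T'\<close>
      by (auto simp: set_zip)
    then have "homogeneous (length (T ! i)) (free_minor q (set (T ! i)) (set (T' ! i)))" if "i < length T" for i
      using homogeneous_free_minor[of "set (T ! i)" q "set (T' ! i)"] that by simp
    then show ?thesis using \<open>length T = length T'\<close> by (simp add: list_all2_conv_all_nth)
  qed
  then show ?thesis unfolding free_bitableau_def by (simp add: homogeneous_prod_list)
qed

lemma bitableau_prod_eq_class:
  assumes "b \<in> antipreferred_bitableaux n"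
  shows "bitableau_prod n q b = qmat_class n q (free_bitableau q b)"
proof -
  obtain T T' where b: "b = (T, T')" by (cases b)
  note row = antipreferred_row(1-3)[OF assms[unfolded b]]
  have "qmat_class n q (free_bitableau q (T, T')) =
    ordered_prod (qmat n q) (map (qmat_class n q) (map2 (\<lambda>r r'. free_minor q (set r) (set r')) T T'))"
    unfolding free_bitableau_def prod.case
    by (rule qmat_class_prod_list[OF free_minors_carrier[OF assms[unfolded b]]])
  also have "map (qmat_class n q) (map2 (\<lambda>r r'. free_minor q (set r) (set r')) T T') =
    map2 (\<lambda>r r'. qminor n q (set r) (set r')) T T'"
  proof -
    have "qminor n q (set r) (set r') = qmat_class n q (free_minor q (set r) (set r'))"
      if "(r, r') \<in> set (zip T T')" for r r'
      by (rule qminor_eq_class[OF row[OF that]])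
    then show ?thesis by auto
  qed
  finally show ?thesis by (simp add: b bitableau_prod_def)
qed

lemma ring_of_ring_1_type: "ring (ring_of_type_algebra :: 'r::ring_1 ring)"
  unfolding ring_of_type_algebra_def
proof (rule ringI, goal_cases)
  case 1
  show ?case
    by (rule abelian_groupI) (auto simp: add.assoc add.commute intro: exI[of _ "- _"])
next
  case 2
  show ?case by (rule monoidI) (auto simp: mult.assoc)
qed (auto simp: distrib_left distrib_right)

section \<open>The network representation annihilates the ideal\<close>

context network begin

definition rep :: "'k free_alg \<Rightarrow> (edge \<Rightarrow> int, 'k) lin_op" where
  "rep = eval_word (tail_mat (3 * n))"

lemma rep_relations:
  assumes "f \<in> qmat_relations n q"
  shows "rep f = 0"
proof -
  have M: "qmatrix (tail_mat (3 * n))" by (rule qmatrix_tail_mat) simp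
  have h: "scalar_op (q - inverse q) = z - scalar_op (inverse q)"
    by (simp add: eq_diff_eq scalar_op_add[symmetric])
  show ?thesis
    using assms unfolding qmat_relations_def
  proof (elim UnE CollectE exE conjE)
    fix i j l assume f: "f = Xgen i j * Xgen l j - scalar q * Xgen l j * Xgen i j" "{i, j, l} \<subseteq> {1..n}" "i < l"
    then show "rep f = 0" using qmatrix_col[OF M, of i l j]
      by (simp add: rep_def eval_word_diff eval_word_mult mult.assoc)
  next
    fix i j m assume f: "f = Xgen i j * Xgen i m - scalar q * Xgen i m * Xgen i j" "{i, j, m} \<subseteq> {1..n}" "j < m"
    then show "rep f = 0" using qmatrix_row[OF M, of i j m]
      by (simp add: rep_def eval_word_diff eval_word_mult mult.assoc)
  next
    fix i j l m assume f: "f = Xgen i j * Xgen l m - Xgen l m * Xgen i j" "{i, j, l, m} \<subseteq> {1..n}" "i < l" "m < j"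
    then show "rep f = 0" using qmatrix_anti[OF M, of i l m j]
      by (simp add: rep_def eval_word_diff eval_word_mult)
  next
    fix i j l m assume f: "f = Xgen i j * Xgen l m - Xgen l m * Xgen i j - scalar (q - inverse q) * Xgen i m * Xgen l j"
      "{i, j, l, m} \<subseteq> {1..n}" "i < l" "j < m"
    then show "rep f = 0" using qmatrix_diag[OF M, of i l j m]
      by (simp add: rep_def eval_word_diff eval_word_mult mult.assoc h)
  qed
qed

text \<open>On the free algebra \<open>rep\<close> is a ring homomorphism, so its kernel is an
  ideal; it contains the relations and hence the ideal generated by them.\<close>

lemma rep_ideal:
  assumes "f \<in> qmat_ideal n q"
  shows "rep f = 0"
proof -
  let ?F = "free_algebra n :: 'k free_alg ring"
  let ?R = "ring_of_type_algebra :: (edge \<Rightarrow> int, 'k) lin_op ring"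
  have hom: "rep \<in> ring_hom ?F ?R"
    by (rule ring_hom_memI) (auto simp: rep_def eval_word_mult eval_word_add ring_of_type_algebra_def)
  have "ring_hom_ring ?F ?R rep"
    by (rule ring_hom_ringI2[OF free_algebra_ring ring_of_ring_1_type hom])
  then have ker: "ideal (a_kernel ?F ?R rep) ?F"
    by (rule ring_hom_ring.kernel_is_ideal)
  have "qmat_relations n q \<subseteq> a_kernel ?F ?R rep"
    using qmat_relations_carrier[of n q] rep_relations
    by (auto simp: a_kernel_def' ring_of_type_algebra_def)
  then have "qmat_ideal n q \<subseteq> a_kernel ?F ?R rep"
    unfolding qmat_ideal_def by (rule ring.genideal_minimal[OF free_algebra_ring ker])
  then show ?thesis using assms by (auto simp: a_kernel_def' ring_of_type_algebra_def)
qed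

lemma rep_free_minor:
  assumes "I \<subseteq> {1..n}" "J \<subseteq> {1..n}" "card I = card J"
  shows "rep (free_minor q I J) = qdet z (tail_mat (3 * n)) (sorted_list_of_set I) J"
proof -
  have "finite J" using assms finite_subset by auto
  have "rep (free_minor q I J) = (\<Sum>\<sigma> | \<sigma> permutes {..<card J}. (- z) ^ perm_length (card J) \<sigma> *
     prod_list (map (\<lambda>a. tail_mat (3 * n) (sorted_list_of_set I ! a) (sorted_list_of_set J ! \<sigma> a)) [0..<card J]))"
    unfolding rep_def free_minor_def assms(3)
    by (simp add: eval_word_sum eval_word_mult eval_word_prod_list scalar_op_power scalar_op_minus comp_def)
  also have "\<dots> = qdet z (tail_mat (3 * n)) (sorted_list_of_set I) J"
    using assms by (intro qdet_permutes \<open>finite J\<close>) simp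
  finally show ?thesis .
qed

lemma rep_free_bitableau:
  assumes "b \<in> antipreferred_bitableaux n"
  shows "rep (free_bitableau q b) = bitableau_op b"
proof -
  obtain T T' where b: "b = (T, T')" by (cases b)
  note row = antipreferred_row[OF assms[unfolded b]]
  have "map rep (map2 (\<lambda>r r'. free_minor q (set r) (set r')) T T') =
    map2 (\<lambda>r r'. qdet z (tail_mat (3 * n)) r (set r')) T T'"
  proof -
    have "rep (free_minor q (set r) (set r')) = qdet z (tail_mat (3 * n)) r (set r')"
      if "(r, r') \<in> set (zip T T')" for r r'
      using rep_free_minor[OF row(1-3)[OF that]] row(5)[OF that] by simp
    then show ?thesis by auto
  qed
  then show ?thesis unfolding b free_bitableau_def bitableau_op_def prod.case
    by (simp only: rep_def eval_word_prod_list)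
qed

theorem free_bitableau_independent:
  assumes n: "0 < n" and F: "finite F" "F \<subseteq> antipreferred_bitableaux n"
    and zero: "(\<Sum>b\<in>F. scalar (c b) * free_bitableau q b) \<in> qmat_ideal n q" and b: "b \<in> F"
  shows "c b = 0"
proof (rule bitableau_op_independent[OF n F _ b])
  have "rep (\<Sum>b\<in>F. scalar (c b) * free_bitableau q b) = (\<Sum>b\<in>F. scalar_op (c b) * rep (free_bitableau q b))"
    by (simp add: rep_def eval_word_sum eval_word_mult)
  also have "\<dots> = (\<Sum>b\<in>F. scalar_op (c b) * bitableau_op b)"
    using F(2) by (intro sum.cong refl) (auto simp: rep_free_bitableau)
  finally show "(\<Sum>b\<in>F. scalar_op (c b) * bitableau_op b) = 0"
    using rep_ideal[OF zero] by simp
qed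

end

section \<open>Growth diagrams\<close>

text \<open>Partitions are given by their column heights. The condition then says that passing from
  \<open>\<kappa>\<close> to \<open>\<mu>\<close> adds at most one box to each row, as strictly
  increasing rows require.\<close>

definition interlace :: "(nat \<Rightarrow> nat) \<Rightarrow> (nat \<Rightarrow> nat) \<Rightarrow> bool" where
  "interlace \<kappa> \<mu> \<longleftrightarrow> (\<forall>c. \<kappa> c \<le> \<mu> c \<and> \<mu> (Suc c) \<le> \<kappa> c)"

text \<open>
  Fomin's local rule of the growth diagram: \<open>\<kappa>\<close>, \<open>\<mu>\<close>, \<open>\<nu>\<close> are the partitions at three corners of a cell with
  entry \<open>m\<close>, and the value is the partition at the fourth corner.
\<close>

definition local_rule :: "(nat \<Rightarrow> nat) \<Rightarrow> (nat \<Rightarrow> nat) \<Rightarrow> (nat \<Rightarrow> nat) \<Rightarrow> nat \<Rightarrow> nat \<Rightarrow> nat" where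
  "local_rule \<kappa> \<mu> \<nu> m c = (case c of 0 \<Rightarrow> max (\<mu> 0) (\<nu> 0) + m
     | Suc c \<Rightarrow> max (\<mu> (Suc c)) (\<nu> (Suc c)) + min (\<mu> c) (\<nu> c) - \<kappa> c)"

lemma interlace_local_rule:
  assumes "interlace \<kappa> \<mu>" "interlace \<kappa> \<nu>"
  shows "interlace \<mu> (local_rule \<kappa> \<mu> \<nu> m)" "interlace \<nu> (local_rule \<kappa> \<mu> \<nu> m)"
proof -
  have "\<mu> c \<le> local_rule \<kappa> \<mu> \<nu> m c \<and> \<nu> c \<le> local_rule \<kappa> \<mu> \<nu> m c" for c
  proof (cases c)
    case (Suc d)
    have "\<kappa> d \<le> \<mu> d" "\<kappa> d \<le> \<nu> d"
      using assms by (auto simp: interlace_def)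
    then show ?thesis using Suc by (simp add: local_rule_def) linarith
  qed (auto simp: local_rule_def max_def)
  moreover have "local_rule \<kappa> \<mu> \<nu> m (Suc c) \<le> \<mu> c \<and> local_rule \<kappa> \<mu> \<nu> m (Suc c) \<le> \<nu> c" for c
  proof -
    have "\<mu> (Suc c) \<le> \<kappa> c" "\<nu> (Suc c) \<le> \<kappa> c" "\<kappa> c \<le> \<mu> c" "\<kappa> c \<le> \<nu> c"
      using assms by (auto simp: interlace_def)
    then show ?thesis by (simp add: local_rule_def) linarith
  qed
  ultimately show "interlace \<mu> (local_rule \<kappa> \<mu> \<nu> m)" "interlace \<nu> (local_rule \<kappa> \<mu> \<nu> m)"
    by (auto simp: interlace_def)
qed

text \<open>Column 0 reveals \<open>m\<close>. In the later columns interlacing makes the truncated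
  subtraction exact, so \<open>\<kappa>\<close> can be solved for.\<close>

lemma local_rule_inj:
  assumes "interlace \<kappa> \<mu>" "interlace \<kappa> \<nu>" "interlace \<kappa>' \<mu>" "interlace \<kappa>' \<nu>"
    and eq: "local_rule \<kappa> \<mu> \<nu> m = local_rule \<kappa>' \<mu> \<nu> m'"
  shows "\<kappa> = \<kappa>' \<and> m = m'"
proof
  show "m = m'" using fun_cong[OF eq, of 0] by (simp add: local_rule_def)
  show "\<kappa> = \<kappa>'"
  proof
    fix c
    have "\<kappa> c \<le> \<mu> c" "\<kappa> c \<le> \<nu> c" "\<kappa>' c \<le> \<mu> c" "\<kappa>' c \<le> \<nu> c"
      using assms by (auto simp: interlace_def)
    then show "\<kappa> c = \<kappa>' c" using fun_cong[OF eq, of "Suc c"] by (simp add: local_rule_def)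
  qed
qed

text \<open>Sizes are additive because a maximum and a minimum of two numbers sum to the numbers
  themselves. A partial sum is off by the last minimum, which vanishes at \<open>N\<close>.\<close>

lemma sum_local_rule:
  assumes "interlace \<kappa> \<mu>" "interlace \<kappa> \<nu>" "\<mu> N = 0" "\<nu> N = 0"
  shows "(\<Sum>c\<le>N. local_rule \<kappa> \<mu> \<nu> m c) + (\<Sum>c\<le>N. \<kappa> c) = (\<Sum>c\<le>N. \<mu> c) + (\<Sum>c\<le>N. \<nu> c) + m"
proof -
  have *: "\<kappa> c \<le> \<mu> c" "\<kappa> c \<le> \<nu> c" for c using assms by (auto simp: interlace_def)
  have N0: "\<kappa> N = 0" using *(1)[of N] assms by simp
  have "(\<Sum>c\<le>N'. local_rule \<kappa> \<mu> \<nu> m c) + (\<Sum>c<N'. \<kappa> c) + min (\<mu> N') (\<nu> N') = (\<Sum>c\<le>N'. \<mu> c) + (\<Sum>c\<le>N'. \<nu> c) + m" for N'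
  proof (induction N')
    case (Suc N')
    have "local_rule \<kappa> \<mu> \<nu> m (Suc N') + \<kappa> N' = max (\<mu> (Suc N')) (\<nu> (Suc N')) + min (\<mu> N') (\<nu> N')"
      using *[of N'] by (simp add: local_rule_def)
    then show ?case using Suc by simp
  qed (simp add: local_rule_def)
  from this[of N] show ?thesis using assms(3) N0 by (simp add: lessThan_Suc_atMost[symmetric])
qed

fun growth :: "(nat \<Rightarrow> nat \<Rightarrow> nat) \<Rightarrow> nat \<Rightarrow> nat \<Rightarrow> nat \<Rightarrow> nat" where
  "growth A 0 j = (\<lambda>_. 0)"
| "growth A (Suc i) 0 = (\<lambda>_. 0)"
| "growth A (Suc i) (Suc j) =
     local_rule (growth A i j) (growth A i (Suc j)) (growth A (Suc i) j) (A i j)"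

lemma growth_0 [simp]: "growth A i 0 = (\<lambda>_. 0)"
  by (cases i) auto

lemma interlace_growth:
  "interlace (growth A i j) (growth A (Suc i) j) \<and> interlace (growth A i j) (growth A i (Suc j))"
proof (induction i arbitrary: j)
  case 0
  have col: "interlace (growth A 0 j) (growth A 0 (Suc j))" for j by (simp add: interlace_def)
  moreover have "interlace (growth A 0 j) (growth A (Suc 0) j)" for j
  proof (induction j)
    case (Suc j)
    show ?case unfolding growth.simps(3) using col Suc by (rule interlace_local_rule)
  qed (simp add: interlace_def)
  ultimately show ?case by blast
next
  case (Suc i)
  have col: "interlace (growth A (Suc i) j) (growth A (Suc i) (Suc j))" for j
    unfolding growth.simps(3) using Suc.IH by (intro interlace_local_rule(2)) auto
  moreover have "interlace (growth A (Suc i) j) (growth A (Suc (Suc i)) j)" for j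
  proof (induction j)
    case (Suc j)
    show ?case unfolding growth.simps(3)[of A "Suc i"] using col Suc by (rule interlace_local_rule)
  qed (simp add: interlace_def)
  ultimately show ?case by blast
qed

text \<open>Each step in \<open>i\<close> can open at most one new column, by interlacing.\<close>

lemma growth_zero: "i \<le> c \<Longrightarrow> growth A i j c = 0"
proof (induction i arbitrary: c)
  case (Suc i)
  then obtain d where d: "c = Suc d" "i \<le> d" by (cases c) auto
  have "growth A (Suc i) j (Suc d) \<le> growth A i j d"
    using interlace_growth[of A i j] by (simp add: interlace_def)
  then show ?case using Suc.IH[OF d(2)] d by simp
qed simp

lemma sum_growth:
  "i \<le> N \<Longrightarrow> (\<Sum>c\<le>N. growth A i j c) = (\<Sum>a<i. \<Sum>b<j. A a b)"
proof (induction i arbitrary: j)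
  case (Suc i)
  have IH: "(\<Sum>c\<le>N. growth A i j c) = (\<Sum>a<i. \<Sum>b<j. A a b)" for j using Suc by simp
  show ?case
  proof (induction j)
    case (Suc j)
    have "(\<Sum>c\<le>N. growth A (Suc i) (Suc j) c) + (\<Sum>c\<le>N. growth A i j c) =
       (\<Sum>c\<le>N. growth A i (Suc j) c) + (\<Sum>c\<le>N. growth A (Suc i) j c) + A i j"
      unfolding growth.simps(3)
      using interlace_growth[of A i j] growth_zero \<open>Suc i \<le> N\<close> by (intro sum_local_rule) auto
    then show ?case unfolding IH Suc by (simp add: sum.distrib)
  qed simp
qed simp

text \<open>Inverting the local rule rebuilds the whole diagram from its two far sides, by induction
  on the distance from the far corner; the entries of the matrix come out along the way.\<close>

lemma growth_inj:
  assumes "\<And>i. i \<le> n \<Longrightarrow> growth A i m = growth B i m" "\<And>j. j \<le> m \<Longrightarrow> growth A n j = growth B n j"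
    and "i < n" "j < m"
  shows "A i j = B i j"
proof -
  have *: "\<forall>i j. i \<le> n \<longrightarrow> j \<le> m \<longrightarrow> (n - i) + (m - j) \<le> d \<longrightarrow> growth A i j = growth B i j" for d
  proof (induction d)
    case 0
    then show ?case using assms(1)[OF order_refl] by (metis add.commute add_is_0 diff_is_0_eq le_antisym le_zero_eq)
  next
    case (Suc d)
    show ?case
    proof (intro allI impI)
      fix i j assume ij: "i \<le> n" "j \<le> m" "n - i + (m - j) \<le> Suc d"
      show "growth A i j = growth B i j"
      proof (cases "i < n \<and> j < m")
        case True
        then have e: "growth A (Suc i) j = growth B (Suc i) j" "growth A i (Suc j) = growth B i (Suc j)"
          using Suc ij by auto
        have e3: "growth A (Suc i) (Suc j) = growth B (Suc i) (Suc j)"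
          using Suc ij True by (auto simp del: growth.simps(3))
        show ?thesis
          using local_rule_inj[of "growth A i j" "growth A i (Suc j)" "growth A (Suc i) j" "growth B i j"]
            interlace_growth[of A i j] interlace_growth[of B i j] e e3[unfolded growth.simps(3)] by metis
      qed (use assms ij in \<open>auto simp: not_less\<close>)
    qed
  qed
  have e: "growth A i j = growth B i j" if "i \<le> n" "j \<le> m" for i j
    using * that by blast
  show ?thesis
    using local_rule_inj[of "growth A i j" "growth A i (Suc j)" "growth A (Suc i) j" "growth B i j"]
      interlace_growth[of A i j] interlace_growth[of B i j] e[of i j] e[of "Suc i" j] e[of i "Suc j"]
      e[of "Suc i" "Suc j", unfolded growth.simps(3)] assms(3,4)
    by (metis Suc_leI less_imp_le_nat)
qed

section \<open>Tableaux from growth diagrams\<close>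

definition chain_length :: "nat \<Rightarrow> (nat \<Rightarrow> nat \<Rightarrow> nat) \<Rightarrow> nat \<Rightarrow> nat" where
  "chain_length n \<Lambda> r = card {c. c < n \<and> r < \<Lambda> n c}"

definition chain_entry :: "(nat \<Rightarrow> nat \<Rightarrow> nat) \<Rightarrow> nat \<Rightarrow> nat \<Rightarrow> nat" where
  "chain_entry \<Lambda> r c = (LEAST i. r < \<Lambda> i c)"

text \<open>The usual coding of a tableau by a growing chain of shapes:
  \<open>r < \<Lambda> i c\<close> says that the box in row \<open>r\<close> and column
  \<open>c\<close> is present after step \<open>i\<close>, and a box is labelled by the step that
  adds it.\<close>

definition chain_tableau :: "nat \<Rightarrow> (nat \<Rightarrow> nat \<Rightarrow> nat) \<Rightarrow> tableau" where
  "chain_tableau n \<Lambda> = map (\<lambda>r. map (chain_entry \<Lambda> r) [0..<chain_length n \<Lambda> r]) [0..<\<Lambda> n 0]"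

locale interlacing_chain =
  fixes n :: nat and \<Lambda> :: "nat \<Rightarrow> nat \<Rightarrow> nat"
  assumes start: "\<Lambda> 0 c = 0"
    and interlace: "interlace (\<Lambda> i) (\<Lambda> (Suc i))"
    and bound: "n \<le> c \<Longrightarrow> \<Lambda> n c = 0"
begin

lemma chain_mono: "i \<le> j \<Longrightarrow> \<Lambda> i c \<le> \<Lambda> j c"
  by (rule lift_Suc_mono_le) (use interlace in \<open>auto simp: interlace_def\<close>)

lemma chain_Suc_column: "\<Lambda> (Suc i) (Suc c) \<le> \<Lambda> i c"
  using interlace[of i] by (simp add: interlace_def)

lemma chain_antimono: "c \<le> c' \<Longrightarrow> \<Lambda> i c' \<le> \<Lambda> i c"
proof (rule lift_Suc_antimono_le[of "\<Lambda> i"])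
  fix c
  show "\<Lambda> i (Suc c) \<le> \<Lambda> i c"
    using chain_Suc_column[of "i - 1" c] chain_mono[of "i - 1" i c] start by (cases i) auto
qed

lemma less_chain_length: "c < chain_length n \<Lambda> r \<longleftrightarrow> r < \<Lambda> n c"
proof -
  have "c < chain_length n \<Lambda> r \<longleftrightarrow> c < n \<and> r < \<Lambda> n c"
    unfolding chain_length_def
    by (rule less_card_down_closed) (use chain_antimono less_le_trans less_imp_le in blast)
  then show ?thesis using bound[of c] by (cases "c < n") auto
qed

lemma chain_entry_le_iff:
  assumes "r < \<Lambda> n c"
  shows "chain_entry \<Lambda> r c \<le> i \<longleftrightarrow> r < \<Lambda> i c"
proof
  have least: "r < \<Lambda> (chain_entry \<Lambda> r c) c" unfolding chain_entry_def using assms by (rule LeastI)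
  show "chain_entry \<Lambda> r c \<le> i \<Longrightarrow> r < \<Lambda> i c" using least chain_mono less_le_trans by blast
  show "r < \<Lambda> i c \<Longrightarrow> chain_entry \<Lambda> r c \<le> i" unfolding chain_entry_def by (rule Least_le)
qed

lemma chain_tableau_simps [simp]:
  "length (chain_tableau n \<Lambda>) = \<Lambda> n 0"
  "r < \<Lambda> n 0 \<Longrightarrow> length (chain_tableau n \<Lambda> ! r) = chain_length n \<Lambda> r"
  "r < \<Lambda> n 0 \<Longrightarrow> c < chain_length n \<Lambda> r \<Longrightarrow> chain_tableau n \<Lambda> ! r ! c = chain_entry \<Lambda> r c"
  by (simp_all add: chain_tableau_def)

lemma chain_entry_range: "r < \<Lambda> n c \<Longrightarrow> chain_entry \<Lambda> r c \<in> {1..n}"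
  using chain_entry_le_iff[of r c n] chain_entry_le_iff[of r c 0] start[of c] by auto

lemma is_tableau_chain: "is_tableau n (chain_tableau n \<Lambda>)"
  unfolding is_tableau_def
proof (intro conjI ballI)
  have "chain_length n \<Lambda> r \<noteq> 0" if "r < \<Lambda> n 0" for r
    using less_chain_length[of 0 r] that by simp
  then show "[] \<notin> set (chain_tableau n \<Lambda>)"
    by (fastforce simp: chain_tableau_def)
  show "sorted_wrt (\<ge>) (map length (chain_tableau n \<Lambda>))"
    unfolding sorted_wrt_iff_nth_less
  proof (intro allI impI)
    fix r r' assume "r < r'" "r' < length (map length (chain_tableau n \<Lambda>))"
    moreover have "chain_length n \<Lambda> r' \<le> chain_length n \<Lambda> r"
      unfolding chain_length_def using \<open>r < r'\<close> by (intro card_mono) auto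
    ultimately show "map length (chain_tableau n \<Lambda>) ! r' \<le> map length (chain_tableau n \<Lambda>) ! r" by simp
  qed
  fix row assume "row \<in> set (chain_tableau n \<Lambda>)"
  then obtain r where "row = map (chain_entry \<Lambda> r) [0..<chain_length n \<Lambda> r]"
    by (auto simp: chain_tableau_def)
  moreover have "chain_entry \<Lambda> r c \<in> {1..n}" if "c < chain_length n \<Lambda> r" for c
    using chain_entry_range[of r c] less_chain_length[of c r] that by blast
  ultimately show "set row \<subseteq> {1..n}" by auto
qed

lemma increasing_chain: "increasing_tableau (chain_tableau n \<Lambda>)"
  unfolding increasing_tableau_def
proof (intro conjI ballI allI impI)
  fix row assume "row \<in> set (chain_tableau n \<Lambda>)"
  then obtain r where row: "row = map (chain_entry \<Lambda> r) [0..<chain_length n \<Lambda> r]"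
    by (auto simp: chain_tableau_def)
  have "chain_entry \<Lambda> r c < chain_entry \<Lambda> r (Suc c)" if "Suc c < chain_length n \<Lambda> r" for c
  proof -
    have r: "r < \<Lambda> n (Suc c)" "r < \<Lambda> n c" using that less_chain_length[of "Suc c" r] less_chain_length[of c r] by auto
    \<comment> \<open>One step before box \<open>(r, c + 1)\<close> appears, interlacing guarantees
      that box \<open>(r, c)\<close> is already there.\<close>
    obtain i where i: "chain_entry \<Lambda> r (Suc c) = Suc i"
      using chain_entry_range[OF r(1)] by (cases "chain_entry \<Lambda> r (Suc c)") auto
    then have "r < \<Lambda> (Suc i) (Suc c)" using chain_entry_le_iff[OF r(1), of "Suc i"] by simp
    then have "r < \<Lambda> i c" using chain_Suc_column[of i c] by simp
    then show ?thesis using chain_entry_le_iff[OF r(2), of i] i by simp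
  qed
  then show "sorted_wrt (<) row"
    unfolding row by (subst sorted_wrt_iff_nth_Suc_transp) auto
next
  fix a b c assume h: "a < b \<and> b < length (chain_tableau n \<Lambda>) \<and> c < length (chain_tableau n \<Lambda> ! b)"
  then have b: "b < \<Lambda> n 0" "c < chain_length n \<Lambda> b" "b < \<Lambda> n c" using less_chain_length[of c b] by auto
  then have "c < chain_length n \<Lambda> a" using h less_chain_length[of c a] by auto
  moreover have "a < \<Lambda> (chain_entry \<Lambda> b c) c"
    using chain_entry_le_iff[OF b(3), of "chain_entry \<Lambda> b c"] h by auto
  then have "chain_entry \<Lambda> a c \<le> chain_entry \<Lambda> b c"
    unfolding chain_entry_def[of _ a] by (rule Least_le)
  ultimately show "chain_tableau n \<Lambda> ! a ! c \<le> chain_tableau n \<Lambda> ! b ! c" using h b by simp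
qed

lemma chain_recover:
  assumes "i \<le> n"
  shows "r < \<Lambda> i c \<longleftrightarrow> r < length (chain_tableau n \<Lambda>) \<and> c < length (chain_tableau n \<Lambda> ! r) \<and>
    chain_tableau n \<Lambda> ! r ! c \<le> i"
proof -
  have "r < \<Lambda> i c \<Longrightarrow> r < \<Lambda> n c" using chain_mono[OF assms, of c] by simp
  moreover have "r < \<Lambda> n c \<Longrightarrow> r < \<Lambda> n 0" using chain_antimono[of 0 c n] by simp
  ultimately show ?thesis using less_chain_length[of c r] chain_entry_le_iff[of r c i] by auto
qed

lemma chain_boxes: "sum_list (map length (chain_tableau n \<Lambda>)) = (\<Sum>c\<le>n. \<Lambda> n c)"
proof -
  have "sum_list (map length (chain_tableau n \<Lambda>)) = (\<Sum>r<\<Lambda> n 0. chain_length n \<Lambda> r)"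
    by (simp add: chain_tableau_def comp_def interv_sum_list_conv_sum_set_nat atLeast0LessThan)
  also have "\<dots> = (\<Sum>r<\<Lambda> n 0. \<Sum>c<n. if r < \<Lambda> n c then 1 else 0)"
    unfolding chain_length_def by (subst sum_if_card) auto
  also have "\<dots> = (\<Sum>c<n. \<Sum>r<\<Lambda> n 0. if r < \<Lambda> n c then 1 else 0)"
    by (rule sum.swap)
  also have "\<dots> = (\<Sum>c<n. \<Lambda> n c)"
  proof (rule sum.cong[OF refl])
    fix c
    have "{r \<in> {..<\<Lambda> n 0}. r < \<Lambda> n c} = {..<\<Lambda> n c}" using chain_antimono[of 0 c n] by auto
    then show "(\<Sum>r<\<Lambda> n 0. if r < \<Lambda> n c then 1 else 0) = \<Lambda> n c" by (simp add: sum_if_card)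
  qed
  finally show ?thesis using bound[of n] by (simp add: lessThan_Suc_atMost[symmetric])
qed

end

lemma chain_tableau_inj:
  assumes "interlacing_chain n \<Lambda>" "interlacing_chain n M" "chain_tableau n \<Lambda> = chain_tableau n M" "i \<le> n"
  shows "\<Lambda> i = M i"
proof
  fix c
  have "r < \<Lambda> i c \<longleftrightarrow> r < M i c" for r
    using interlacing_chain.chain_recover[OF assms(1,4)] interlacing_chain.chain_recover[OF assms(2,4)] assms(3) by simp
  then show "\<Lambda> i c = M i c" by (metis linorder_neqE_nat less_irrefl)
qed

section \<open>The Robinson-Schensted-Knuth correspondence\<close>

lemma interlacing_growth:
  "interlacing_chain n (\<lambda>i. growth A i n)" "interlacing_chain n (growth A n)"
  by (unfold_locales, use interlace_growth growth_zero in auto)+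

text \<open>The two far sides of the growth diagram end in the same corner, so both tableaux have
  the same shape. The second is flipped to become decreasing.\<close>

definition rsk :: "nat \<Rightarrow> (nat \<Rightarrow> nat \<Rightarrow> nat) \<Rightarrow> tableau \<times> tableau" where
  "rsk n A = (chain_tableau n (\<lambda>i. growth A i n), flip_tableau n (chain_tableau n (growth A n)))"

lemma decreasing_flip:
  assumes "is_tableau n T" "increasing_tableau T"
  shows "decreasing_tableau (flip_tableau n T)"
  unfolding decreasing_tableau_def
proof (intro conjI ballI allI impI)
  fix r assume "r \<in> set (flip_tableau n T)"
  then obtain r' where r': "r' \<in> set T" "r = map (\<lambda>x. Suc n - x) r'" by (auto simp: flip_tableau_def)
  have "set r' \<subseteq> {1..n}" "sorted_wrt (<) r'"
    using assms r'(1) by (auto simp: is_tableau_def increasing_tableau_def)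
  then show "sorted_wrt (>) r" unfolding r'(2) sorted_wrt_map
    by (elim sorted_wrt_mono_rel[rotated]) fastforce
next
  fix a b c assume h: "a < b \<and> b < length (flip_tableau n T) \<and> c < length (flip_tableau n T ! b)"
  then have "c < length (T ! a)" using is_tableau_lengths[OF assms(1), of a b] by auto
  moreover have "T ! a ! c \<le> T ! b ! c"
    using assms(2) h length_flip(2)[of b T n] unfolding increasing_tableau_def length_flip(1) by metis
  ultimately show "flip_tableau n T ! b ! c \<le> flip_tableau n T ! a ! c"
    using h length_flip(2)[of b T n] length_flip(3)[of b T c n] length_flip(3)[of a T c n] by auto
qed

lemma rsk_antipreferred: "rsk n A \<in> antipreferred_bitableaux n"
proof -
  note P = interlacing_growth(1)[of n A] and Q = interlacing_growth(2)[of n A]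
  have "map length (chain_tableau n (\<lambda>i. growth A i n)) = map length (chain_tableau n (growth A n))"
    by (simp add: chain_tableau_def chain_length_def)
  moreover have "map length (flip_tableau n T) = map length T" for T by (simp add: flip_tableau_def)
  ultimately show ?thesis
    unfolding rsk_def antipreferred_bitableaux_def bitableaux_def
    using interlacing_chain.is_tableau_chain[OF P] is_tableau_flip[OF interlacing_chain.is_tableau_chain[OF Q]]
      interlacing_chain.increasing_chain[OF P]
      decreasing_flip[OF interlacing_chain.is_tableau_chain[OF Q] interlacing_chain.increasing_chain[OF Q]]
    by simp
qed

lemma rsk_boxes: "sum_list (map length (fst (rsk n A))) = (\<Sum>a<n. \<Sum>b<n. A a b)"
  unfolding rsk_def using interlacing_chain.chain_boxes[OF interlacing_growth(1)[of n A]]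
  by (simp add: sum_growth)

lemma rsk_inj:
  assumes eq: "rsk n A = rsk n B" and "a < n" "b < n"
  shows "A a b = B a b"
proof (rule growth_inj[OF _ _ assms(2,3)])
  have "chain_tableau n (\<lambda>i. growth A i n) = chain_tableau n (\<lambda>i. growth B i n)"
    using eq by (simp add: rsk_def)
  from chain_tableau_inj[OF interlacing_growth(1)[of n A] interlacing_growth(1)[of n B] this]
  show "growth A i n = growth B i n" if "i \<le> n" for i using that by blast
  have "flip_tableau n (chain_tableau n (growth A n)) = flip_tableau n (chain_tableau n (growth B n))"
    using eq by (simp add: rsk_def)
  then have "chain_tableau n (growth A n) = chain_tableau n (growth B n)"
    using flip_flip[OF interlacing_chain.is_tableau_chain[OF interlacing_growth(2)[of n A]]]
      flip_flip[OF interlacing_chain.is_tableau_chain[OF interlacing_growth(2)[of n B]]] by metis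
  from chain_tableau_inj[OF interlacing_growth(2)[of n A] interlacing_growth(2)[of n B] this]
  show "growth A n j = growth B n j" if "j \<le> n" for j using that by blast
qed

section \<open>Sorted words as matrices, and spanning\<close>

definition word_matrix :: "(nat \<times> nat) list \<Rightarrow> nat \<Rightarrow> nat \<Rightarrow> nat" where
  "word_matrix w a b = count_list w (Suc a, Suc b)"

text \<open>\<open>letter_le\<close> is antisymmetric, so two sorted words with the same letters
  begin alike.\<close>

lemma sorted_word_unique:
  "sorted_wrt letter_le v \<Longrightarrow> sorted_wrt letter_le w \<Longrightarrow> mset v = mset w \<Longrightarrow> v = w"
proof (induction v arbitrary: w)
  case (Cons x v)
  then obtain y w' where w: "w = y # w'" by (cases w) auto
  have "x \<in> set w" "y \<in> set (x # v)" using Cons.prems(3) w by (metis list.set_intros(1) set_mset_mset)+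
  then have "x = y \<or> (letter_le x y \<and> letter_le y x)" using Cons.prems(1,2) w by auto
  then have "x = y" using letter_le_antisym by blast
  then show ?case using Cons w by auto
qed simp

lemma word_matrix_inj:
  assumes "v \<in> sorted_words n d" "w \<in> sorted_words n d"
    and eq: "\<And>a b. a < n \<Longrightarrow> b < n \<Longrightarrow> word_matrix v a b = word_matrix w a b"
  shows "v = w"
proof (rule sorted_word_unique)
  have "count_list v x = count_list w x" for x
  proof (cases "x \<in> {1..n} \<times> {1..n}")
    case True
    then obtain a b where "x = (Suc a, Suc b)" "a < n" "b < n"
      by (cases x) (auto simp: Suc_le_eq gr0_conv_Suc)
    then show ?thesis using eq[of a b] by (simp add: word_matrix_def)
  next
    case False
    then have "x \<notin> set v" "x \<notin> set w" using assms by (auto simp: sorted_words_def)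
    then show ?thesis by (simp add: count_list_0_iff)
  qed
  then show "mset v = mset w" by (intro multiset_eqI) (simp add: count_mset)
qed (use assms in \<open>auto simp: sorted_words_def\<close>)

lemma sum_word_matrix:
  assumes "set w \<subseteq> {1..n} \<times> {1..n}"
  shows "(\<Sum>a<n. \<Sum>b<n. word_matrix w a b) = length w"
proof -
  have "(\<Sum>a<n. \<Sum>b<n. word_matrix w a b) = (\<Sum>i\<in>{1..n}. \<Sum>j\<in>{1..n}. count_list w (i, j))"
  proof -
    have shift: "(\<Sum>a<n. g (Suc a)) = (\<Sum>i\<in>{1..n}. g i)" for g :: "nat \<Rightarrow> nat"
      by (rule sum.reindex_bij_witness[of _ "\<lambda>i. i - 1" Suc]) auto
    have inner: "(\<Sum>b<n. count_list w (Suc a, Suc b)) = (\<Sum>j\<in>{1..n}. count_list w (Suc a, j))" for a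
      by (rule shift)
    show ?thesis unfolding word_matrix_def inner by (rule shift)
  qed
  also have "\<dots> = (\<Sum>x\<in>{1..n} \<times> {1..n}. count_list w x)"
    by (simp add: sum.cartesian_product)
  also have "\<dots> = length w" using assms by (intro sum_count_set) auto
  finally show ?thesis .
qed

text \<open>One bitableau for each sorted word makes the coefficient matrix \<open>M\<close> square.
  A relation among its rows would put a combination of antipreferred products into the ideal, so
  independence gives a solution for the unit vector at \<open>w\<^sub>0\<close>.\<close>

lemma sorted_word_span:
  assumes n: "0 < n" and q: "q \<noteq> (0::'k::field)" and w: "w\<^sub>0 \<in> sorted_words n d"
  shows "\<exists>F c. finite F \<and> F \<subseteq> antipreferred_bitableaux n \<and>
    word_monom w\<^sub>0 - (\<Sum>b\<in>F. scalar (c b) * free_bitableau q b) \<in> qmat_ideal n q"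
proof -
  interpret network n q by unfold_locales (rule q)
  let ?J = "sorted_words n d" and ?g = "\<lambda>w. rsk n (word_matrix w)"
  define B where "B = ?g ` ?J"
  have "inj_on ?g ?J"
    by (intro inj_onI word_matrix_inj) (use rsk_inj in blast)+
  then have card: "card ?J = card B" by (simp add: B_def card_image)
  have B: "B \<subseteq> antipreferred_bitableaux n" "finite B"
    using rsk_antipreferred finite_sorted_words by (auto simp: B_def)
  \<comment> \<open>The number of boxes is the sum of the matrix entries, which is the length
    \<open>d\<close> of the word; hence all these products expand in the same finite set of sorted
    words.\<close>
  have "spanned n q d (free_bitableau q b)" if b: "b \<in> B" for b
  proof -
    obtain w where w: "w \<in> ?J" "b = ?g w" using b by (auto simp: B_def)
    have "sum_list (map length (fst b)) = d"
      using rsk_boxes[of n "word_matrix w"] sum_word_matrix[of w n] w by (simp add: sorted_words_def)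
    then have "homogeneous d (free_bitableau q b)"
      using homogeneous_free_bitableau[of "fst b" "snd b" n q] B(1) b by auto
    then show ?thesis
      unfolding homogeneous_def
      by (intro spanned_homogeneous[OF q free_bitableau_carrier[OF subsetD[OF B(1) b]]]) blast
  qed
  then obtain M where M: "\<And>b. b \<in> B \<Longrightarrow>
      free_bitableau q b - (\<Sum>w\<in>?J. scalar (M b w) * word_monom w) \<in> qmat_ideal n q"
    unfolding spanned_def by metis
  have comb: "(\<Sum>b\<in>B. scalar (c b) * free_bitableau q b) -
      (\<Sum>w\<in>?J. scalar (\<Sum>b\<in>B. c b * M b w) * word_monom w) \<in> qmat_ideal n q" for c
  proof -
    have "(\<Sum>b\<in>B. scalar (c b) * (free_bitableau q b - (\<Sum>w\<in>?J. scalar (M b w) * word_monom w))) \<in> qmat_ideal n q"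
      by (intro qmat_ideal_sum qmat_ideal_closed(3) M scalar_in_carrier)
    moreover have "(\<Sum>b\<in>B. scalar (c b) * (\<Sum>w\<in>?J. scalar (M b w) * word_monom w)) =
      (\<Sum>w\<in>?J. scalar (\<Sum>b\<in>B. c b * M b w) * word_monom w)"
      by (simp add: sum_distrib_left mult.assoc[symmetric] scalar_mult scalar_sum sum_distrib_right)
        (rule sum.swap)
    ultimately show ?thesis by (simp add: right_diff_distrib sum_subtractf)
  qed
  have "\<exists>c. \<forall>w\<in>?J. (\<Sum>b\<in>B. c b * M b w) = (if w = w\<^sub>0 then 1 else 0)"
  proof (rule solvable_if_independent[OF finite_sorted_words B(2) card w])
    fix c b assume "\<forall>w\<in>?J. (\<Sum>b\<in>B. c b * M b w) = 0" "b \<in> B"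
    then show "c b = 0"
      using free_bitableau_independent[OF n B(2,1) _ \<open>b \<in> B\<close>, of c] comb[of c] by simp
  qed
  then obtain c where c: "\<forall>w\<in>?J. (\<Sum>b\<in>B. c b * M b w) = (if w = w\<^sub>0 then 1 else 0)" by blast
  have "(\<Sum>w\<in>?J. scalar (\<Sum>b\<in>B. c b * M b w) * word_monom w) = (\<Sum>w\<in>?J. if w = w\<^sub>0 then word_monom w else 0)"
    using c by (intro sum.cong refl) auto
  also have "\<dots> = (word_monom w\<^sub>0 :: 'k free_alg)"
    using w finite_sorted_words by simp
  finally have "(\<Sum>b\<in>B. scalar (c b) * free_bitableau q b) - word_monom w\<^sub>0 \<in> qmat_ideal n q"
    using comb[of c] by simp
  from qmat_ideal_closed(2)[OF this] show ?thesis using B by auto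
qed

lemma bitableau_span:
  assumes n: "0 < n" and q: "q \<noteq> (0::'k::field)" and f: "f \<in> free_carrier n"
  shows "\<exists>F c. finite F \<and> F \<subseteq> antipreferred_bitableaux n \<and>
    f - (\<Sum>b\<in>F. scalar (c b) * free_bitableau q b) \<in> qmat_ideal n q" (is "?P f")
proof -
  have add: "?P (g + h)" if gh: "?P g" "?P h" for g h
  proof -
    obtain F c where F: "finite F" "F \<subseteq> antipreferred_bitableaux n"
      "g - (\<Sum>b\<in>F. scalar (c b) * free_bitableau q b) \<in> qmat_ideal n q"
      using gh(1) by blast
    obtain G e where G: "finite G" "G \<subseteq> antipreferred_bitableaux n"
      "h - (\<Sum>b\<in>G. scalar (e b) * free_bitableau q b) \<in> qmat_ideal n q"
      using gh(2) by blast
    \<comment> \<open>Both coefficient families are extended by 0 to the union, so coefficients of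
      common bitableaux add.\<close>
    let ?c = "\<lambda>b. (if b \<in> F then c b else 0) + (if b \<in> G then e b else 0)"
    have F': "(\<Sum>b\<in>F \<union> G. scalar (if b \<in> F then c b else 0) * free_bitableau q b) = (\<Sum>b\<in>F. scalar (c b) * free_bitableau q b)"
      using F(1) G(1) by (intro sum.mono_neutral_cong_right) auto
    have G': "(\<Sum>b\<in>F \<union> G. scalar (if b \<in> G then e b else 0) * free_bitableau q b) = (\<Sum>b\<in>G. scalar (e b) * free_bitableau q b)"
      using F(1) G(1) by (intro sum.mono_neutral_cong_right) auto
    have "(\<Sum>b\<in>F \<union> G. scalar (?c b) * free_bitableau q b) =
      (\<Sum>b\<in>F. scalar (c b) * free_bitableau q b) + (\<Sum>b\<in>G. scalar (e b) * free_bitableau q b)"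
      unfolding scalar_add distrib_right sum.distrib F' G' ..
    then have "g + h - (\<Sum>b\<in>F \<union> G. scalar (?c b) * free_bitableau q b) \<in> qmat_ideal n q"
      using qmat_ideal_closed(1)[OF F(3) G(3)] by (simp add: algebra_simps)
    then show ?thesis using F G by (intro exI[of _ "F \<union> G"] exI[of _ ?c]) auto
  qed
  have scale: "?P (scalar a * g)" if "?P g" for a g
  proof -
    obtain F c where F: "finite F" "F \<subseteq> antipreferred_bitableaux n"
      "g - (\<Sum>b\<in>F. scalar (c b) * free_bitableau q b) \<in> qmat_ideal n q"
      using \<open>?P g\<close> by blast
    have "scalar a * g - (\<Sum>b\<in>F. scalar (a * c b) * free_bitableau q b) \<in> qmat_ideal n q"
      using qmat_ideal_closed(3)[OF F(3) scalar_in_carrier[of a]]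
      by (simp add: right_diff_distrib sum_distrib_left scalar_mult mult.assoc[symmetric])
    then show ?thesis using F by (intro exI[of _ F] exI[of _ "\<lambda>b. a * c b"]) auto
  qed
  have zero: "?P 0" by (intro exI[of _ "{}"]) auto
  have sums: "?P (sum h A)" if "\<And>x. x \<in> A \<Longrightarrow> ?P (h x)" for h :: "'x \<Rightarrow> 'k free_alg" and A
    using that
  proof (induction A rule: infinite_finite_induct)
    case (insert x A)
    have "?P (h x + sum h A)" using insert by (intro add) auto
    then show ?case using insert by simp
  qed (use zero in auto)
  have word: "?P (word_monom w)" if w: "set w \<subseteq> {1..n} \<times> {1..n}" for w
  proof -
    obtain c where c: "word_monom w - (\<Sum>v\<in>sorted_words n (length w). scalar (c v) * word_monom v) \<in> qmat_ideal n q"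
      using spanned_word[OF q w refl] unfolding spanned_def by blast
    have "?P (\<Sum>v\<in>sorted_words n (length w). scalar (c v) * word_monom v)"
      by (intro sums scale sorted_word_span[OF n q])
    then obtain F e where F: "finite F" "F \<subseteq> antipreferred_bitableaux n"
      "(\<Sum>v\<in>sorted_words n (length w). scalar (c v) * word_monom v) -
        (\<Sum>b\<in>F. scalar (e b) * free_bitableau q b) \<in> qmat_ideal n q" by blast
    have "word_monom w - (\<Sum>b\<in>F. scalar (e b) * free_bitableau q b) \<in> qmat_ideal n q"
      using qmat_ideal_closed(1)[OF c F(3)] by simp
    then show ?thesis using F by blast
  qed
  have "?P (\<Sum>w\<in>Poly_Mapping.keys f. scalar (Poly_Mapping.lookup f w) * word_monom (letters w))"
    by (intro sums scale word) (use f in \<open>auto simp: free_carrier_iff\<close>)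
  then show ?thesis using free_alg_expand[of f] by simp
qed

section \<open>The basis property in the quotient\<close>

lemma bitableau_sum_class:
  assumes "finite F" "F \<subseteq> antipreferred_bitableaux n"
  shows "(\<Oplus>\<^bsub>qmat n q\<^esub> b\<in>F. c b \<odot>\<^bsub>qmat n q\<^esub> bitableau_prod n q b) =
    qmat_class n q (\<Sum>b\<in>F. scalar (c b) * free_bitableau q b)"
proof -
  interpret Q: ring "qmat n q" by (rule qmat_ring)
  have car: "scalar (c b) * free_bitableau q b \<in> free_carrier n" if "b \<in> F" for b
    by (intro free_carrier_closed(4) scalar_in_carrier free_bitableau_carrier subsetD[OF assms(2) that])
  have trm: "qmat_class n q (scalar (c b) * free_bitableau q b) = c b \<odot>\<^bsub>qmat n q\<^esub> bitableau_prod n q b"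
    if "b \<in> F" for b
    unfolding bitableau_prod_eq_class[OF subsetD[OF assms(2) that]]
    by (rule qmat_class_hom(4)[OF free_bitableau_carrier[OF subsetD[OF assms(2) that]] free_carrier_closed(1)])
  have "qmat_class n q (\<Sum>b\<in>F. scalar (c b) * free_bitableau q b) =
    (\<Oplus>\<^bsub>qmat n q\<^esub> b\<in>F. qmat_class n q (scalar (c b) * free_bitableau q b))"
    by (rule qmat_class_sum[OF assms(1) car])
  also have "\<dots> = (\<Oplus>\<^bsub>qmat n q\<^esub> b\<in>F. c b \<odot>\<^bsub>qmat n q\<^esub> bitableau_prod n q b)"
  proof (rule Q.finsum_cong'[OF refl])
    show "(\<lambda>b. c b \<odot>\<^bsub>qmat n q\<^esub> bitableau_prod n q b) \<in> F \<rightarrow> carrier (qmat n q)"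
      by (rule Pi_I) (simp add: trm[symmetric] qmat_class_hom(1)[OF car free_carrier_closed(1)])
  qed (rule trm)
  finally show ?thesis by simp
qed

theorem theorem5p4:
  fixes n :: nat and q :: "'k::field"
  assumes "n \<ge> 1" and "q \<noteq> 0"
  shows "is_basis (ring_of_type_algebra :: 'k ring) (qmat n q)
           (antipreferred_bitableaux n) (bitableau_prod n q)"
  unfolding is_basis_def
proof (intro conjI allI impI ballI)
  have n: "0 < n" using assms(1) by simp
  interpret network n q by unfold_locales (rule assms(2))
  have sum_carrier: "(\<Sum>b\<in>F. scalar (c b) * free_bitableau q b) \<in> free_carrier n"
    if "F \<subseteq> antipreferred_bitableaux n" for F c
    using that by (intro free_carrier_sum free_carrier_closed(4) scalar_in_carrier free_bitableau_carrier) (rule subsetD)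
  show "bitableau_prod n q \<in> antipreferred_bitableaux n \<rightarrow> carrier (qmat n q)"
    by (rule Pi_I) (simp add: bitableau_prod_eq_class qmat_class_hom(1)[OF free_bitableau_carrier free_carrier_closed(1)])
  show "c i = \<zero>\<^bsub>ring_of_type_algebra\<^esub>"
    if F: "finite F \<and> F \<subseteq> antipreferred_bitableaux n \<and> c \<in> F \<rightarrow> carrier ring_of_type_algebra \<and>
        (\<Oplus>\<^bsub>qmat n q\<^esub> i\<in>F. c i \<odot>\<^bsub>qmat n q\<^esub> bitableau_prod n q i) = \<zero>\<^bsub>qmat n q\<^esub>"
      and i: "i \<in> F" for F and c :: "tableau \<times> tableau \<Rightarrow> 'k" and i
  proof -
    have "qmat_class n q (\<Sum>b\<in>F. scalar (c b) * free_bitableau q b) = qmat_class n q 0"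
      using F bitableau_sum_class[of F n q c] qmat_class_hom(5)[OF free_carrier_closed(1,1), of n q] by simp
    then have "(\<Sum>b\<in>F. scalar (c b) * free_bitableau q b) \<in> qmat_ideal n q"
      using qmat_class_eq_iff[OF sum_carrier free_carrier_closed(1)] F by simp
    then show ?thesis
      using free_bitableau_independent[OF n _ _ _ i] F by (simp add: ring_of_type_algebra_def)
  qed
  show "\<exists>F c. finite F \<and> F \<subseteq> antipreferred_bitableaux n \<and> c \<in> F \<rightarrow> carrier (ring_of_type_algebra :: 'k ring) \<and>
      x = (\<Oplus>\<^bsub>qmat n q\<^esub> i\<in>F. c i \<odot>\<^bsub>qmat n q\<^esub> bitableau_prod n q i)"
    if x: "x \<in> carrier (qmat n q)" for x
  proof -
    obtain f where f: "f \<in> free_carrier n" "x = qmat_class n q f" using x by (auto simp: qmat_carrier)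
    obtain F c where F: "finite F" "F \<subseteq> antipreferred_bitableaux n"
      "f - (\<Sum>b\<in>F. scalar (c b) * free_bitableau q b) \<in> qmat_ideal n q"
      using bitableau_span[OF n assms(2) f(1)] by blast
    then have "x = (\<Oplus>\<^bsub>qmat n q\<^esub> i\<in>F. c i \<odot>\<^bsub>qmat n q\<^esub> bitableau_prod n q i)"
      using f qmat_class_eq_iff[OF f(1) sum_carrier] by (simp add: bitableau_sum_class)
    then show ?thesis using F by (intro exI[of _ F] exI[of _ c]) (auto simp: ring_of_type_algebra_def)
  qed
qed

end
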